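(* Let $r\in\{1,2,3\}$ and let $L$ be an extremal even unimodular lattice of rank $40r$. Then $L$ is generated (as a $\mathbb{Z}$-module) by the set of its vectors of norm $4r$ together with the set of its vectors of norm $4r+2$; that is, $L=\mathcal{L}_{4r+(4r+2)}(L)$, where $\mathcal{L}_{4r+(4r+2)}(L)$ denotes the sublattice of $L$ generated by $\{x\in L:\langle x,x\rangle=4r\}\cup\{x\in L:\langle x,x\rangle=4r+2\}$.
   Context: A lattice of rank $n$ is a free $\mathbb{Z}$-module of rank $n$ with a positive-definite inner product $\langle\cdot,\cdot\rangle$ into $\mathbb{R}$; the norm of $x$ is $\langle x,x\rangle$. $L$ is even if $\langle x,x\rangle\in 2\mathbb{Z}$ for all $x\in L$, and unimodular if it equals its dual $L^*=\{y\in L\otimes\mathbb{R}:\langle x,y\rangle\in\mathbb{Z}\ \forall x\in L\}$. For an even unimodular lattice of rank $n$, the minimal nonzero norm is at most $2\lfloor n/24\rfloor+2$; the lattice is called extremal if its minimal nonzero norm equals $2\lfloor n/24\rfloor+2$. (For rank $40r$ with $r=1,2,3$ this minimal norm is $4r$.) *)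

theory Defs
  imports "HOL-Analysis.Analysis"
begin

global_interpretation zmod: module "\<lambda>(k::int) (x::'a::real_vector). of_int k *\<^sub>R x"
  defines zspan = zmod.span
  by unfold_locales (simp_all add: scaleR_add_right scaleR_add_left)

(* A lattice is represented inside a real inner product space, where L tensor R is span L.
   Linear independence of the basis is over the reals: this gives freeness of rank n and makes
   the inner product positive definite on L tensor R, not just on L. The ambient space may be
   larger than span L. *)
definition lattice_of_rank :: "nat \<Rightarrow> 'a::real_inner set \<Rightarrow> bool" where
  "lattice_of_rank n L \<longleftrightarrow>
     (\<exists>B. finite B \<and> card B = n \<and> independent B \<and> L = zspan B)"

definition even_lattice :: "'a::real_inner set \<Rightarrow> bool" where
  "even_lattice L \<longleftrightarrow> (\<forall>x\<in>L. \<exists>k::int. x \<bullet> x = 2 * of_int k)"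

definition dual_lattice :: "'a::real_inner set \<Rightarrow> 'a set" where
  "dual_lattice L = {y \<in> span L. \<forall>x\<in>L. x \<bullet> y \<in> \<int>}"

definition unimodular :: "'a::real_inner set \<Rightarrow> bool" where
  "unimodular L \<longleftrightarrow> L = dual_lattice L"

(* The norm of a vector x is the quadratic value x \<bullet> x, not its square root. *)
definition is_min_norm :: "'a::real_inner set \<Rightarrow> real \<Rightarrow> bool" where
  "is_min_norm L m \<longleftrightarrow>
     (\<exists>x\<in>L. x \<noteq> 0 \<and> x \<bullet> x = m) \<and> (\<forall>x\<in>L. x \<noteq> 0 \<longrightarrow> m \<le> x \<bullet> x)"

definition extremal_even_unimodular :: "nat \<Rightarrow> 'a::real_inner set \<Rightarrow> bool" where
  "extremal_even_unimodular n L \<longleftrightarrow>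
     lattice_of_rank n L \<and> even_lattice L \<and> unimodular L \<and>
     is_min_norm L (real (2 * (n div 24) + 2))"

definition shell :: "'a::real_inner set \<Rightarrow> real \<Rightarrow> 'a set" where
  "shell L m = {x \<in> L. x \<bullet> x = m}"

definition two_shell_lattice :: "'a::real_inner set \<Rightarrow> real \<Rightarrow> real \<Rightarrow> 'a set" where
  "two_shell_lattice L a b = zspan (shell L a \<union> shell L b)"

end

(*
If the two shells do not generate L, let x be a vector of least norm T outside the lattice M they
generate. Then T >= 4r + 4, and for y in either shell the minimality of x compared with x - y and
x + y gives |x . y| <= (y . y) / 2, so the inner products x . y take few integer values.

The Taylor coefficients of the Jacobi theta function
  sum over y in L of q^(y . y / 2) exp(s x . y)
in s, corrected by a factor exp(- T/24 E2 s^2), are modular forms. This follows from Poisson summation for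
Gaussians on lattices, which is proved by induction on a basis from the one-dimensional case.
Multiplying such a form by a product of E4 and E6 and dividing by a power of Delta gives a weakly
holomorphic form of weight 2, whose constant term vanishes. Since L has no vectors of norm strictly
between 0 and 4r, this is a linear relation among the even moments of x . y over the two shells.
Together with the bounds on x . y these relations are contradictory.

Delta is q times the 24th power of the series in the pentagonal number theorem. The theorem identifies
this series with Euler's product, so Delta does not vanish, and Poisson summation applied to the
series gives the transformation law. E2, E4 and E6 are obtained from Delta by logarithmic and Serre
derivatives.
*)

theory Submission
  imports Defs "HOL-Probability.Probability" "HOL-Complex_Analysis.Complex_Analysis"
begin

section \<open>Poisson summation for Gaussians\<close>

text \<open>The weight bookkeeping decides which moments can be found. Half the rank is 20r, so
  weight 2 requires 4a + 6b + 20r + 2k = 12j + 2 for the \<open>2 * k\<close>-th moment, multiplier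
  \<open>E4 ^ a * E6 ^ b\<close> and divisor \<open>Delta ^ j\<close>. For j = 2r this reads 4a + 6b
  + 2k = 4r + 2 and involves only the shell of norm 4r; for j = 2r + 1 it reads 4a + 6b + 2k = 4r +
  14 and involves both shells. The first family fixes the moments with k < 2r and ties k = 2r + 1 to
  k = 2r. At k = 2r it says nothing, because 4a + 6b = 2 has no solution, and it ends before k = 2r
  + 2. Hence two unknowns remain; the second family expresses the other shell through them. The
  bounds on x . y make one polynomial in (x . y)^2 vanish on each shell. Used twice on the first
  shell and once on the second, they give three linear equations for two unknowns, consistent only
  if a polynomial in T = x . x vanishes. The inversion laws of theta series and \<open>Delta\<close>
  are checked on the imaginary axis only, where Gaussians are real and the identity theorem supplies
  the rest.\<close>

inductive trig_poly :: "(complex \<Rightarrow> complex) \<Rightarrow> bool" where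
  trig_poly_monom: "trig_poly (\<lambda>z. c * z powi m)"
| trig_poly_add: "trig_poly f \<Longrightarrow> trig_poly g \<Longrightarrow> trig_poly (\<lambda>z. f z + g z)"

text \<open>The addition law of \<open>powi\<close> may fail at 0, so closure under products is
  claimed on the unit circle only.\<close>

lemma trig_poly_mult_monom:
  assumes "trig_poly f"
  shows "\<exists>h. trig_poly h \<and> (\<forall>z\<in>sphere 0 1. h z = f z * (c * z powi m))"
  using assms
proof induction
  case (trig_poly_monom c' m')
  have "z powi (m' + m) = z powi m' * z powi m" if "cmod z = 1" for z
    using that by (intro power_int_add) auto
  then show ?case
    by (intro exI[of _ "\<lambda>z. (c' * c) * z powi (m' + m)"]) (auto intro: trig_poly.intros)
next
  case (trig_poly_add f g)
  then obtain hf hg where "trig_poly hf" "\<forall>z\<in>sphere 0 1. hf z = f z * (c * z powi m)"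
    "trig_poly hg" "\<forall>z\<in>sphere 0 1. hg z = g z * (c * z powi m)" by blast
  then show ?case
    by (intro exI[of _ "\<lambda>z. hf z + hg z"]) (auto intro: trig_poly.intros simp: algebra_simps)
qed

lemma trig_poly_mult:
  assumes "trig_poly f" "trig_poly g"
  shows "\<exists>h. trig_poly h \<and> (\<forall>z\<in>sphere 0 1. h z = f z * g z)"
  using assms(2)
proof induction
  case (trig_poly_monom c m)
  show ?case using trig_poly_mult_monom[OF assms(1)] .
next
  case (trig_poly_add g g')
  then obtain h h' where "trig_poly h" "\<forall>z\<in>sphere 0 1. h z = f z * g z"
    "trig_poly h'" "\<forall>z\<in>sphere 0 1. h' z = f z * g' z" by blast
  then show ?case
    by (intro exI[of _ "\<lambda>z. h z + h' z"]) (auto intro: trig_poly.intros simp: algebra_simps)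
qed

text \<open>On the unit circle 1/z is the conjugate of z, so Re z and Im z are combinations of
  \<open>z powi 1\<close> and \<open>z powi (-1)\<close>; sums and products carry this to all
  polynomials in the two coordinates.\<close>

lemma real_polynomial_function_trig_poly:
  assumes "real_polynomial_function p"
  shows "\<exists>h. trig_poly h \<and> (\<forall>z\<in>sphere 0 1. h z = of_real (p z))"
  using assms
proof induction
  case (linear l)
  have "l z = Re z * l 1 + Im z * l \<i>" for z
  proof -
    interpret bounded_linear l by fact
    have "l z = l (Re z *\<^sub>R 1 + Im z *\<^sub>R \<i>)"
      by (rule arg_cong[where f = l]) (auto simp: complex_eq_iff)
    then show ?thesis by (simp add: add scale)
  qed
  moreover have "(of_real (l 1) / 2 - \<i> * of_real (l \<i>) / 2) * z powi 1 
        + (of_real (l 1) / 2 + \<i> * of_real (l \<i>) / 2) * z powi (-1) 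
        = of_real (Re z * l 1 + Im z * l \<i>)" if "z \<in> sphere 0 1" for z
  proof -
    have "z * cnj z = 1" using that by (simp add: complex_norm_square[symmetric])
    then have "z powi (-1) = cnj z"
      by (simp add: power_int_minus) (metis inverse_unique)
    then show ?thesis by (simp add: complex_eq_iff)
  qed
  ultimately show ?case
    by (intro exI[of _ "\<lambda>z. (of_real (l 1) / 2 - \<i> * of_real (l \<i>) / 2) * z powi 1 
        + (of_real (l 1) / 2 + \<i> * of_real (l \<i>) / 2) * z powi (-1)"] conjI ballI
        trig_poly.intros) metis
next
  case (const c)
  show ?case
    using trig_poly_monom[of "of_real c" 0] by (intro exI[of _ "\<lambda>z. of_real c * z powi 0"]) auto
next
  case (add f g)
  then obtain h h' where "trig_poly h" "\<forall>z\<in>sphere 0 1. h z = of_real (f z)"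
    "trig_poly h'" "\<forall>z\<in>sphere 0 1. h' z = of_real (g z)" by blast
  then show ?case
    by (intro exI[of _ "\<lambda>z. h z + h' z"]) (auto intro: trig_poly.intros)
next
  case (mult f g)
  then obtain h h' where h: "trig_poly h" "\<forall>z\<in>sphere 0 1. h z = of_real (f z)"
    "trig_poly h'" "\<forall>z\<in>sphere 0 1. h' z = of_real (g z)" by blast
  from trig_poly_mult[OF h(1,3)] h(2,4) show ?case by auto
qed

lemma trig_poly_dense:
  assumes "continuous_on (sphere 0 1) (f :: complex \<Rightarrow> complex)" "e > 0"
  shows "\<exists>h. trig_poly h \<and> (\<forall>z\<in>sphere 0 1. norm (f z - h z) < e)"
proof -
  obtain p where p: "polynomial_function p" "\<forall>z\<in>sphere 0 1. norm (f z - p z) < e"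
    using Stone_Weierstrass_polynomial_function[OF compact_sphere assms] by blast
  have "real_polynomial_function (Re \<circ> p)" "real_polynomial_function (Im \<circ> p)"
    using p(1) bounded_linear_Re bounded_linear_Im unfolding polynomial_function_def by blast+
  then obtain u v where u: "trig_poly u" "\<forall>z\<in>sphere 0 1. u z = of_real (Re (p z))"
     and v: "trig_poly v" "\<forall>z\<in>sphere 0 1. v z = of_real (Im (p z))"
    using real_polynomial_function_trig_poly unfolding o_def by metis
  obtain w where w: "trig_poly w" "\<forall>z\<in>sphere 0 1. w z = v z * (\<i> * z powi 0)"
    using trig_poly_mult_monom[OF v(1)] by blast
  have "u z + w z = p z" if "z \<in> sphere 0 1" for z
    using that u v w by (simp add: complex_eq_iff)
  then show ?thesis using p(2) trig_poly_add[OF u(1) w(1)] by (metis (no_types, lifting))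
qed

text \<open>Against every trigonometric polynomial \<open>g\<close> integrates to zero.
  Approximating the conjugate of \<open>g\<close> uniformly by such polynomials bounds the integral
  of |g|^2 by e times that of |g| for every e > 0, so it is zero.\<close>

lemma Fourier_coefficients_zero_imp_zero:
  fixes g :: "real \<Rightarrow> complex"
  assumes cont: "continuous_on UNIV g"
    and per: "\<And>x. g (x + 1) = g x"
    and coeff: "\<And>m::int. integral {0..1} (\<lambda>x. g x * cis (2 * pi * m * x)) = 0"
  shows "g x = 0"
proof -
  have cg: "continuous_on A g" for A using cont continuous_on_subset by blast
  have int_trig: "integral {0..1} (\<lambda>x. g x * h (cis (2 * pi * x))) = 0 \<and> 
     (\<lambda>x. g x * h (cis (2 * pi * x))) integrable_on {0..1}" if "trig_poly h" for h
    using that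
  proof induction
    case (trig_poly_monom c m)
    have *: "g x * (c * cis (2 * pi * x) powi m) = c * (g x * cis (2 * pi * m * x))" for x
      by (simp add: cis_power_int mult_ac)
    have "(\<lambda>x. g x * cis (2 * pi * m * x)) integrable_on {0..1}"
      by (intro integrable_continuous_interval continuous_intros cg)
    then show ?case unfolding * by (simp add: coeff integrable_on_mult_right)
  next
    case (trig_poly_add f h)
    then show ?case by (simp add: ring_distribs integral_add integrable_add)
  qed
  have per_int: "g (x + of_int k) = g x" for x k
  proof (induction k rule: int_induct[of _ 0])
    case base then show ?case by simp
  next
    case (step1 i) then show ?case using per[of "x + of_int i"] by (simp add: add.assoc)
  next
    case (step2 i) then show ?case using per[of "x + of_int i - 1"] by (simp add: algebra_simps)
  qed
  define G where "G z = g (Arg z / (2 * pi))" for z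
  have G_cis: "G (cis (2 * pi * y)) = g y" for y
  proof -
    obtain k :: int where "Arg (cis (2 * pi * y)) = 2 * pi * y + 2 * pi * k"
    proof -
      have "cis (Arg (cis (2 * pi * y))) = cis (2 * pi * y)" 
        using cis_Arg[of "cis (2*pi*y)"] by (simp add: sgn_div_norm)
      then have "sin (Arg (cis (2 * pi * y))) = sin (2 * pi * y) \<and> cos (Arg (cis (2 * pi * y))) = cos (2 * pi * y)"
        by (simp add: complex_eq_iff)
      then show ?thesis using that sin_cos_eq_iff by (metis mult.assoc mult.commute)
    qed
    then have "Arg (cis (2 * pi * y)) / (2 * pi) = y + of_int k" by (simp add: field_simps)
    then show ?thesis using per_int[of y k] by (simp add: G_def)
  qed
  have "continuous_on (sphere 0 1) G"
  proof -
    \<comment> \<open>\<open>Arg\<close> jumps on the negative axis, so continuity of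
      \<open>G\<close> cannot be read off its formula. Wrapping a compact interval onto the
      Hausdorff circle is a quotient map, and \<open>G\<close> composed with it is the continuous
      \<open>g\<close>.\<close>
    have "quotient_map (top_of_set {0..1::real}) (top_of_set (sphere 0 1)) (\<lambda>x. cis (2 * pi * x))"
    proof (rule continuous_imp_quotient_map)
      show "continuous_map (top_of_set {0..1}) (top_of_set (sphere 0 1)) (\<lambda>x. cis (2 * pi * x))"
        by (auto simp: continuous_map_in_subtopology intro!: continuous_intros)
      show "compact_space (top_of_set {0..1::real})" by (simp add: compact_space_subtopology)
      show "Hausdorff_space (top_of_set (sphere (0::complex) 1))"
        by (intro Hausdorff_space_subtopology Hausdorff_space_euclidean)
      have "\<exists>x\<in>{0..1}. z = cis (2 * pi * x)" if "cmod z = 1" for z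
      proof
        show "z = cis (2 * pi * (Arg2pi z / (2 * pi)))"
          using that Arg2pi_eq[of z] by (simp add: cis_conv_exp)
        show "Arg2pi z / (2 * pi) \<in> {0..1}"
          using Arg2pi_ge_0[of z] Arg2pi_lt_2pi[of z] by simp
      qed
      then show "(\<lambda>x. cis (2 * pi * x)) ` topspace (top_of_set {0..1::real}) = topspace (top_of_set (sphere 0 1))"
        by (fastforce simp: image_def)
    qed
    then have "continuous_map (top_of_set (sphere 0 1)) euclidean G"
      by (rule continuous_compose_quotient_map) (simp add: o_def G_cis cg)
    then show ?thesis by simp
  qed
  then have contG: "continuous_on (sphere 0 1) (\<lambda>z. cnj (G z))" by (intro continuous_intros)
  define K where "K = integral {0..1} (\<lambda>x. norm (g x))"
  have K: "K \<ge> 0" unfolding K_def by (intro integral_nonneg integrable_continuous_interval continuous_intros cg) auto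
  define I where "I = integral {0..1} (\<lambda>x. norm (g x) ^ 2)"
  have ig: "(\<lambda>x. g x * cnj (g x)) integrable_on {0..1}"
    by (intro integrable_continuous_interval continuous_intros cg)
  have I_bound: "I \<le> e * K" if "e > 0" for e
  proof -
    obtain h where h: "trig_poly h" "\<forall>z\<in>sphere 0 1. norm (cnj (G z) - h z) < e"
      using trig_poly_dense[OF contG \<open>e > 0\<close>] by blast
    have "complex_of_real I = integral {0..1} (\<lambda>x. of_real (norm (g x) ^ 2))"
      unfolding I_def by (subst integral_linear[OF _ bounded_linear_of_real, symmetric, unfolded o_def])
         (auto intro!: integrable_continuous_interval continuous_intros cg)
    also have "\<dots> = integral {0..1} (\<lambda>x. g x * cnj (g x))"
      by (simp only: complex_norm_square)
    also have "\<dots> = integral {0..1} (\<lambda>x. g x * cnj (g x) - g x * h (cis (2 * pi * x)))"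
      using int_trig[OF h(1)] ig by (subst integral_diff) auto
    finally have "I = norm (integral {0..1} (\<lambda>x. g x * cnj (g x) - g x * h (cis (2 * pi * x))))"
    proof -
      assume a: "complex_of_real I = integral {0..1} (\<lambda>x. g x * cnj (g x) - g x * h (cis (2 * pi * x)))"
      have "I \<ge> 0" unfolding I_def by (intro integral_nonneg integrable_continuous_interval continuous_intros cg) auto
      then show ?thesis unfolding a[symmetric] by simp
    qed
    also have "\<dots> \<le> integral {0..1} (\<lambda>x. e * norm (g x))"
    proof (rule integral_norm_bound_integral)
      show "(\<lambda>x. g x * cnj (g x) - g x * h (cis (2 * pi * x))) integrable_on {0..1}"
        using int_trig[OF h(1)] ig by (intro integrable_diff) auto
      show "(\<lambda>x. e * norm (g x)) integrable_on {0..1}"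
        by (intro integrable_continuous_interval continuous_intros cg)
      fix x :: real assume "x \<in> {0..1}"
      have "norm (cnj (g x) - h (cis (2 * pi * x))) < e"
        using h(2)[rule_format, of "cis (2 * pi * x)"] by (simp add: G_cis)
      then show "norm (g x * cnj (g x) - g x * h (cis (2 * pi * x))) \<le> e * norm (g x)"
        using mult_left_mono[of "norm (cnj (g x) - h (cis (2 * pi * x)))" e "norm (g x)"]
        by (simp only: right_diff_distrib[symmetric] norm_mult) (simp add: mult.commute)
    qed
    also have "\<dots> = e * K" by (simp add: K_def)
    finally show ?thesis .
  qed
  have "I \<le> 0"
  proof (rule field_le_epsilon)
    fix e :: real assume "e > 0"
    have "I \<le> (e / (K + 1)) * K" using \<open>e > 0\<close> K by (intro I_bound) auto
    also have "\<dots> \<le> e" using \<open>e > 0\<close> K by (simp add: field_simps)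
    finally show "I \<le> 0 + e" by simp
  qed
  moreover have "I \<ge> 0" unfolding I_def by (intro integral_nonneg integrable_continuous_interval continuous_intros cg) auto
  ultimately have "integral (cbox 0 1) (\<lambda>x. norm (g x) ^ 2) = 0" by (simp add: I_def)
  then have *: "\<forall>x\<in>{0..1}. g x = 0"
    by (subst (asm) integral_cbox_eq_0_iff) (auto intro!: continuous_intros cg)
  have "x = frac x + of_int \<lfloor>x\<rfloor>" by (simp add: frac_def)
  then have "g x = g (frac x)" using per_int[of "frac x" "\<lfloor>x\<rfloor>"] by metis
  moreover have "frac x \<in> {0..1}" using frac_ge_0[of x] frac_lt_1[of x] by simp
  ultimately show ?thesis using * by metis
qed

section \<open>The Fourier transform of the Gaussian\<close>

lemma gaussian_Fourier_transform:
  fixes t c :: real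
  assumes t: "t > 0"
  defines "f \<equiv> \<lambda>x. of_real (exp (- pi * t * x\<^sup>2)) * cis (2 * pi * c * x)"
  shows "integrable lborel f"
    and "integral\<^sup>L lborel f = of_real (exp (- pi * c\<^sup>2 / t) / sqrt t)"
proof -
  \<comment> \<open>Scaling by \<open>k\<close> turns the standard normal density into the Gaussian
    with parameter \<open>t\<close>; the transform is then the characteristic function of the normal
    distribution.\<close>
  define k where "k = sqrt (2 * pi * t)"
  have k: "k > 0" "k\<^sup>2 = 2 * pi * t" using t by (auto simp: k_def)
  define s where "s = 2 * pi * c / k"
  let ?d = "\<lambda>x. std_normal_density x *\<^sub>R iexp (s * x)"
  have eq: "?d (0 + k * x) = of_real (1 / sqrt (2 * pi)) * f x" for x
  proof -
    have "(k * x)\<^sup>2 / 2 = pi * t * x\<^sup>2" using k by (simp add: power_mult_distrib)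
    moreover have "s * (k * x) = 2 * pi * c * x" using k by (simp add: s_def)
    ultimately have "exp (- (k * x)\<^sup>2 / 2) = exp (- pi * t * x\<^sup>2)" "iexp (s * (k * x)) = cis (2 * pi * c * x)"
      by (simp_all only: cis_conv_exp) simp
    then show ?thesis
      by (simp add: std_normal_density_def f_def scaleR_conv_of_real)
  qed
  have int_d: "integrable lborel ?d"
    by (rule Bochner_Integration.integrable_bound[OF integrable_normal_density[of 1 0]])
       (auto simp: norm_mult)
  have val_d: "integral\<^sup>L lborel ?d = of_real (exp (- s\<^sup>2 / 2))"
  proof -
    have "char std_normal_distribution s = integral\<^sup>L lborel ?d"
      unfolding char_def by (subst integral_density) auto
    then show ?thesis by (simp add: char_std_normal_distribution)
  qed
  have "integrable lborel (\<lambda>x. ?d (0 + k * x))"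
    using lborel_integrable_real_affine[OF int_d, of k 0] k by simp
  then have "integrable lborel (\<lambda>x. of_real (1 / sqrt (2 * pi)) * f x)" by (simp only: eq)
  then have "integrable lborel (\<lambda>x. of_real (sqrt (2 * pi)) * (of_real (1 / sqrt (2 * pi)) * f x))"
    by (rule integrable_mult_right)
  moreover have "(of_real (sqrt (2 * pi)) * (of_real (1 / sqrt (2 * pi)) * f x)) = f x" for x
    by (simp flip: of_real_mult mult.assoc)
  ultimately show int: "integrable lborel f" by simp
  have "of_real (exp (- s\<^sup>2 / 2)) = \<bar>k\<bar> *\<^sub>R integral\<^sup>L lborel (\<lambda>x. ?d (0 + k * x))"
    unfolding val_d[symmetric] by (rule lborel_integral_real_affine) (use k in simp)
  also have "\<dots> = of_real (k / sqrt (2 * pi)) * integral\<^sup>L lborel f"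
    unfolding eq using k by (simp add: scaleR_conv_of_real)
  also have "k / sqrt (2 * pi) = sqrt t" by (simp add: k_def real_sqrt_mult)
  finally have "of_real (exp (- s\<^sup>2 / 2)) = of_real (sqrt t) * integral\<^sup>L lborel f" .
  moreover have "- s\<^sup>2 / 2 = - pi * c\<^sup>2 / t"
    using k t unfolding s_def power_divide k(2) by (simp add: field_simps power2_eq_square)
  ultimately have "of_real (exp (- pi * c\<^sup>2 / t)) = of_real (sqrt t) * integral\<^sup>L lborel f"
    by (simp only:)
  then show "integral\<^sup>L lborel f = of_real (exp (- pi * c\<^sup>2 / t) / sqrt t)"
    using t by (simp add: field_simps)
qed

text \<open>The truncation to [-n, n] is the one met in Poisson summation, where the translates with
  shifts in {-n..<n} are integrated over [0, 1].\<close>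

lemma gaussian_Fourier_transform_limit:
  fixes t c :: real
  assumes t: "t > 0"
  defines "f \<equiv> \<lambda>x. of_real (exp (- pi * t * x\<^sup>2)) * cis (2 * pi * c * x)"
  shows "(\<lambda>n. integral {- real n..real n} f) \<longlonglongrightarrow> of_real (exp (- pi * c\<^sup>2 / t) / sqrt t)"
proof -
  note F = gaussian_Fourier_transform[OF t, of c, folded f_def]
  have "(\<lambda>n. integral\<^sup>L lborel (\<lambda>x. indicator {- real n..real n} x *\<^sub>R f x)) \<longlonglongrightarrow> integral\<^sup>L lborel f"
  proof (rule integral_dominated_convergence)
    show "integrable lborel (\<lambda>x. norm (f x))" using F(1) by simp
    show "f \<in> borel_measurable lborel" using F(1) by auto
    show "(\<lambda>x. indicator {- real n..real n} x *\<^sub>R f x) \<in> borel_measurable lborel" for n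
      using F(1) by measurable
    show "AE x in lborel. (\<lambda>n. indicat_real {- real n..real n} x *\<^sub>R f x) \<longlonglongrightarrow> f x"
    proof (rule AE_I2)
      fix x :: real
      obtain N where N: "\<bar>x\<bar> \<le> real N" using real_arch_simple by blast
      have "eventually (\<lambda>n. indicat_real {- real n..real n} x *\<^sub>R f x = f x) sequentially"
        using eventually_ge_at_top[of N] by eventually_elim (use N in \<open>auto simp: indicator_def\<close>)
      then show "(\<lambda>n. indicat_real {- real n..real n} x *\<^sub>R f x) \<longlonglongrightarrow> f x"
        by (rule tendsto_eventually)
    qed
    show "AE x in lborel. norm (indicat_real {- real n..real n} x *\<^sub>R f x) \<le> norm (f x)" for n
      by (auto simp: indicator_def)
  qed
  moreover have "integral\<^sup>L lborel (\<lambda>x. indicator {- real n..real n} x *\<^sub>R f x) = integral {- real n..real n} f" for n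
  proof -
    have "set_integrable lborel {- real n..real n} f"
      using integrable_mult_indicator[OF _ F(1)] by (simp add: set_integrable_def)
    then show ?thesis using set_borel_integral_eq_integral(2) by (simp add: set_lebesgue_integral_def)
  qed
  ultimately show ?thesis using F(2) by simp
qed

section \<open>Poisson summation over the integers\<close>

lemma summable_gaussian_nat: "c > 0 \<Longrightarrow> summable (\<lambda>n. exp (- c * (real n)\<^sup>2))"
proof (rule summable_comparison_test'[of "\<lambda>n. exp (- c) ^ n" 0])
  assume "c > 0"
  then show "summable (\<lambda>n. exp (- c) ^ n)" by (simp add: summable_geometric_iff)
  fix n :: nat
  have "real n \<le> (real n)\<^sup>2" by (cases n) (auto simp: power2_eq_square)
  then have "- c * (real n)\<^sup>2 \<le> real n * - c" using \<open>c > 0\<close> by simp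
  then show "norm (exp (- c * (real n)\<^sup>2)) \<le> exp (- c) ^ n"
    by (simp flip: exp_of_nat_mult)
qed

text \<open>Pairing n with - n - 1 runs through the integers without meeting 0 twice, and the first
  n pairs cover exactly {-n..<n}.\<close>

lemma summable_on_int:
  fixes f :: "int \<Rightarrow> 'a::banach"
  assumes "summable (\<lambda>n. norm (f (int n)))" "summable (\<lambda>n. norm (f (- int n - 1)))"
  shows "(\<lambda>k. norm (f k)) summable_on UNIV"
    "(f has_sum (\<Sum>n. f (int n) + f (- int n - 1))) UNIV"
proof -
  have inj: "inj int" "inj (\<lambda>n. - int n - 1)" by (auto simp: inj_on_def)
  have U: "range int \<union> range (\<lambda>n. - int n - 1) = UNIV"
  proof -
    have "x \<in> range int \<union> range (\<lambda>n. - int n - 1)" for x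
      by (cases x rule: int_cases) auto
    then show ?thesis by blast
  qed
  have D: "range int \<inter> range (\<lambda>n. - int n - 1) = {}" by auto
  have 1: "(\<lambda>n. norm (f (int n))) summable_on UNIV" "(\<lambda>n. norm (f (- int n - 1))) summable_on UNIV"
    using assms by (auto intro!: norm_summable_imp_summable_on)
  then have 2: "(\<lambda>k. norm (f k)) summable_on range int" "(\<lambda>k. norm (f k)) summable_on range (\<lambda>n. - int n - 1)"
    using summable_on_reindex[OF inj(1), of "\<lambda>x. norm (f x)"]
      summable_on_reindex[OF inj(2), of "\<lambda>x. norm (f x)"] by (auto simp: o_def)
  have "(\<lambda>k. norm (f k)) summable_on (range int \<union> range (\<lambda>n. - int n - 1))"
    by (rule summable_on_Un_disjoint[OF 2 D])
  then show "(\<lambda>k. norm (f k)) summable_on UNIV" using U by simp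
  have "(f has_sum (\<Sum>n. f (int n))) (range int)"
    using has_sum_reindex[OF inj(1), of f] norm_summable_imp_has_sum[OF assms(1) summable_sums[OF summable_norm_cancel[OF assms(1)]]]
    by (simp add: o_def)
  moreover have "(f has_sum (\<Sum>n. f (- int n - 1))) (range (\<lambda>n. - int n - 1))"
    using has_sum_reindex[OF inj(2), of f] norm_summable_imp_has_sum[OF assms(2) summable_sums[OF summable_norm_cancel[OF assms(2)]]]
    by (simp add: o_def)
  ultimately have "(f has_sum ((\<Sum>n. f (int n)) + (\<Sum>n. f (- int n - 1)))) (range int \<union> range (\<lambda>n. - int n - 1))"
    using D by (rule has_sum_Un_disjoint)
  then show "(f has_sum (\<Sum>n. f (int n) + f (- int n - 1))) UNIV"
    unfolding U by (simp add: suminf_add summable_norm_cancel assms)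
qed

lemma gaussian_summable_bound:
  fixes c a :: real
  assumes c: "c > 0" 
  shows "summable (\<lambda>n. exp (- c * (real n + a)\<^sup>2))"
proof (rule summable_comparison_test')
  show "summable (\<lambda>n. exp (c * a\<^sup>2) * exp (- (c / 2) * (real n)\<^sup>2))"
    using c by (intro summable_mult summable_gaussian_nat) auto
  fix n :: nat
  \<comment> \<open>The two sides differ by half the square of n + 2a.\<close>
  have "(real n)\<^sup>2 / 2 \<le> (real n + a)\<^sup>2 + a\<^sup>2"
    using zero_le_power2[of "real n + 2 * a"] by (simp add: power2_eq_square algebra_simps)
  then have "c * ((real n)\<^sup>2 / 2) \<le> c * ((real n + a)\<^sup>2 + a\<^sup>2)" using c by (intro mult_left_mono) auto
  then show "norm (exp (- c * (real n + a)\<^sup>2)) \<le> exp (c * a\<^sup>2) * exp (- (c / 2) * (real n)\<^sup>2)"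
    by (simp add: algebra_simps flip: exp_add)
qed

lemma gaussian_abs_summable_int:
  fixes c a :: real
  assumes "c > 0"
  shows "(\<lambda>k::int. exp (- c * (of_int k + a)\<^sup>2)) summable_on UNIV"
proof -
  have "(- 1 - real n + a)\<^sup>2 = (real n + (1 - a))\<^sup>2" for n
    by (simp add: power2_eq_square algebra_simps)
  then have "(\<lambda>k::int. norm (exp (- c * (of_int k + a)\<^sup>2))) summable_on UNIV"
    using gaussian_summable_bound[OF assms, of a] gaussian_summable_bound[OF assms, of "1 - a"]
    by (intro summable_on_int) (auto simp: algebra_simps)
  then show ?thesis by simp
qed

text \<open>Both sides are continuous and 1-periodic in \<open>a\<close>: the left is the
  periodization of a function, the right a Fourier series, and their Fourier coefficients agree. The
  character \<open>b\<close> is carried along for the induction over a basis and for the signs of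
  the eta series.\<close>

theorem gaussian_Poisson_1d:
  fixes t a b :: real
  assumes t: "t > 0"
  shows "(\<Sum>\<^sub>\<infinity>k\<in>(UNIV::int set). of_real (exp (- pi * t * (of_int k + a)\<^sup>2)) * cis (2 * pi * b * (of_int k + a)))
    = of_real (1 / sqrt t) * 
      (\<Sum>\<^sub>\<infinity>m\<in>(UNIV::int set). of_real (exp (- pi * (of_int m - b)\<^sup>2 / t)) * cis (2 * pi * of_int m * a))"
proof -
  define f where "f x = of_real (exp (- pi * t * x\<^sup>2)) * cis (2 * pi * b * x)" for x
  have nf: "norm (f x) = exp (- pi * t * x\<^sup>2)" for x by (simp add: f_def norm_mult)
  have cf: "continuous_on A f" for A unfolding f_def by (intro continuous_intros)
  define e where "e m x = of_real (exp (- pi * (of_int m - b)\<^sup>2 / t)) * cis (2 * pi * of_int m * x)" for m :: int and x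
  have ne: "norm (e m x) = exp (- (pi / t) * (of_int m - b)\<^sup>2)" for m x by (simp add: e_def norm_mult)
  have ce: "continuous_on A (e m)" for A m unfolding e_def by (intro continuous_intros)
  define u where "u n x = f (x + real n) + f (x - real n - 1)" for n x
  define v where "v n x = e (int n) x + e (- int n - 1) x" for n x
  have cu: "continuous_on A (u n)" for A n unfolding u_def 
    by (intro continuous_intros continuous_on_compose2[OF cf[of UNIV]]) auto
  have cv: "continuous_on A (v n)" for A n unfolding v_def by (intro continuous_intros ce)

  have sumf1: "summable (\<lambda>n. norm (f (x + real n)))" "summable (\<lambda>n. norm (f (x - real n - 1)))" for x
  proof -
    show "summable (\<lambda>n. norm (f (x + real n)))"
      using gaussian_summable_bound[of "pi * t" x] t by (simp add: nf add.commute)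
    have "(x - real n - 1)\<^sup>2 = (real n + (1 - x))\<^sup>2" for n by (simp add: power2_eq_square algebra_simps)
    then show "summable (\<lambda>n. norm (f (x - real n - 1)))"
      using gaussian_summable_bound[of "pi * t" "1 - x"] t by (simp add: nf)
  qed
  have sume1: "summable (\<lambda>n. norm (e (int n) x))" "summable (\<lambda>n. norm (e (- int n - 1) x))" for x
  proof -
    show "summable (\<lambda>n. norm (e (int n) x))"
      using gaussian_summable_bound[of "pi / t" "- b"] t by (simp add: ne)
    have "(of_int (- int n - 1) - b)\<^sup>2 = (real n + (1 + b))\<^sup>2" for n by (simp add: power2_eq_square algebra_simps)
    then show "summable (\<lambda>n. norm (e (- int n - 1) x))"
      using gaussian_summable_bound[of "pi / t" "1 + b"] t unfolding ne by simp
  qed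
  have F: "((\<lambda>k::int. f (x + of_int k)) has_sum (\<Sum>n. u n x)) UNIV" for x
    using summable_on_int(2)[of "\<lambda>k. f (x + of_int k)"] sumf1[of x] by (simp add: u_def algebra_simps)
  have E: "((\<lambda>k::int. e k x) has_sum (\<Sum>n. v n x)) UNIV" for x
    using summable_on_int(2)[of "\<lambda>k. e k x"] sume1[of x] by (simp add: v_def)
  define U where "U x = (\<Sum>n. u n x)" for x
  define V where "V x = (\<Sum>n. v n x)" for x
  have limV: "uniform_limit A (\<lambda>n x. \<Sum>i<n. v i x) V sequentially" for A
    unfolding V_def
  proof (rule Weierstrass_m_test)
    show "norm (v n x) \<le> norm (e (int n) 0) + norm (e (- int n - 1) 0)" for n x
      unfolding v_def by (rule order_trans[OF norm_triangle_ineq]) (simp add: ne)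
    show "summable (\<lambda>n. norm (e (int n) 0) + norm (e (- int n - 1) 0))"
      by (intro summable_add sume1)
  qed
  \<comment> \<open>The terms of the Fourier series have norms independent of x, but the partial
    sums of the periodization converge uniformly on bounded intervals only.\<close>
  have limU: "uniform_limit {- R..R} (\<lambda>n x. \<Sum>i<n. u i x) U sequentially" for R
    unfolding U_def
  proof (rule Weierstrass_m_test)
    let ?b = "\<lambda>n. exp (pi * t * (1 + \<bar>R\<bar>)\<^sup>2) * exp (- (pi * t / 2) * (real n)\<^sup>2)"
    show "norm (u n x) \<le> 2 * (?b n)" if "x \<in> {- R..R}" for n x
    proof -
      have *: "exp (- pi * t * y\<^sup>2) \<le> ?b n"
        if "y\<^sup>2 = (real n + a)\<^sup>2" "\<bar>a\<bar> \<le> 1 + \<bar>R\<bar>" for a y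
      proof -
        have "a\<^sup>2 \<le> (1 + \<bar>R\<bar>)\<^sup>2" using that(2) by (simp add: abs_le_square_iff[symmetric])
        moreover have "(real n)\<^sup>2 / 2 \<le> (real n + a)\<^sup>2 + a\<^sup>2"
          using zero_le_power2[of "real n + 2 * a"] by (simp add: power2_eq_square algebra_simps)
        ultimately have "(real n)\<^sup>2 / 2 - (1 + \<bar>R\<bar>)\<^sup>2 \<le> y\<^sup>2" using that(1) by linarith
        then have "pi * t * ((real n)\<^sup>2 / 2 - (1 + \<bar>R\<bar>)\<^sup>2) \<le> pi * t * y\<^sup>2" 
          using t by (intro mult_left_mono) auto
        then show ?thesis by (simp add: algebra_simps flip: exp_add)
      qed
      have "norm (f (x + real n)) \<le> ?b n"
        unfolding nf using that by (intro *[of _ x]) (auto simp: add.commute)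
      moreover have "norm (f (x - real n - 1)) \<le> ?b n"
        unfolding nf using that by (intro *[of _ "1 - x"]) (auto simp: power2_eq_square algebra_simps)
      ultimately show ?thesis unfolding u_def using norm_triangle_ineq[of "f (x + real n)" "f (x - real n - 1)"] by linarith
    qed
    show "summable (\<lambda>n. 2 * (?b n))"
      using t by (intro summable_mult summable_gaussian_nat) auto
  qed
  have Uper: "U (x + 1) = U x" for x
  proof -
    have "((\<lambda>k::int. f ((x + 1) + of_int k)) has_sum U (x + 1)) UNIV" using F U_def by simp
    moreover have "((\<lambda>k::int. f ((x + 1) + of_int k)) has_sum U x) UNIV"
    proof -
      have "bij_betw (\<lambda>k::int. k + 1) UNIV UNIV" by (rule bij_betwI[of _ _ _ "\<lambda>k. k - 1"]) auto
      from has_sum_reindex_bij_betw[OF this, of "\<lambda>k. f (x + of_int k)" "U x"] F[of x]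
      show ?thesis by (simp add: U_def algebra_simps)
    qed
    ultimately show ?thesis using has_sum_unique by blast
  qed
  have Vper: "V (x + 1) = V x" for x
  proof -
    have "e m (x + 1) = e m x" for m
    proof -
      have "cis (2 * pi * of_int m * (x + 1)) = cis (2 * pi * of_int m * x) * cis (2 * pi * of_int m)"
        by (simp add: cis_mult algebra_simps)
      also have "cis (2 * pi * of_int m) = 1"
        by (rule cis_multiple_2pi) simp
      finally show ?thesis by (simp add: e_def)
    qed
    then show ?thesis by (simp add: V_def v_def)
  qed
  have contV: "continuous_on A V" for A
    by (rule uniform_limit_theorem[OF _ limV]) (auto intro!: always_eventually continuous_intros cv)
  have contR: "continuous_on {- R..R} U" for R
    by (rule uniform_limit_theorem[OF _ limU]) (auto intro!: always_eventually continuous_intros cu)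
  have contU: "continuous_on UNIV U"
  proof -
    have "isCont U x" for x
      by (rule continuous_on_interior[OF contR[of "\<bar>x\<bar> + 1"]]) (auto simp: abs_if)
    then show ?thesis by (simp add: continuous_at_imp_continuous_on)
  qed
  define s where "s = complex_of_real (1 / sqrt t)"
  have "U x - s * V x = 0" for x
  proof (rule Fourier_coefficients_zero_imp_zero)
    show "continuous_on UNIV (\<lambda>x. U x - s * V x)" by (intro continuous_intros contU contV)
    show "U (x + 1) - s * V (x + 1) = U x - s * V x" for x by (simp add: Uper Vper)
    fix m :: int
    let ?w = "\<lambda>x. cis (2 * pi * m * x)"
    have cw: "continuous_on A ?w" for A by (intro continuous_intros)
    have sum_sym: "(\<Sum>i<n. g (int i) + g (- int i - 1)) = (\<Sum>k\<in>{- int n..<int n}. g k)" 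
      for g :: "int \<Rightarrow> complex" and n
    proof (induction n)
      case (Suc n)
      have "{- int (Suc n)..<int (Suc n)} = insert (int n) (insert (- int n - 1) {- int n..<int n})" by auto
      then show ?case using Suc by simp
    qed simp
    let ?J = "\<lambda>g. integral {0..1} (\<lambda>x. g x * ?w x)"
    let ?cU = "complex_of_real (exp (- pi * (b + m)\<^sup>2 / t) / sqrt t)"
    let ?cV = "complex_of_real (exp (- pi * (b + m)\<^sup>2 / t))"
    have lim_coeff: "(\<lambda>n. \<Sum>i<n. ?J (w i)) \<longlonglongrightarrow> ?J W"
      if lim: "uniform_limit {0..1} (\<lambda>n x. \<Sum>i<n. w i x) W sequentially" and cw': "\<And>i. continuous_on {0..1} (w i)" 
      for w W
    proof -
      have cont: "continuous_on {0..1} (\<lambda>x. (\<Sum>i<n. w i x) * ?w x)" for n 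
        by (intro continuous_intros cw' cw)
      have "uniform_limit {0..1} (\<lambda>n x. (\<Sum>i<n. w i x) * ?w x) (\<lambda>x. W x * ?w x) sequentially"
      proof (rule uniform_limitI)
        fix e :: real assume "e > 0"
        from uniform_limitD[OF lim this]
        show "\<forall>\<^sub>F n in sequentially. \<forall>x\<in>{0..1}. dist ((\<Sum>i<n. w i x) * ?w x) (W x * ?w x) < e"
          by (simp add: dist_norm left_diff_distrib[symmetric] norm_mult)
      qed
      then obtain I J where IJ: "\<And>n. ((\<lambda>x. (\<Sum>i<n. w i x) * ?w x) has_integral I n) {0..1}"
         "((\<lambda>x. W x * ?w x) has_integral J) {0..1}" "I \<longlonglongrightarrow> J"
        by (rule uniform_limit_integral[OF _ cont]) auto
      have "I n = (\<Sum>i<n. ?J (w i))" for n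
      proof -
        have "((\<lambda>x. \<Sum>i<n. w i x * ?w x) has_integral (\<Sum>i<n. ?J (w i))) {0..1}"
          by (intro has_integral_sum integrable_integral integrable_continuous_interval continuous_intros cw' cw) auto
        then show ?thesis using IJ(1)[of n] by (simp add: sum_distrib_right has_integral_unique)
      qed
      then have "I = (\<lambda>n. \<Sum>i<n. ?J (w i))" by blast
      then show ?thesis using IJ(2,3) by (simp add: integral_unique)
    qed
    have coeffU: "?J U = ?cU"
    proof (rule LIMSEQ_unique[OF lim_coeff])
      show "uniform_limit {0..1} (\<lambda>n x. \<Sum>i<n. u i x) U sequentially"
        using limU[of 1] by (rule uniform_limit_on_subset) auto
      show "continuous_on {0..1} (u i)" for i by (rule cu)
      define h where "h x = f x * ?w x" for x
      have h: "h = (\<lambda>x. of_real (exp (- pi * t * x\<^sup>2)) * cis (2 * pi * (b + m) * x))"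
        by (simp add: h_def f_def cis_mult algebra_simps fun_eq_iff)
      have ch: "continuous_on A h" for A unfolding h by (intro continuous_intros)
      have ih: "h integrable_on {x..y}" for x y by (intro integrable_continuous_interval ch)
      have wper: "?w (x + of_int k) = ?w x" for x k
      proof -
        have "cis (2 * pi * of_int (m * k)) = 1" by (rule cis_multiple_2pi) simp
        moreover have "?w (x + of_int k) = ?w x * cis (2 * pi * of_int (m * k))"
          by (simp add: cis_mult algebra_simps)
        ultimately show ?thesis by simp
      qed
      have shift: "integral {0..1} (\<lambda>x. f (x + of_int k) * ?w x) = integral {of_int k..of_int k + 1} h" for k
      proof -
        have "integral {0..1} (\<lambda>x. f (x + of_int k) * ?w x) = integral {0..1} (h \<circ> ((+) (of_int k)))"
          by (simp add: h_def o_def wper add.commute)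
        also have "\<dots> = integral {0 + of_int k..1 + of_int k} h" by (rule integral_shift_Icc_real)
        finally show ?thesis by (simp add: add.commute)
      qed
      \<comment> \<open>The shifts of [0, 1] by {-n..<n} tile [-n, n] and leave the character
        unchanged, so partial sums of coefficients are truncated Fourier integrals.\<close>
      have "(\<Sum>i<n. ?J (u i)) = integral {- real n..real n} h" for n
      proof (induction n)
        case (Suc n)
        have "?J (u n) 
            = integral {0..1} (\<lambda>x. f (x + of_int (int n)) * ?w x + f (x + of_int (- int n - 1)) * ?w x)"
          by (simp add: u_def algebra_simps)
        also have "\<dots> = integral {real n..real n + 1} h + integral {- real n - 1..- real n} h"
          by (subst integral_add)
             (auto simp del: of_int_diff of_int_minus of_int_of_nat_eq simp: shift 
               intro!: integrable_continuous_interval continuous_intros continuous_on_compose2[OF cf[of UNIV]],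
              simp)
        finally have "(\<Sum>i<Suc n. ?J (u i)) 
            = (integral {- real n - 1..- real n} h + integral {- real n..real n} h) + integral {real n..real n + 1} h"
          using Suc by simp
        also have "integral {- real n - 1..- real n} h + integral {- real n..real n} h = integral {- real n - 1..real n} h"
          by (rule Henstock_Kurzweil_Integration.integral_combine) (auto intro: ih)
        also have "\<dots> + integral {real n..real n + 1} h = integral {- real n - 1..real n + 1} h"
          by (rule Henstock_Kurzweil_Integration.integral_combine) (auto intro: ih)
        finally have "(\<Sum>i<Suc n. ?J (u i)) = integral {- real n - 1..real n + 1} h" .
        moreover have "- real (Suc n) = - real n - 1" "real (Suc n) = real n + 1" by simp_all
        ultimately show ?case by (simp only:)
      qed simp
      then show "(\<lambda>n. \<Sum>i<n. ?J (u i)) \<longlonglongrightarrow> ?cU"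
        using gaussian_Fourier_transform_limit[OF t, of "b + m"] by (simp only: h)
    qed
    have coeffV: "?J V = ?cV"
    proof (rule LIMSEQ_unique[OF lim_coeff])
      show "uniform_limit {0..1} (\<lambda>n x. \<Sum>i<n. v i x) V sequentially" by (rule limV)
      show "continuous_on {0..1} (v i)" for i by (rule cv)
      \<comment> \<open>Orthogonality of characters; the sign in \<open>- m\<close> is due to
        \<open>?w\<close> not being conjugated.\<close>
      have ek: "?J (e k) = (if k = - m then ?cV else 0)" for k
      proof -
        have *: "e k x * ?w x = of_real (exp (- pi * (of_int k - b)\<^sup>2 / t)) * cis (2 * pi * of_int (k + m) * x)" for x
          by (simp add: e_def cis_mult algebra_simps)
        show ?thesis
        proof (cases "k = - m")
          case True
          have "(- real_of_int m - b)\<^sup>2 = (b + m)\<^sup>2" by (simp add: power2_eq_square algebra_simps)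
          then show ?thesis unfolding * using True by simp
        next
          case False
          define l where "l = 2 * pi * of_int (k + m)"
          have l: "l \<noteq> 0" using False unfolding l_def by (simp add: add_eq_0_iff2 del: of_int_add)
          have "((\<lambda>x. cis (l * x)) has_integral (cis (l * 1) / (\<i> * l) - cis (l * 0) / (\<i> * l))) {0..1}"
            by (rule fundamental_theorem_of_calculus)
               (use l in \<open>auto intro!: derivative_eq_intros has_vector_derivative_real_field 
                  simp: cis_conv_exp mult_ac\<close>)
          moreover have "cis (l * 1) = 1" unfolding l_def mult_1_right by (rule cis_multiple_2pi) simp
          ultimately have "integral {0..1} (\<lambda>x. cis (l * x)) = 0" by (simp add: integral_unique)
          then show ?thesis unfolding * using False by (simp add: l_def)
        qed
      qed
      have "(\<Sum>i<n. ?J (v i)) = ?cV" if "n > nat \<bar>m\<bar>" for n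
      proof -
        have "?J (v i) = ?J (e (int i)) + ?J (e (- int i - 1))" for i
          unfolding v_def ring_distribs
          by (rule integral_add) (intro integrable_continuous_interval continuous_intros ce)+
        then have "(\<Sum>i<n. ?J (v i)) = (\<Sum>k\<in>{- int n..<int n}. ?J (e k))"
          by (simp add: sum_sym[of "\<lambda>k. ?J (e k)"])
        also have "\<dots> = ?cV" unfolding ek using that by (simp add: nat_less_iff) (simp add: abs_if split: if_splits)
        finally show ?thesis .
      qed
      then show "(\<lambda>n. \<Sum>i<n. ?J (v i)) \<longlonglongrightarrow> ?cV"
        by (intro tendsto_eventually) (auto intro: eventually_mono[OF eventually_gt_at_top[of "nat \<bar>m\<bar>"]])
    qed
    have "integral {0..1} (\<lambda>x. (U x - s * V x) * ?w x) = integral {0..1} (\<lambda>x. U x * ?w x - s * (V x * ?w x))"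
      by (simp add: algebra_simps)
    also have "\<dots> = ?J U - s * ?J V"
      by (subst integral_diff) (auto intro!: integrable_continuous_interval continuous_intros 
           continuous_on_subset[OF contU] contV)
    also have "\<dots> = 0" by (simp add: coeffU coeffV s_def)
    finally show "integral {0..1} (\<lambda>x. (U x - s * V x) * ?w x) = 0" .
  qed
  then have "U a = s * V a" by simp
  then show ?thesis
    using infsumI[OF F[of a]] infsumI[OF E[of a]] unfolding U_def V_def s_def f_def e_def
    by (simp add: add.commute)
qed

section \<open>Poisson summation over a lattice\<close>

lemma orthogonal_projection_exists:
  fixes x :: "'a::real_inner"
  assumes "finite B"
  shows "\<exists>p\<in>span B. \<forall>w\<in>span B. (x - p) \<bullet> w = 0"
  using assms
proof (induction arbitrary: x)
  case empty
  then show ?case by simp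
next
  case (insert b B)
  obtain p where p: "p \<in> span B" "\<forall>w\<in>span B. (x - p) \<bullet> w = 0" using insert by blast
  obtain p' where p': "p' \<in> span B" "\<forall>w\<in>span B. (b - p') \<bullet> w = 0" using insert by blast
  define q where "q = b - p'"
  have q: "q \<in> span (insert b B)" unfolding q_def
    by (intro span_diff) (use p' span_mono[of B "insert b B"] in \<open>auto intro: span_base\<close>)
  \<comment> \<open>One Gram-Schmidt step. If \<open>q = 0\<close>, the coefficient is a quotient by
    zero, hence 0, and \<open>p\<close> itself still serves.\<close>
  define r where "r = p + ((x \<bullet> q) / (q \<bullet> q)) *\<^sub>R q"
  have "(x - r) \<bullet> w = 0" if "w \<in> span (insert b B)" for w
  proof -
    obtain k where k: "w - k *\<^sub>R b \<in> span B" using \<open>w \<in> _\<close> by (auto simp: span_insert)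
    define w' where "w' = (w - k *\<^sub>R b) + k *\<^sub>R p'"
    have w': "w' \<in> span B" unfolding w'_def by (intro span_add k span_scale p')
    have w: "w = w' + k *\<^sub>R q" by (simp add: w'_def q_def algebra_simps)
    have "q \<bullet> w' = 0" "q \<bullet> p = 0" using p' w' p(1) by (auto simp: q_def)
    then show ?thesis unfolding w r_def using p(2) w' p(1)
      by (cases "q = 0") (auto simp: inner_diff_left inner_add_left inner_add_right inner_commute algebra_simps)
  qed
  moreover have "r \<in> span (insert b B)" unfolding r_def
    by (intro span_add span_scale q) (use p span_mono[of B "insert b B"] in auto)
  ultimately show ?case by blast
qed

lemma infsum_of_real_summable:
  assumes "(f :: 'b \<Rightarrow> real) summable_on A"
  shows "(\<Sum>\<^sub>\<infinity>x\<in>A. complex_of_real (f x)) = of_real (infsum f A)"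
  using has_sum_of_real[OF has_sum_infsum[OF assms]] by (rule infsumI)

text \<open>The dual lattice tested on generators only: inserting a basis vector then adds a single
  integrality condition.\<close>

definition dual_span :: "'a::real_inner set \<Rightarrow> 'a set" where
  "dual_span B = {w \<in> span B. \<forall>b\<in>B. b \<bullet> w \<in> \<int>}"

lemma norm_infsum_le_infsum:
  fixes f :: "'b \<Rightarrow> 'c::banach"
  assumes "g summable_on A" "\<And>x. x \<in> A \<Longrightarrow> norm (f x) = g x"
  shows "norm (infsum f A) \<le> infsum g A"
proof -
  have "(\<lambda>x. norm (f x)) summable_on A"
    using assms by (simp cong: summable_on_cong)
  from norm_infsum_bound[OF this] show ?thesis using assms(2) by (simp cong: infsum_cong)
qed

text \<open>On the dual side of Poisson summation the shift occurs only in factors of modulus 1, so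
  taking norms gives a bound uniform in \<open>a\<close>.\<close>

lemma gaussian_sum_int_bounded:
  fixes c :: real
  assumes "c > 0"
  shows "\<exists>K. \<forall>a. (\<Sum>\<^sub>\<infinity>k\<in>(UNIV::int set). exp (- c * (of_int k + a)\<^sup>2)) \<le> K"
proof (intro exI allI)
  fix a :: real
  define t where "t = c / pi"
  have t: "t > 0" "- pi * t = - c" using assms by (auto simp: t_def)
  let ?V = "(\<Sum>\<^sub>\<infinity>m\<in>(UNIV::int set). complex_of_real (exp (- pi * (of_int m - 0)\<^sup>2 / t)) * cis (2 * pi * of_int m * a))"
  have sum: "(\<lambda>k::int. exp (- c * (of_int k + a)\<^sup>2)) summable_on UNIV"
    by (rule gaussian_abs_summable_int[OF assms])
  have sum2: "(\<lambda>m::int. exp (- pi * (of_int m)\<^sup>2 / t)) summable_on UNIV"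
    using gaussian_abs_summable_int[of "pi / t" 0] t by simp
  have "of_real (\<Sum>\<^sub>\<infinity>k\<in>(UNIV::int set). exp (- c * (of_int k + a)\<^sup>2)) = complex_of_real (1 / sqrt t) * ?V"
    using gaussian_Poisson_1d[OF t(1), of a 0] unfolding t(2) infsum_of_real_summable[OF sum, symmetric] by simp
  moreover have "norm ?V \<le> (\<Sum>\<^sub>\<infinity>m\<in>(UNIV::int set). exp (- pi * (of_int m)\<^sup>2 / t))"
    by (rule norm_infsum_le_infsum[OF sum2]) (simp add: norm_mult)
  ultimately have "norm (complex_of_real (\<Sum>\<^sub>\<infinity>k\<in>(UNIV::int set). exp (- c * (of_int k + a)\<^sup>2)))
     \<le> (1 / sqrt t) * (\<Sum>\<^sub>\<infinity>m\<in>(UNIV::int set). exp (- pi * (of_int m)\<^sup>2 / t))"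
    using t by (simp add: norm_mult norm_divide divide_right_mono)
  then show "(\<Sum>\<^sub>\<infinity>k\<in>(UNIV::int set). exp (- c * (of_int k + a)\<^sup>2)) \<le> 
     (1 / sqrt (c / pi)) * (\<Sum>\<^sub>\<infinity>m\<in>(UNIV::int set). exp (- pi * (of_int m)\<^sup>2 / (c / pi)))"
    unfolding t_def by simp
qed

definition gauss :: "real \<Rightarrow> 'a::real_inner \<Rightarrow> real" where
  "gauss t x = exp (- pi * t * (x \<bullet> x))"

lemma gauss_pos [simp]: "gauss t x > 0" "gauss t x \<ge> 0" "gauss t x \<noteq> 0"
  by (auto simp: gauss_def)

text \<open>The shift \<open>v\<close> and the character \<open>u\<close> make the induction work,
  since the projection of a new basis vector shifts the inner sums. The constant \<open>c\<close> is
  the reciprocal covolume, left abstract so that no Gram determinant enters; for unimodular lattices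
  its value is recovered afterwards.\<close>

definition lattice_Poisson :: "'a::real_inner set \<Rightarrow> real \<Rightarrow> bool" where
  "lattice_Poisson B c \<longleftrightarrow> c > 0 \<and>
     (\<forall>t>0. \<forall>v\<in>span B. (\<lambda>y. gauss t (y + v)) summable_on zspan B) \<and>
     (\<forall>t>0. \<forall>u\<in>span B. (\<lambda>w. gauss t (w - u)) summable_on dual_span B) \<and>
     (\<forall>t>0. \<forall>v\<in>span B. \<forall>u\<in>span B.
       (\<Sum>\<^sub>\<infinity>y\<in>zspan B. of_real (gauss t (y + v)) * cis (2 * pi * (u \<bullet> (y + v)))) =
       of_real (c / sqrt t ^ card B) * 
       (\<Sum>\<^sub>\<infinity>w\<in>dual_span B. of_real (gauss (1 / t) (w - u)) * cis (2 * pi * (w \<bullet> v))))"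

lemma lattice_Poisson_empty: "lattice_Poisson ({} :: 'a::real_inner set) 1"
  by (simp add: lattice_Poisson_def zmod.span_empty dual_span_def gauss_def)

text \<open>Again the shift disappears from the dual side on taking norms. Uniformity in
  \<open>v\<close> is what a double sum needs when the shift of the inner sum depends on the outer
  index.\<close>

lemma lattice_Poisson_bounded:
  assumes "lattice_Poisson B c" "t > 0"
  shows "\<exists>K. \<forall>v\<in>span B. (\<Sum>\<^sub>\<infinity>y\<in>zspan B. gauss t (y + v)) \<le> K"
proof (intro exI ballI)
  fix v assume v: "v \<in> span B"
  have c: "c > 0" using assms by (simp add: lattice_Poisson_def)
  let ?V = "\<Sum>\<^sub>\<infinity>w\<in>dual_span B. complex_of_real (gauss (1 / t) (w - 0)) * cis (2 * pi * (w \<bullet> v))"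
  have "0 \<in> span B" by (rule span_zero)
  then have sum2: "(\<lambda>w. gauss (1 / t) (w - 0)) summable_on dual_span B"
    using assms unfolding lattice_Poisson_def by (meson zero_less_divide_1_iff)
  have "(\<Sum>\<^sub>\<infinity>y\<in>zspan B. complex_of_real (gauss t (y + v)) * cis (2 * pi * (0 \<bullet> (y + v)))) =
      of_real (c / sqrt t ^ card B) * ?V"
    using assms v \<open>0 \<in> span B\<close> unfolding lattice_Poisson_def by blast
  then have "complex_of_real (\<Sum>\<^sub>\<infinity>y\<in>zspan B. gauss t (y + v)) = of_real (c / sqrt t ^ card B) * ?V"
    using infsum_of_real_summable[of "\<lambda>y. gauss t (y + v)" "zspan B"] assms v
    by (simp add: lattice_Poisson_def)
  then have "norm (complex_of_real (\<Sum>\<^sub>\<infinity>y\<in>zspan B. gauss t (y + v))) = (c / sqrt t ^ card B) * norm ?V"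
    using c assms(2) by (simp add: norm_mult norm_divide norm_power)
  moreover have "norm ?V \<le> (\<Sum>\<^sub>\<infinity>w\<in>dual_span B. gauss (1 / t) (w - 0))"
    by (rule norm_infsum_le_infsum[OF sum2]) (simp add: norm_mult)
  ultimately have "norm (complex_of_real (\<Sum>\<^sub>\<infinity>y\<in>zspan B. gauss t (y + v)))
      \<le> (c / sqrt t ^ card B) * (\<Sum>\<^sub>\<infinity>w\<in>dual_span B. gauss (1 / t) (w - 0))"
    using c assms(2) by (simp add: mult_left_mono divide_right_mono)
  then show "(\<Sum>\<^sub>\<infinity>y\<in>zspan B. gauss t (y + v))
      \<le> (c / sqrt t ^ card B) * (\<Sum>\<^sub>\<infinity>w\<in>dual_span B. gauss (1 / t) (w - 0))" by simp
qed

lemma summable_on_Times_bounded: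
  fixes f :: "'a \<Rightarrow> 'b \<Rightarrow> real"
  assumes f: "\<And>x. x \<in> A \<Longrightarrow> f x summable_on B" "\<And>x y. x \<in> A \<Longrightarrow> y \<in> B \<Longrightarrow> f x y \<ge> 0"
    and K: "\<And>x. x \<in> A \<Longrightarrow> infsum (f x) B \<le> K"
    and g: "g summable_on A" "\<And>x. x \<in> A \<Longrightarrow> g x \<ge> 0"
  shows "(\<lambda>(x, y). g x * f x y) summable_on A \<times> B"
proof (rule summable_on_SigmaI)
  show "((\<lambda>y. case (x, y) of (x, y) \<Rightarrow> g x * f x y) has_sum g x * infsum (f x) B) B" if "x \<in> A" for x
    using has_sum_cmult_right[OF has_sum_infsum[OF f(1)[OF that]]] by simp
  show "(\<lambda>x. g x * infsum (f x) B) summable_on A"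
  proof (rule summable_on_comparison_test)
    show "(\<lambda>x. g x * K) summable_on A" by (intro summable_on_cmult_left g)
    show "g x * infsum (f x) B \<le> g x * K" if "x \<in> A" for x using K[OF that] g(2)[OF that] by (rule mult_left_mono)
    show "0 \<le> g x * infsum (f x) B" if "x \<in> A" for x
      using that by (intro mult_nonneg_nonneg g infsum_nonneg f)
  qed
  show "0 \<le> (case (x, y) of (x, y) \<Rightarrow> g x * f x y)" if "x \<in> A" "y \<in> B" for x y
    using that f g by simp
qed

text \<open>Write b = p + q with p in \<open>span B\<close> and q orthogonal to it. A Gaussian then
  splits into a factor along q and one on \<open>span B\<close>, while the lattice and its dual
  become products sheared by p. The hypothesis treats the sum over \<open>zspan B\<close>, the
  one-dimensional formula the sum over multiples of b, with an interchange of summations in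
  between.\<close>

lemma lattice_Poisson_insert:
  fixes b :: "'a::real_inner"
  assumes IH: "lattice_Poisson B c" and fin: "finite B" and ind: "independent (insert b B)" and b: "b \<notin> B"
  shows "\<exists>c'. lattice_Poisson (insert b B) c'"
proof -
  have c: "c > 0" using IH by (simp add: lattice_Poisson_def)
  obtain p where p: "p \<in> span B" "\<forall>w\<in>span B. (b - p) \<bullet> w = 0" 
    using orthogonal_projection_exists[OF fin] by blast
  define q where "q = b - p"
  have bq: "b = p + q" by (simp add: q_def)
  have q: "q \<bullet> w = 0" "w \<bullet> q = 0" if "w \<in> span B" for w using p that by (auto simp: q_def inner_commute)
  have q0: "q \<noteq> 0" using p(1) ind b by (auto simp: q_def independent_insert)
  define h where "h = q \<bullet> q"
  have h: "h > 0" using q0 by (simp add: h_def)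
  have bq_inner: "b \<bullet> w = p \<bullet> w" "b \<bullet> q = h" if "w \<in> span B" for w
    using q[OF that] q[OF p(1)] by (auto simp: bq inner_add_left h_def)
  have zspan_span: "y \<in> span B" if "y \<in> zspan B" for y
    using that
  proof (induction rule: zmod.span_induct_alt)
    case base show ?case by (rule span_zero)
  next
    case (step c x y) then show ?case by (meson span_add span_scale span_base)
  qed
  have span_ins: "x \<in> span (insert b B) \<longleftrightarrow> (\<exists>w\<in>span B. \<exists>\<gamma>. x = w + \<gamma> *\<^sub>R q)" for x
  proof
    assume "x \<in> span (insert b B)"
    then obtain k where k: "x - k *\<^sub>R b \<in> span B" by (auto simp: span_insert)
    have "(x - k *\<^sub>R b) + k *\<^sub>R p \<in> span B" by (intro span_add span_scale k p(1))
    moreover have "x = ((x - k *\<^sub>R b) + k *\<^sub>R p) + k *\<^sub>R q" by (simp add: q_def algebra_simps)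
    ultimately show "\<exists>w\<in>span B. \<exists>\<gamma>. x = w + \<gamma> *\<^sub>R q" by blast
  next
    assume "\<exists>w\<in>span B. \<exists>\<gamma>. x = w + \<gamma> *\<^sub>R q"
    then obtain w \<gamma> where w: "w \<in> span B" "x = w + \<gamma> *\<^sub>R q" by blast
    have "x - \<gamma> *\<^sub>R b = w - \<gamma> *\<^sub>R p" by (simp add: w q_def algebra_simps)
    also have "\<dots> \<in> span B" by (intro span_diff span_scale w p)
    finally show "x \<in> span (insert b B)" by (auto simp: span_insert)
  qed
  define \<phi> where "\<phi> = (\<lambda>(k::int, y). y + of_int k *\<^sub>R b)"
  have bij1: "bij_betw \<phi> (UNIV \<times> zspan B) (zspan (insert b B))"
  proof (rule bij_betw_imageI)
    show "inj_on \<phi> (UNIV \<times> zspan B)"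
    proof (rule inj_onI, clarsimp simp: \<phi>_def)
      fix k k' y y' assume y: "y \<in> zspan B" "y' \<in> zspan B" and eq: "y + of_int k *\<^sub>R b = y' + of_int k' *\<^sub>R b"
      have "(y + of_int k *\<^sub>R b) \<bullet> q = (y' + of_int k' *\<^sub>R b) \<bullet> q" using eq by simp
      then have "of_int k * h = of_int k' * h"
        using q(2) zspan_span y bq_inner(2)[OF p(1)] by (simp add: inner_add_left)
      then have "k = k'" using h by simp
      then show "k = k' \<and> y = y'" using eq by simp
    qed
    show "\<phi> ` (UNIV \<times> zspan B) = zspan (insert b B)"
    proof -
      have "x \<in> \<phi> ` (UNIV \<times> zspan B) \<longleftrightarrow> x \<in> zspan (insert b B)" for x
      proof -
        have "x \<in> \<phi> ` (UNIV \<times> zspan B) \<longleftrightarrow> (\<exists>k::int. \<exists>y\<in>zspan B. x = y + of_int k *\<^sub>R b)"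
          by (auto simp: \<phi>_def image_iff)
        also have "\<dots> \<longleftrightarrow> (\<exists>k::int. x - of_int k *\<^sub>R b \<in> zspan B)"
          by (metis add_diff_cancel_right' diff_add_cancel)
        finally show ?thesis by (simp add: zmod.span_insert)
      qed
      then show ?thesis by blast
    qed
  qed
  \<comment> \<open>For w + g q the product with \<open>b\<close> is w . p + g h. Setting it equal
    to an integer m determines the coefficient g.\<close>
  define \<psi> where "\<psi> = (\<lambda>(w, m::int). w + ((of_int m - w \<bullet> p) / h) *\<^sub>R q)"
  have bij2: "bij_betw \<psi> (dual_span B \<times> UNIV) (dual_span (insert b B))"
  proof (rule bij_betw_imageI)
    show "inj_on \<psi> (dual_span B \<times> UNIV)"
    proof (rule inj_onI, clarsimp simp: \<psi>_def)
      fix k k' :: int and w w' assume w: "w \<in> dual_span B" "w' \<in> dual_span B" 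
        and eq: "w + ((of_int k - w \<bullet> p) / h) *\<^sub>R q = w' + ((of_int k' - w' \<bullet> p) / h) *\<^sub>R q"
      have ws: "w \<in> span B" "w' \<in> span B" using w by (auto simp: dual_span_def)
      have "(w + ((of_int k - w \<bullet> p) / h) *\<^sub>R q) \<bullet> q = (w' + ((of_int k' - w' \<bullet> p) / h) *\<^sub>R q) \<bullet> q"
        by (simp only: eq)
      then have *: "of_int k - w \<bullet> p = of_int k' - w' \<bullet> p"
        using q(2) ws h by (simp add: inner_add_left flip: h_def)
      then have "w = w'" using eq by simp
      then show "w = w' \<and> k = k'" using * by simp
    qed
    show "\<psi> ` (dual_span B \<times> UNIV) = dual_span (insert b B)"
    proof (intro equalityI subsetI)
      fix x assume "x \<in> \<psi> ` (dual_span B \<times> UNIV)"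
      then obtain w m where w: "w \<in> dual_span B" and x: "x = w + ((of_int m - w \<bullet> p) / h) *\<^sub>R q"
        by (auto simp: \<psi>_def)
      have ws: "w \<in> span B" using w by (auto simp: dual_span_def)
      have "x \<in> span (insert b B)" using x ws span_ins by blast
      moreover have "b \<bullet> x = of_int m" using bq_inner[OF ws] h by (simp add: x inner_add_right inner_commute)
      moreover have "d \<bullet> x = d \<bullet> w" if "d \<in> B" for d
        using q(2)[OF span_base[OF that]] by (simp add: x inner_add_right)
      ultimately show "x \<in> dual_span (insert b B)" using w by (auto simp: dual_span_def)
    next
      fix x assume x: "x \<in> dual_span (insert b B)"
      then obtain w \<gamma> where w: "w \<in> span B" "x = w + \<gamma> *\<^sub>R q" using span_ins by (auto simp: dual_span_def)
      obtain m :: int where "b \<bullet> x = of_int m" using x by (auto simp: dual_span_def Ints_def)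
      then have m: "p \<bullet> w + \<gamma> * h = of_int m" using bq_inner[OF w(1)] by (simp add: w(2) inner_add_right)
      have "d \<bullet> x = d \<bullet> w" if "d \<in> B" for d
        using q(2)[OF span_base[OF that]] by (simp add: w(2) inner_add_right)
      then have "w \<in> dual_span B" using x w by (auto simp: dual_span_def)
      moreover have "x = \<psi> (w, m)" using h by (simp add: \<psi>_def w(2) inner_commute m[symmetric])
      ultimately show "x \<in> \<psi> ` (dual_span B \<times> UNIV)" by blast
    qed
  qed
  have gauss_split: "gauss t (w + \<gamma> *\<^sub>R q) = exp (- (pi * t * h) * \<gamma>\<^sup>2) * gauss t w" if "w \<in> span B" for t w \<gamma>
    using q[OF that] by (simp add: gauss_def inner_add_left inner_add_right power2_eq_square 
        algebra_simps flip: h_def exp_add)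
  have dsB: "w \<in> span B" if "w \<in> dual_span B" for w using that by (simp add: dual_span_def)
  define c' where "c' = c / sqrt h"
  have c': "c' > 0" using c h by (simp add: c'_def)
  have eq1: "gauss t (\<phi> (k, y) + (v0 + \<alpha> *\<^sub>R q)) = exp (- (pi * t * h) * (of_int k + \<alpha>)\<^sup>2) * gauss t (y + (of_int k *\<^sub>R p + v0))"
    if "y \<in> span B" "v0 \<in> span B" for y v0 \<alpha> k t
  proof -
    have "\<phi> (k, y) + (v0 + \<alpha> *\<^sub>R q) = (y + (of_int k *\<^sub>R p + v0)) + (of_int k + \<alpha>) *\<^sub>R q"
      by (simp add: \<phi>_def bq algebra_simps)
    then show ?thesis using that p(1) by (simp only: gauss_split span_add span_scale)
  qed
  have eq2: "gauss t (\<psi> (w, m) - (u0 + (\<beta> / h) *\<^sub>R q)) = exp (- (pi * t / h) * (of_int m + (- (w \<bullet> p) - \<beta>))\<^sup>2) * gauss t (w - u0)"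
    if "w \<in> span B" "u0 \<in> span B" for w u0 \<beta> m t
  proof -
    have *: "\<psi> (w, m) - (u0 + (\<beta> / h) *\<^sub>R q) = (w - u0) + ((of_int m + (- (w \<bullet> p) - \<beta>)) / h) *\<^sub>R q"
      by (simp add: \<psi>_def algebra_simps diff_divide_distrib add_divide_distrib)
    show ?thesis unfolding * using that gauss_split[of "w - u0" t] h
      by (simp add: span_diff power_divide power2_eq_square)
  qed
  have sum1: "(\<lambda>(k, y). exp (- (pi * t * h) * (of_int k + \<alpha>)\<^sup>2) * gauss t (y + (of_int k *\<^sub>R p + v0))) summable_on (UNIV \<times> zspan B)"
    if t: "t > 0" and v0: "v0 \<in> span B" for t v0 \<alpha>
  proof -
    obtain K where K: "\<forall>v\<in>span B. (\<Sum>\<^sub>\<infinity>y\<in>zspan B. gauss t (y + v)) \<le> K"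
      using lattice_Poisson_bounded[OF IH t] by blast
    have "of_int k *\<^sub>R p + v0 \<in> span B" for k by (intro span_add span_scale v0 p)
    then show ?thesis using IH t K h unfolding lattice_Poisson_def
      by (intro summable_on_Times_bounded[where K = K] gaussian_abs_summable_int) auto
  qed
  have sum2: "(\<lambda>(w, m). gauss t (w - u0) * exp (- (pi * t / h) * (of_int m + (- (w \<bullet> p) - \<beta>))\<^sup>2)) summable_on (dual_span B \<times> (UNIV :: int set))"
    if t: "t > 0" and u0: "u0 \<in> span B" for t u0 \<beta>
  proof -
    have pt: "pi * t / h > 0" using t h by simp
    obtain K where K: "\<And>a. (\<Sum>\<^sub>\<infinity>k\<in>(UNIV::int set). exp (- (pi * t / h) * (of_int k + a)\<^sup>2)) \<le> K"
      using gaussian_sum_int_bounded[OF pt] by blast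
    show ?thesis using IH t u0 h pt unfolding lattice_Poisson_def
      by (intro summable_on_Times_bounded[where K = K] gaussian_abs_summable_int K) auto
  qed
  have S1: "(\<lambda>y. gauss t (y + v)) summable_on zspan (insert b B)" if t: "t > 0" and v: "v \<in> span (insert b B)" for t v
  proof -
    obtain v0 \<alpha> where v0: "v0 \<in> span B" "v = v0 + \<alpha> *\<^sub>R q" using v span_ins by blast
    have "(\<lambda>z. gauss t (\<phi> z + v)) summable_on (UNIV \<times> zspan B)"
      using sum1[OF t v0(1), of \<alpha>] by (rule summable_on_cong[THEN iffD1, rotated])
         (auto simp: v0(2) eq1 zspan_span v0(1))
    then show ?thesis using summable_on_reindex_bij_betw[OF bij1, of "\<lambda>y. gauss t (y + v)"] by simp
  qed
  have S2: "(\<lambda>w. gauss t (w - u)) summable_on dual_span (insert b B)" if t: "t > 0" and u: "u \<in> span (insert b B)" for t u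
  proof -
    obtain u0 \<beta>' where u0: "u0 \<in> span B" "u = u0 + \<beta>' *\<^sub>R q" using u span_ins by blast
    define \<beta> where "\<beta> = \<beta>' * h"
    have ub: "u = u0 + (\<beta> / h) *\<^sub>R q" using h by (simp add: \<beta>_def u0)
    have "(\<lambda>z. gauss t (\<psi> z - u)) summable_on (dual_span B \<times> UNIV)"
      using sum2[OF t u0(1), of \<beta>] by (rule summable_on_cong[THEN iffD1, rotated])
         (auto simp: ub eq2 dsB u0(1))
    then show ?thesis using summable_on_reindex_bij_betw[OF bij2, of "\<lambda>y. gauss t (y - u)"] by simp
  qed
  have S3: "(\<Sum>\<^sub>\<infinity>y\<in>zspan (insert b B). of_real (gauss t (y + v)) * cis (2 * pi * (u \<bullet> (y + v)))) =
       of_real (c' / sqrt t ^ card (insert b B)) * 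
       (\<Sum>\<^sub>\<infinity>w\<in>dual_span (insert b B). of_real (gauss (1 / t) (w - u)) * cis (2 * pi * (w \<bullet> v)))"
    if t: "t > 0" and v: "v \<in> span (insert b B)" and u: "u \<in> span (insert b B)" for t v u
  proof -
    obtain v0 \<alpha> where v0: "v0 \<in> span B" "v = v0 + \<alpha> *\<^sub>R q" using v span_ins by blast
    obtain u0 \<beta>' where u0: "u0 \<in> span B" "u = u0 + \<beta>' *\<^sub>R q" using u span_ins by blast
    define \<beta> where "\<beta> = \<beta>' * h"
    have ub: "u = u0 + (\<beta> / h) *\<^sub>R q" using h by (simp add: \<beta>_def u0)
    let ?Q = "\<lambda>y. complex_of_real (gauss t (y + v)) * cis (2 * pi * (u \<bullet> (y + v)))"
    let ?R = "\<lambda>w. complex_of_real (gauss (1 / t) (w - u)) * cis (2 * pi * (w \<bullet> v))"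
    let ?v = "\<lambda>k. of_int k *\<^sub>R p + v0"
    let ?c = "\<lambda>k. cis (2 * pi * (\<beta> * (of_int k + \<alpha>)))"
    let ?e = "\<lambda>k. exp (- (pi * t * h) * (of_int k + \<alpha>)\<^sup>2)"
    have t': "1 / t > 0" "t * h > 0" using t h by auto
    define G where "G k = complex_of_real (?e k)" for k :: int
    define E where "E w = complex_of_real (gauss (1 / t) (w - u0))" for w
    define F where "F k y = (G k * ?c k) *
       (complex_of_real (gauss t (y + ?v k)) * cis (2 * pi * (u0 \<bullet> (y + ?v k))))" for k :: int and y
    have vk: "of_int k *\<^sub>R p + v0 \<in> span B" for k by (intro span_add span_scale v0 p)
    have F: "?Q (\<phi> (k, y)) = F k y" if "y \<in> zspan B" for k y
    proof -
      have y: "y \<in> span B" using zspan_span that .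
      have "u \<bullet> (\<phi> (k, y) + v) = u0 \<bullet> (y + (of_int k *\<^sub>R p + v0)) + \<beta> * (of_int k + \<alpha>)"
        using q[OF y] q[OF p(1)] q[OF v0(1)] q[OF u0(1)] h
        by (simp add: ub v0(2) \<phi>_def bq inner_add_left inner_add_right algebra_simps flip: h_def)
      then have "cis (2 * pi * (u \<bullet> (\<phi> (k, y) + v))) = ?c k * cis (2 * pi * (u0 \<bullet> (y + ?v k)))"
        by (simp add: cis_mult algebra_simps)
      then show ?thesis using eq1[OF y v0(1)] by (simp add: F_def G_def v0(2))
    qed
    have normF: "norm (F k y) = ?e k * gauss t (y + ?v k)" for k y
      by (simp add: F_def G_def norm_mult)
    have sumF: "(\<lambda>(k, y). F k y) summable_on (UNIV \<times> zspan B)"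
      by (rule abs_summable_summable) (use sum1[OF t v0(1), of \<alpha>] in \<open>simp add: normF case_prod_unfold\<close>)
    \<comment> \<open>The summand half way: the hypothesis has been applied for fixed
      \<open>k\<close>, the one-dimensional formula for fixed \<open>w\<close> has not.\<close>
    define H where "H k w = G k * ?c k * (E w * cis (2 * pi * (w \<bullet> ?v k)))" for k :: int and w
    have normH: "norm (H k w) = ?e k * gauss (1 / t) (w - u0)" for k w
      by (simp add: H_def G_def E_def norm_mult)
    have sumH: "(\<lambda>(k, w). H k w) summable_on (UNIV \<times> dual_span B)"
    proof (rule abs_summable_summable)
      have "(\<lambda>w. gauss (1 / t) (w - u0)) summable_on dual_span B"
        using IH t' u0(1) by (simp add: lattice_Poisson_def)
      moreover have "pi * t * h > 0" using t h by simp
      ultimately have "(\<lambda>(k, w). ?e k * gauss (1 / t) (w - u0)) 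
          summable_on ((UNIV :: int set) \<times> dual_span B)"
        by (intro summable_on_Times_bounded[where K = "\<Sum>\<^sub>\<infinity>w\<in>dual_span B. gauss (1 / t) (w - u0)"]
             gaussian_abs_summable_int) auto
      then show "(\<lambda>z. norm (case z of (k, w) \<Rightarrow> H k w)) summable_on (UNIV \<times> dual_span B)"
        by (simp add: normH case_prod_unfold)
    qed
    define C where "C = complex_of_real (c / sqrt t ^ card B)"
    have inner_k: "(\<Sum>\<^sub>\<infinity>k. H k w) = of_real (1 / sqrt (t * h)) * 
        (\<Sum>\<^sub>\<infinity>m\<in>UNIV. ?R (\<psi> (w, m)))" if "w \<in> dual_span B" for w
    proof -
      have w: "w \<in> span B" using dsB that .
      \<comment> \<open>The character in \<open>k\<close> collects the part of \<open>u\<close>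
        along \<open>q\<close> and the product of \<open>w\<close> with the shift by multiples of
        \<open>p\<close>.\<close>
      define b1 where "b1 = \<beta> + w \<bullet> p"
      let ?P = "\<lambda>k. complex_of_real (exp (- pi * (t * h) * (of_int k + \<alpha>)\<^sup>2)) * cis (2 * pi * b1 * (of_int k + \<alpha>))"
      let ?D = "\<lambda>m. complex_of_real (exp (- pi * (of_int m - b1)\<^sup>2 / (t * h))) * cis (2 * pi * of_int m * \<alpha>)"
      define A where "A = E w * cis (2 * pi * (w \<bullet> v0 - \<alpha> * (w \<bullet> p)))"
      have "H k w = A * (?P k)" for k
      proof -
        have "2 * pi * (\<beta> * (of_int k + \<alpha>)) + 2 * pi * (w \<bullet> ?v k) 
           = 2 * pi * (w \<bullet> v0 - \<alpha> * (w \<bullet> p)) + 2 * pi * b1 * (of_int k + \<alpha>)"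
          by (simp add: b1_def inner_add_right algebra_simps)
        then have "?c k * cis (2 * pi * (w \<bullet> ?v k))
          = cis (2 * pi * (w \<bullet> v0 - \<alpha> * (w \<bullet> p))) * cis (2 * pi * b1 * (of_int k + \<alpha>))"
          by (simp only: cis_mult)
        then show ?thesis by (simp add: H_def A_def G_def mult_ac)
      qed
      then have "(\<Sum>\<^sub>\<infinity>k. H k w) = A * (\<Sum>\<^sub>\<infinity>k\<in>(UNIV::int set). 
          ?P k)"
        by (simp only: infsum_cmult_right')
      also have "\<dots> = of_real (1 / sqrt (t * h)) * (A * (\<Sum>\<^sub>\<infinity>m\<in>(UNIV::int set). 
          ?D m))"
        unfolding gaussian_Poisson_1d[OF t'(2)] by (rule mult.left_commute)
      also have "A * (\<Sum>\<^sub>\<infinity>m\<in>(UNIV::int set). 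
          ?D m)
        = (\<Sum>\<^sub>\<infinity>m\<in>UNIV. ?R (\<psi> (w, m)))"
        unfolding infsum_cmult_right'[symmetric]
      proof (rule infsum_cong)
        fix m :: int
        have 1: "gauss (1 / t) (\<psi> (w, m) - u) = exp (- pi * (of_int m - b1)\<^sup>2 / (t * h)) * gauss (1 / t) (w - u0)"
          unfolding ub eq2[OF w u0(1)] by (simp add: b1_def algebra_simps)
        have "\<psi> (w, m) \<bullet> v = (w \<bullet> v0 - \<alpha> * (w \<bullet> p)) + of_int m * \<alpha>"
          using q[OF w] q[OF v0(1)] h
          by (simp add: \<psi>_def v0(2) inner_add_left inner_add_right field_simps flip: h_def)
        then have "2 * pi * (\<psi> (w, m) \<bullet> v) = 2 * pi * (w \<bullet> v0 - \<alpha> * (w \<bullet> p)) + 2 * pi * of_int m * \<alpha>"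
          by (simp only:) (simp add: algebra_simps)
        then have 2: "cis (2 * pi * (\<psi> (w, m) \<bullet> v)) = cis (2 * pi * (w \<bullet> v0 - \<alpha> * (w \<bullet> p))) * cis (2 * pi * of_int m * \<alpha>)"
          by (simp only: cis_mult)
        show "A * (?D m) =
           ?R (\<psi> (w, m))"
          unfolding 1 2 A_def E_def by (simp add: mult_ac)
      qed
      finally show ?thesis .
    qed
    have "(\<Sum>\<^sub>\<infinity>y\<in>zspan (insert b B). ?Q y) =
       (\<Sum>\<^sub>\<infinity>z\<in>UNIV \<times> zspan B. ?Q (\<phi> z))"
      by (rule infsum_reindex_bij_betw[OF bij1, symmetric])
    also have "\<dots> = (\<Sum>\<^sub>\<infinity>(k, y)\<in>UNIV \<times> zspan B. F k y)"
      by (rule infsum_cong) (use F in auto)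
    also have "\<dots> = (\<Sum>\<^sub>\<infinity>k. \<Sum>\<^sub>\<infinity>y\<in>zspan B. F k y)"
      using infsum_Sigma'_banach[OF sumF] by simp
    also have "\<dots> = (\<Sum>\<^sub>\<infinity>k. C * (\<Sum>\<^sub>\<infinity>w\<in>dual_span B. H k w))"
    proof (rule infsum_cong)
      fix k :: int
      have "(\<Sum>\<^sub>\<infinity>y\<in>zspan B. F k y) = (G k * ?c k) *
         (\<Sum>\<^sub>\<infinity>y\<in>zspan B. complex_of_real (gauss t (y + ?v k)) * cis (2 * pi * (u0 \<bullet> (y + ?v k))))"
        unfolding F_def by (rule infsum_cmult_right')
      also have "\<dots> = (G k * ?c k) *
         (C * (\<Sum>\<^sub>\<infinity>w\<in>dual_span B. E w * cis (2 * pi * (w \<bullet> ?v k))))"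
        using IH t vk u0(1) unfolding lattice_Poisson_def C_def E_def by auto
      also have "\<dots> = C * (\<Sum>\<^sub>\<infinity>w\<in>dual_span B. H k w)"
        unfolding H_def infsum_cmult_right' by simp
      finally show "(\<Sum>\<^sub>\<infinity>y\<in>zspan B. F k y) = C * (\<Sum>\<^sub>\<infinity>w\<in>dual_span B. H k w)" .
    qed
    also have "\<dots> = C * (\<Sum>\<^sub>\<infinity>k. \<Sum>\<^sub>\<infinity>w\<in>dual_span B. H k w)" by (rule infsum_cmult_right')
    also have "(\<Sum>\<^sub>\<infinity>k. \<Sum>\<^sub>\<infinity>w\<in>dual_span B. H k w) = (\<Sum>\<^sub>\<infinity>w\<in>dual_span B. \<Sum>\<^sub>\<infinity>k. H k w)"
      by (rule infsum_swap_banach[OF sumH])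
    also have "\<dots> = (\<Sum>\<^sub>\<infinity>w\<in>dual_span B. of_real (1 / sqrt (t * h)) * 
        (\<Sum>\<^sub>\<infinity>m\<in>UNIV. ?R (\<psi> (w, m))))"
      by (rule infsum_cong) (rule inner_k)
    also have "\<dots> = of_real (1 / sqrt (t * h)) * (\<Sum>\<^sub>\<infinity>w\<in>dual_span B. 
        \<Sum>\<^sub>\<infinity>m\<in>UNIV. ?R (\<psi> (w, m)))"
      by (rule infsum_cmult_right')
    also have "(\<Sum>\<^sub>\<infinity>w\<in>dual_span B. \<Sum>\<^sub>\<infinity>m\<in>UNIV. ?R (\<psi> (w, m)))
      = (\<Sum>\<^sub>\<infinity>(w, m)\<in>dual_span B \<times> UNIV. ?R (\<psi> (w, m)))"
    proof (rule infsum_Sigma'_banach, rule abs_summable_summable)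
      have "(\<lambda>z. gauss (1 / t) (\<psi> z - u)) summable_on (dual_span B \<times> UNIV)"
        using S2[OF t'(1) u] summable_on_reindex_bij_betw[OF bij2, of "\<lambda>y. gauss (1 / t) (y - u)"] by simp
      then show "(\<lambda>z. norm (case z of (w, m) \<Rightarrow> ?R (\<psi> (w, m)))) summable_on dual_span B \<times> UNIV"
        by (simp add: case_prod_unfold norm_mult)
    qed
    also have "\<dots> = (\<Sum>\<^sub>\<infinity>w\<in>dual_span (insert b B). ?R w)"
      using infsum_reindex_bij_betw[OF bij2, of "\<lambda>w. ?R w"]
      by (simp add: case_prod_unfold)
    finally show ?thesis
      using fin b by (simp add: C_def c'_def real_sqrt_mult field_simps)
  qed
  have "lattice_Poisson (insert b B) c'"
    unfolding lattice_Poisson_def using c' S1 S2 S3 by blast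
  then show ?thesis ..
qed

theorem lattice_Poisson_exists:
  fixes B :: "'a::real_inner set"
  assumes "finite B" "independent B"
  shows "\<exists>c. lattice_Poisson B c"
  using assms
proof (induction B)
  case empty
  show ?case using lattice_Poisson_empty by blast
next
  case (insert b B)
  then have "independent B" using independent_mono by blast
  with insert show ?case using lattice_Poisson_insert by blast
qed

section \<open>Modular forms as power series\<close>

definition upper :: "complex set" where "upper = {\<tau>. Im \<tau> > 0}"

definition nome :: "complex \<Rightarrow> complex" where "nome \<tau> = exp (2 * pi * \<i> * \<tau>)"

definition qeval :: "complex fps \<Rightarrow> complex \<Rightarrow> complex" where
  "qeval F \<tau> = eval_fps F (nome \<tau>)"

text \<open>A power series in the nome is invariant under tau + 1 and holomorphic at the cusp, so
  for the full modular group the inversion law is what remains to be stated.\<close>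

definition modular :: "nat \<Rightarrow> complex fps \<Rightarrow> bool" where
  "modular k F \<longleftrightarrow> fps_conv_radius F \<ge> 1 \<and> (\<forall>\<tau>\<in>upper. qeval F (- 1 / \<tau>) = \<tau> ^ k * qeval F \<tau>)"

lemma upper_properties: "open upper" "convex upper" "connected upper" "\<i> \<in> upper"
proof -
  show "open upper" by (simp add: upper_def open_halfspace_Im_gt)
  show "convex upper" by (simp add: upper_def convex_halfspace_Im_gt)
  then show "connected upper" by (rule convex_connected)
qed (simp add: upper_def)

lemma upper_neg_inverse: "\<tau> \<in> upper \<Longrightarrow> - 1 / \<tau> \<in> upper"
proof -
  assume "\<tau> \<in> upper"
  then have "Im \<tau> > 0" by (simp add: upper_def)
  then have "0 < Im \<tau> / ((Re \<tau>)\<^sup>2 + (Im \<tau>)\<^sup>2)" by (intro divide_pos_pos add_nonneg_pos) auto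
  then show ?thesis by (simp add: upper_def Im_divide)
qed

lemma norm_nome: "norm (nome \<tau>) = exp (- 2 * pi * Im \<tau>)"
  by (simp add: nome_def norm_exp_eq_Re)

lemma norm_nome_less: "\<tau> \<in> upper \<Longrightarrow> norm (nome \<tau>) < 1"
  by (simp add: norm_nome upper_def)

lemma nome_nonzero [simp]: "nome \<tau> \<noteq> 0" by (simp add: nome_def)

lemma nome_in_eball: 
  assumes "\<tau> \<in> upper" "fps_conv_radius F \<ge> 1"
  shows "nome \<tau> \<in> eball 0 (fps_conv_radius F)" "ereal (norm (nome \<tau>)) < fps_conv_radius F"
proof -
  have "ereal (norm (nome \<tau>)) < 1" using norm_nome_less[OF assms(1)] by simp
  then show "ereal (norm (nome \<tau>)) < fps_conv_radius F" using assms(2) by (rule less_le_trans)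
  then show "nome \<tau> \<in> eball 0 (fps_conv_radius F)" by simp
qed

lemma qeval_holomorphic: 
  assumes "fps_conv_radius F \<ge> 1"
  shows "qeval F holomorphic_on upper"
proof -
  have "(eval_fps F \<circ> nome) holomorphic_on upper"
  proof (rule holomorphic_on_compose_gen)
    show "nome holomorphic_on upper" unfolding nome_def by (intro holomorphic_intros)
    show "eval_fps F holomorphic_on eball 0 (fps_conv_radius F)" by (intro holomorphic_on_eval_fps) auto
    show "nome ` upper \<subseteq> eball 0 (fps_conv_radius F)" using nome_in_eball assms by blast
  qed
  then show ?thesis by (simp add: o_def qeval_def[abs_def])
qed

lemma upper_analytic_continuation:
  assumes "f holomorphic_on upper" "g holomorphic_on upper"
    and "\<And>s. s > 0 \<Longrightarrow> f (\<i> * of_real s) = g (\<i> * of_real s)" and "\<tau> \<in> upper"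
  shows "f \<tau> = g \<tau>"
proof -
  have "f \<tau> - g \<tau> = 0"
  proof (rule analytic_continuation[of "\<lambda>\<tau>. f \<tau> - g \<tau>" upper "(\<lambda>s. \<i> * of_real s) ` {0<..}" \<i>])
    show "(\<lambda>\<tau>. f \<tau> - g \<tau>) holomorphic_on upper" using assms by (intro holomorphic_intros)
    show "\<i> islimpt (\<lambda>s. \<i> * complex_of_real s) ` {0<..}"
    proof (rule islimpt_approachable[THEN iffD2], intro allI impI)
      fix e :: real assume "e > 0"
      show "\<exists>x'\<in>(\<lambda>s. \<i> * complex_of_real s) ` {0<..}. x' \<noteq> \<i> \<and> dist x' \<i> < e"
      proof (intro bexI conjI)
        have "\<i> * complex_of_real (1 + e / 2) - \<i> = \<i> * complex_of_real (e / 2)" by (simp add: algebra_simps)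
        then show "dist (\<i> * complex_of_real (1 + e / 2)) \<i> < e" 
          using \<open>e > 0\<close> by (simp only: dist_norm norm_mult) simp
        show "\<i> * complex_of_real (1 + e / 2) \<noteq> \<i>" using \<open>e > 0\<close> by (simp add: complex_eq_iff)
        show "\<i> * complex_of_real (1 + e / 2) \<in> (\<lambda>s. \<i> * complex_of_real s) ` {0<..}"
          by (rule imageI) (use \<open>e > 0\<close> in simp)
      qed
    qed
  qed (use upper_properties assms in \<open>auto simp: upper_def\<close>)
  then show ?thesis by simp
qed

text \<open>The imaginary axis is preserved by inversion and accumulates inside the half-plane, so
  Poisson summation for real parameters is enough.\<close>

lemma modularI_imaginary_axis:
  assumes F: "fps_conv_radius F \<ge> 1"
    and eq: "\<And>s. s > 0 \<Longrightarrow> qeval F (\<i> / of_real s) = (\<i> * of_real s) ^ k * qeval F (\<i> * of_real s)"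
  shows "modular k F"
  unfolding modular_def
proof (intro conjI F ballI)
  fix \<tau> assume \<tau>: "\<tau> \<in> upper"
  show "qeval F (- 1 / \<tau>) = \<tau> ^ k * qeval F \<tau>"
  proof (rule upper_analytic_continuation[OF _ _ _ \<tau>])
    have "(qeval F \<circ> (\<lambda>\<tau>. - 1 / \<tau>)) holomorphic_on upper"
    proof (rule holomorphic_on_compose_gen)
      show "(\<lambda>\<tau>. - 1 / \<tau>) holomorphic_on upper" by (intro holomorphic_intros) (auto simp: upper_def)
      show "(\<lambda>\<tau>. - 1 / \<tau>) ` upper \<subseteq> upper" using upper_neg_inverse by blast
    qed (rule qeval_holomorphic[OF F])
    then show "(\<lambda>\<tau>. qeval F (- 1 / \<tau>)) holomorphic_on upper" by (simp add: o_def)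
    show "(\<lambda>\<tau>. \<tau> ^ k * qeval F \<tau>) holomorphic_on upper" by (intro holomorphic_intros qeval_holomorphic F)
    fix s :: real assume s: "s > 0"
    have "- 1 / (\<i> * of_real s) = \<i> / of_real s" by (simp add: divide_simps)
    then show "qeval F (- 1 / (\<i> * of_real s)) = (\<i> * of_real s) ^ k * qeval F (\<i> * of_real s)"
      using eq[OF s] by simp
  qed
qed

section \<open>Euler's pentagonal number theorem and the discriminant\<close>

text \<open>Shanks' finite form of the pentagonal number theorem. On the left the term k = 0 is the
  partial Euler product; the others disappear in the limit when |x| < 1. The induction step
  telescopes.\<close>

lemma Shanks_identity:
  fixes x :: "'a::comm_ring_1"
  defines "Q \<equiv> \<lambda>n k. \<Prod>j\<in>{k<..n}. 1 - x ^ j"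
  shows "(\<Sum>k\<le>n. (-1) ^ k * Q n k * x ^ (k * n + k * (k + 1) div 2)) =
    1 + (\<Sum>k=1..n. (-1) ^ k * (x ^ (k * (3 * k + 1) div 2) + x ^ (k * (3 * k - 1) div 2)))"
proof (induction n)
  case 0
  show ?case by (simp add: Q_def)
next
  case (Suc n)
  have tri: "Suc k * (Suc k + 1) div 2 = k * (k + 1) div 2 + Suc k" for k
  proof -
    have "Suc k * (Suc k + 1) = k * (k + 1) + Suc k * 2" by (simp add: algebra_simps)
    then show ?thesis by simp
  qed
  \<comment> \<open>The telescoping term: passing from n to n + 1 changes the k-th summand by T k -
    T (k - 1).\<close>
  define T where "T k = (-1) ^ (k + 1) * Q n k * x ^ ((k + 1) * Suc n + k * (k + 1) div 2)" for k
  have QS: "Q (Suc n) k = Q n k * (1 - x ^ Suc n)" if "k \<le> n" for k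
  proof -
    have "{k<..Suc n} = insert (Suc n) {k<..n}" using that by auto
    then show ?thesis by (simp add: Q_def mult.commute)
  qed
  have Qk: "Q n k = Q n (Suc k) * (1 - x ^ Suc k)" if "k < n" for k
  proof -
    have "{k<..n} = insert (Suc k) {Suc k<..n}" using that by auto
    then show ?thesis by (simp add: Q_def mult.commute)
  qed
  have diff: "(-1) ^ k * Q (Suc n) k * x ^ (k * Suc n + k * (k + 1) div 2) - (-1) ^ k * Q n k * x ^ (k * n + k * (k + 1) div 2)
      = T k - (if k = 0 then 0 else T (k - 1))" if "k \<le> n" for k
  proof (cases k)
    case 0
    then show ?thesis using that by (simp add: QS T_def algebra_simps)
  next
    case (Suc i)
    have "i < n" using Suc that by simp
    define d where "d = i * (i + 1) div 2"
    have "T (k - 1) = (-1) ^ k * (Q n k * (1 - x ^ k)) * x ^ (k * Suc n + d)"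
      using Qk[OF \<open>i < n\<close>] Suc by (simp add: T_def d_def)
    moreover have "k * (k + 1) div 2 = d + k" unfolding Suc d_def by (rule tri)
    ultimately show ?thesis using that Suc
      by (simp add: QS T_def algebra_simps power_add flip: d_def)
  qed
  have tele: "(\<Sum>k\<le>m. T k - (if k = 0 then 0 else T (k - 1))) = T m" for m
    by (induction m) auto
  have "(\<Sum>k\<le>n. (-1) ^ k * Q (Suc n) k * x ^ (k * Suc n + k * (k + 1) div 2)) 
     = (\<Sum>k\<le>n. (-1) ^ k * Q n k * x ^ (k * n + k * (k + 1) div 2)) + T n"
  proof -
    have "(\<Sum>k\<le>n. (-1) ^ k * Q (Suc n) k * x ^ (k * Suc n + k * (k + 1) div 2)) 
     - (\<Sum>k\<le>n. (-1) ^ k * Q n k * x ^ (k * n + k * (k + 1) div 2)) = (\<Sum>k\<le>n. T k - (if k = 0 then 0 else T (k - 1)))"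
      unfolding sum_subtractf[symmetric] by (rule sum.cong) (use diff in auto)
    then show ?thesis unfolding tele by (simp add: algebra_simps)
  qed
  moreover have "T n = (-1) ^ Suc n * x ^ (Suc n * (3 * Suc n - 1) div 2)"
  proof -
    have "Suc n * (3 * Suc n - 1) = n * (n + 1) + (Suc n * Suc n) * 2" by (simp add: algebra_simps)
    then have "Suc n * (3 * Suc n - 1) div 2 = n * (n + 1) div 2 + Suc n * Suc n"
      by (simp only: div_mult_self1)
    moreover have "Q n n = 1" by (simp add: Q_def)
    ultimately show ?thesis by (simp add: T_def algebra_simps)
  qed
  moreover have "(-1) ^ Suc n * Q (Suc n) (Suc n) * x ^ (Suc n * Suc n + Suc n * (Suc n + 1) div 2) = 
     (-1) ^ Suc n * x ^ (Suc n * (3 * Suc n + 1) div 2)"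
  proof -
    have "Suc n * (3 * Suc n + 1) = Suc n * (Suc n + 1) + (Suc n * Suc n) * 2" by (simp add: algebra_simps)
    then have "Suc n * (3 * Suc n + 1) div 2 = Suc n * (Suc n + 1) div 2 + Suc n * Suc n"
      by (simp only: div_mult_self1)
    then show ?thesis by (simp add: Q_def algebra_simps)
  qed
  ultimately show ?case using Suc by (simp add: algebra_simps)
qed

definition pentagonal :: "int \<Rightarrow> nat" where "pentagonal k = nat (k * (3 * k + 1) div 2)"

lemma pentagonal_double: "2 * int (pentagonal k) = k * (3 * k + 1)"
proof -
  have "k * (3 * k + 1) \<ge> 0"
  proof (cases "k \<ge> 0")
    case False
    then show ?thesis by (intro mult_nonpos_nonpos) auto
  qed simp
  moreover have "even (k * (3 * k + 1))" by simp
  ultimately show ?thesis by (simp add: pentagonal_def)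
qed

text \<open>This bound confines the indices with a given pentagonal number to
  \<open>{- n..n}\<close>, making coefficients finite sums, and compares the series with a geometric
  one.\<close>

lemma abs_le_pentagonal: "\<bar>k\<bar> \<le> int (pentagonal k)"
proof -
  have "2 * \<bar>k\<bar> \<le> k * (3 * k + 1)"
  proof (cases "k \<ge> 0")
    case True
    then have "k * 1 \<le> k * k \<or> k = 0" by (cases "k = 0") (auto intro: mult_left_mono)
    then show ?thesis using True by (auto simp: algebra_simps)
  next
    case False
    then have "(- k) * 1 \<le> (- k) * (- k)" by (intro mult_left_mono) auto
    then show ?thesis using False by (simp add: algebra_simps)
  qed
  then show ?thesis using pentagonal_double[of k] by linarith
qed

definition euler_fps :: "complex fps" where
  "euler_fps = Abs_fps (\<lambda>n. \<Sum>k\<in>{k\<in>{- int n..int n}. pentagonal k = n}. (-1) ^ nat \<bar>k\<bar>)"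

lemma pentagonal_summable:
  fixes x :: complex
  assumes "norm x < 1"
  shows "summable (\<lambda>n. norm x ^ pentagonal (int n))" "summable (\<lambda>n. norm x ^ pentagonal (- int n - 1))"
proof -
  have "pentagonal (int n) \<ge> n" "pentagonal (- int n - 1) \<ge> n" for n
    using abs_le_pentagonal[of "int n"] abs_le_pentagonal[of "- int n - 1"] by auto
  then have "norm x ^ pentagonal (int n) \<le> norm x ^ n" "norm x ^ pentagonal (- int n - 1) \<le> norm x ^ n" for n
    using assms by (auto intro: power_decreasing)
  moreover have "summable (\<lambda>n. norm x ^ n)" using assms by (intro summable_geometric) simp
  ultimately show "summable (\<lambda>n. norm x ^ pentagonal (int n))" "summable (\<lambda>n. norm x ^ pentagonal (- int n - 1))"
    by (auto intro: summable_comparison_test'[of "\<lambda>n. norm x ^ n" 0])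
qed

text \<open>In Shanks' identity the products \<open>Q n k\<close> are bounded uniformly and every
  term with k >= 1 contains at least the n-th power of x. These terms together are O(n |x|^n), so
  the partial Euler product and the partial pentagonal sum have the same limit.\<close>

lemma has_sum_pentagonal:
  fixes x :: complex
  assumes x: "norm x < 1"
  shows "((\<lambda>k. (-1) ^ nat \<bar>k\<bar> * x ^ pentagonal k) has_sum (\<Prod>n. 1 - x ^ Suc n)) UNIV"
    and "(\<Prod>n. 1 - x ^ Suc n) \<noteq> 0"
proof -
  define f where "f k = (-1) ^ nat \<bar>k\<bar> * x ^ pentagonal k" for k
  have nf: "norm (f k) = norm x ^ pentagonal k" for k by (simp add: f_def norm_mult norm_power)
  have sf: "summable (\<lambda>n. norm (f (int n)))" "summable (\<lambda>n. norm (f (- int n - 1)))"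
    unfolding nf by (rule pentagonal_summable[OF x])+
  have hs: "(f has_sum (\<Sum>n. f (int n) + f (- int n - 1))) UNIV"
    by (rule summable_on_int(2)[OF sf])
  define Q where "Q n k = (\<Prod>j\<in>{k<..n}. 1 - x ^ j)" for n k
  define a where "a = norm x"
  have a: "0 \<le> a" "a < 1" using x by (auto simp: a_def)
  have acp: "abs_convergent_prod (\<lambda>n. 1 - x ^ Suc n)"
  proof (rule summable_imp_abs_convergent_prod)
    have "summable (\<lambda>n. a ^ Suc n)" using a by (subst summable_Suc_iff) (simp add: summable_geometric)
    then show "summable (\<lambda>n. norm (1 - x ^ Suc n - 1))" by (simp add: a_def norm_mult norm_power)
  qed
  have nz: "1 - x ^ Suc n \<noteq> 0" for n
  proof
    assume "1 - x ^ Suc n = 0"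
    then have "norm (x ^ Suc n) = 1" by simp
    moreover have "norm (x ^ Suc n) < 1" unfolding norm_power 
      using x power_decreasing[of 1 "Suc n" "norm x"] by simp
    ultimately show False by simp
  qed
  have conv: "convergent_prod (\<lambda>n. 1 - x ^ Suc n)" using acp by (rule abs_convergent_prod_imp_convergent_prod)
  then show "(\<Prod>n. 1 - x ^ Suc n) \<noteq> 0" using nz by (rule prodinf_nonzero)
  have Q0: "(\<lambda>n. Q n 0) \<longlonglongrightarrow> (\<Prod>n. 1 - x ^ Suc n)"
  proof -
    have "Q (Suc n) 0 = (\<Prod>i\<le>n. 1 - x ^ Suc i)" for n
      unfolding Q_def by (rule prod.reindex_bij_witness[of _ Suc "\<lambda>i. i - 1"]) auto
    then show ?thesis using convergent_prod_LIMSEQ[OF conv] by (subst filterlim_sequentially_Suc[symmetric]) simp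
  qed
  \<comment> \<open>Comes from 1 + a^j <= exp (a^j) and the sum of the geometric series.\<close>
  define M where "M = exp (1 / (1 - a))"
  have M: "M \<ge> 0" by (simp add: M_def)
  have QM: "norm (Q n k) \<le> M" for n k
  proof -
    have "norm (Q n k) \<le> (\<Prod>j\<in>{k<..n}. 1 + a ^ j)"
      unfolding Q_def prod_norm[symmetric]
    proof (intro prod_mono conjI norm_ge_zero)
      fix j show "norm (1 - x ^ j) \<le> 1 + a ^ j"
        using norm_triangle_ineq4[of 1 "x ^ j"] by (simp add: a_def norm_power)
    qed
    also have "\<dots> \<le> (\<Prod>j\<in>{k<..n}. exp (a ^ j))" using a
      by (intro prod_mono) (auto intro: exp_ge_add_one_self add_nonneg_nonneg)
    also have "\<dots> = exp (\<Sum>j\<in>{k<..n}. a ^ j)" by (simp add: exp_sum)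
    also have "(\<Sum>j\<in>{k<..n}. a ^ j) \<le> (\<Sum>j. a ^ j)"
      using a by (intro sum_le_suminf summable_geometric) auto
    also have "\<dots> = 1 / (1 - a)" using a by (simp add: suminf_geometric)
    finally show ?thesis by (simp add: M_def)
  qed
  have rest: "(\<lambda>n. \<Sum>k\<in>{1..n}. (-1) ^ k * Q n k * x ^ (k * n + k * (k + 1) div 2)) \<longlonglongrightarrow> 0"
  proof (rule Lim_null_comparison)
    show "\<forall>\<^sub>F n in sequentially. norm (\<Sum>k\<in>{1..n}. (-1) ^ k * Q n k * x ^ (k * n + k * (k + 1) div 2)) \<le> M * (of_nat n * a ^ n)"
    proof (intro always_eventually allI)
      fix n
      have "norm (\<Sum>k\<in>{1..n}. (-1) ^ k * Q n k * x ^ (k * n + k * (k + 1) div 2)) \<le> (\<Sum>k\<in>{1..n}. M * a ^ n)"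
      proof (rule sum_norm_le)
        fix k assume k: "k \<in> {1..n}"
        have "n \<le> k * n + k * (k + 1) div 2" using k by (simp add: trans_le_add1)
        then have "a ^ (k * n + k * (k + 1) div 2) \<le> a ^ n" using a by (intro power_decreasing) auto
        then show "norm ((-1) ^ k * Q n k * x ^ (k * n + k * (k + 1) div 2)) \<le> M * a ^ n"
          using QM[of n k] a M by (auto simp: norm_mult norm_power a_def[symmetric] intro!: mult_mono)
      qed
      then show "norm (\<Sum>k\<in>{1..n}. (-1) ^ k * Q n k * x ^ (k * n + k * (k + 1) div 2)) \<le> M * (of_nat n * a ^ n)"
        by (simp add: mult_ac)
    qed
    have "(\<lambda>n. of_nat n * a ^ n) \<longlonglongrightarrow> 0" using a by (intro powser_times_n_limit_0) auto
    then show "(\<lambda>n. M * (of_nat n * a ^ n)) \<longlonglongrightarrow> 0" by (rule tendsto_mult_right_zero)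
  qed
  \<comment> \<open>The extra term \<open>f (int n)\<close> completes the paired sum to the
    symmetric range {-n..n} of Shanks' identity.\<close>
  have part: "(\<Sum>i<n. f (int i) + f (- int i - 1)) + f (int n) 
     = Q n 0 + (\<Sum>k\<in>{1..n}. (-1) ^ k * Q n k * x ^ (k * n + k * (k + 1) div 2))" for n
  proof -
    have pen: "pentagonal (int k) = k * (3 * k + 1) div 2" for k
      using pentagonal_double[of "int k"] by (metis nat_int of_nat_1 of_nat_add of_nat_mult of_nat_numeral zdiv_int pentagonal_def)
    have pen': "pentagonal (- int k) = k * (3 * k - 1) div 2" if "k \<ge> 1" for k
    proof -
      have "2 * int (pentagonal (- int k)) = int (k * (3 * k - 1))"
        using pentagonal_double[of "- int k"] that by (simp add: of_nat_diff algebra_simps)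
      then have "2 * pentagonal (- int k) = k * (3 * k - 1)" by linarith
      then show ?thesis by simp
    qed
    have f1: "f (- int i - 1) = (-1) ^ Suc i * x ^ (Suc i * (3 * Suc i - 1) div 2)" for i
    proof -
      have "- int i - 1 = - int (Suc i)" "nat \<bar>- int (Suc i)\<bar> = Suc i" by simp_all
      moreover have "pentagonal (- int (Suc i)) = Suc i * (3 * Suc i - 1) div 2" by (rule pen') simp
      ultimately show ?thesis unfolding f_def by (simp only:)
    qed
    have f2: "f (int i) = (-1) ^ i * x ^ (i * (3 * i + 1) div 2)" for i
      by (simp add: f_def pen)
    have "(\<Sum>i<n. f (int i) + f (- int i - 1)) + f (int n) =
       1 + (\<Sum>k=1..n. (-1) ^ k * (x ^ (k * (3 * k + 1) div 2) + x ^ (k * (3 * k - 1) div 2)))"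
    proof (induction n)
      case 0 then show ?case by (simp add: f_def pentagonal_def)
    next
      case (Suc n)
      have "(\<Sum>i<Suc n. f (int i) + f (- int i - 1)) + f (int (Suc n)) 
        = ((\<Sum>i<n. f (int i) + f (- int i - 1)) + f (int n)) + f (- int n - 1) + f (int (Suc n))"
        by simp
      also have "\<dots> = 1 + (\<Sum>k=1..Suc n. (-1) ^ k * (x ^ (k * (3 * k + 1) div 2) + x ^ (k * (3 * k - 1) div 2)))"
        unfolding Suc unfolding f1 f2 by (simp add: distrib_left add_ac)
      finally show ?case .
    qed
    also have "\<dots> = (\<Sum>k\<le>n. (-1) ^ k * Q n k * x ^ (k * n + k * (k + 1) div 2))"
      unfolding Q_def by (rule Shanks_identity[symmetric])
    also have "{..n} = insert 0 {1..n}" by auto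
    finally show ?thesis by simp
  qed
  have "(\<lambda>n. (\<Sum>i<n. f (int i) + f (- int i - 1)) + f (int n)) \<longlonglongrightarrow> (\<Prod>n. 1 - x ^ Suc n) + 0"
    unfolding part by (rule tendsto_add[OF Q0 rest])
  moreover have "(\<lambda>n. (\<Sum>i<n. f (int i) + f (- int i - 1)) + f (int n)) \<longlonglongrightarrow> (\<Sum>n. f (int n) + f (- int n - 1)) + 0"
  proof (rule tendsto_add)
    show "(\<lambda>n. \<Sum>i<n. f (int i) + f (- int i - 1)) \<longlonglongrightarrow> (\<Sum>n. f (int n) + f (- int n - 1))"
      by (rule summable_LIMSEQ[OF summable_add[OF sf[THEN summable_norm_cancel]]])
    show "(\<lambda>n. f (int n)) \<longlonglongrightarrow> 0" by (rule summable_LIMSEQ_zero[OF sf(1)[THEN summable_norm_cancel]])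
  qed
  ultimately have "(\<Prod>n. 1 - x ^ Suc n) = (\<Sum>n. f (int n) + f (- int n - 1))"
    using LIMSEQ_unique by fastforce
  then show "((\<lambda>k. (-1) ^ nat \<bar>k\<bar> * x ^ pentagonal k) has_sum (\<Prod>n. 1 - x ^ Suc n)) UNIV"
    using hs by (simp add: f_def[abs_def])
qed


lemma
  shows euler_fps_conv_radius: "fps_conv_radius euler_fps \<ge> 1"
    and eval_euler_fps: "norm x < 1 \<Longrightarrow> eval_fps euler_fps x = (\<Prod>n. 1 - x ^ Suc n)"
proof -
  have sums: "(\<lambda>n. fps_nth euler_fps n * x ^ n) sums (\<Prod>n. 1 - x ^ Suc n)" if "norm x < 1" for x
  proof -
    define A where "A n = {k\<in>{- int n..int n}. pentagonal k = n}" for n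
    have A: "k \<in> A n \<longleftrightarrow> pentagonal k = n" for k n
      using abs_le_pentagonal[of k] by (auto simp: A_def)
    define f where "f k = (-1) ^ nat \<bar>k\<bar> * x ^ pentagonal k" for k
    have "bij_betw snd (Sigma UNIV A) UNIV"
      by (rule bij_betwI[of _ _ _ "\<lambda>k. (pentagonal k, k)"]) (auto simp: A)
    from has_sum_reindex_bij_betw[OF this, of f] 
    have "((\<lambda>z. f (snd z)) has_sum (\<Prod>n. 1 - x ^ Suc n)) (Sigma UNIV A)"
      using has_sum_pentagonal(1)[OF that] by (simp add: f_def[abs_def])
    moreover have "((\<lambda>y. f (snd (n, y))) has_sum (\<Sum>k\<in>A n. f k)) (A n)" for n
    proof -
      have "finite (A n)" unfolding A_def by (rule finite_subset[of _ "{- int n..int n}"]) auto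
      then show ?thesis by (simp add: has_sum_finite)
    qed
    ultimately have "((\<lambda>n. \<Sum>k\<in>A n. f k) has_sum (\<Prod>n. 1 - x ^ Suc n)) UNIV"
      by (rule has_sum_SigmaD)
    then have "(\<lambda>n. \<Sum>k\<in>A n. f k) sums (\<Prod>n. 1 - x ^ Suc n)" by (rule has_sum_imp_sums)
    moreover have "(\<Sum>k\<in>A n. f k) = fps_nth euler_fps n * x ^ n" for n
    proof -
      have "(\<Sum>k\<in>A n. f k) = (\<Sum>k\<in>A n. (-1) ^ nat \<bar>k\<bar> * x ^ n)"
        by (rule sum.cong) (auto simp: f_def A)
      then show ?thesis by (simp add: euler_fps_def A_def sum_distrib_right)
    qed
    ultimately show ?thesis by simp
  qed
  show "fps_conv_radius euler_fps \<ge> 1"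
    unfolding fps_conv_radius_def
  proof (rule conv_radius_geI_ex)
    fix r :: real assume "0 < r" "ereal r < 1"
    then show "\<exists>z. norm z = r \<and> summable (\<lambda>n. fps_nth euler_fps n * z ^ n)"
      using sums[of "of_real r"] by (intro exI[of _ "of_real r"]) (auto simp: sums_iff)
  qed
  show "norm x < 1 \<Longrightarrow> eval_fps euler_fps x = (\<Prod>n. 1 - x ^ Suc n)"
    using sums[of x] by (simp add: eval_fps_def sums_iff)
qed

lemma eval_euler_fps_nonzero: "norm x < 1 \<Longrightarrow> eval_fps euler_fps x \<noteq> 0"
  using has_sum_pentagonal(2)[of x] eval_euler_fps[of x] by simp

section \<open>The inversion law of the eta function\<close>

lemma nome_imaginary: "nome (\<i> * of_real s) = of_real (exp (- 2 * pi * s))"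
proof -
  have "2 * pi * \<i> * (\<i> * of_real s) = of_real (- 2 * pi * s)" by (simp add: complex_eq_iff)
  then show ?thesis by (simp only: nome_def exp_of_real)
qed

text \<open>Dedekind's eta function at tau = i s: the factor q^(1/24) completes the square, k (3k +
  1) / 2 + 1/24 = (3/2) (k + 1/6)^2.\<close>

definition eta_series :: "real \<Rightarrow> complex" where
  "eta_series s = (\<Sum>\<^sub>\<infinity>k\<in>(UNIV::int set). (-1) ^ nat \<bar>k\<bar> * of_real (exp (- 3 * pi * s * (of_int k + 1 / 6)\<^sup>2)))"

lemma eta_series_eq:
  assumes "s > 0"
  shows "eta_series s = of_real (exp (- 2 * pi * s / 24)) * qeval euler_fps (\<i> * of_real s)"
proof -
  define x where "x = complex_of_real (exp (- 2 * pi * s))"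
  have x: "norm x < 1" using assms by (simp add: x_def)
  have "qeval euler_fps (\<i> * of_real s) = (\<Prod>n. 1 - x ^ Suc n)"
    using eval_euler_fps[OF x] by (simp add: qeval_def nome_imaginary x_def)
  then have "((\<lambda>k. of_real (exp (- 2 * pi * s / 24)) * ((-1) ^ nat \<bar>k\<bar> * x ^ pentagonal k)) has_sum
     of_real (exp (- 2 * pi * s / 24)) * qeval euler_fps (\<i> * of_real s)) UNIV"
    using has_sum_cmult_right[OF has_sum_pentagonal(1)[OF x]] by simp
  moreover have "of_real (exp (- 2 * pi * s / 24)) * ((-1) ^ nat \<bar>k\<bar> * x ^ pentagonal k) 
     = (-1) ^ nat \<bar>k\<bar> * complex_of_real (exp (- 3 * pi * s * (of_int k + 1 / 6)\<^sup>2))" for k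
  proof -
    have "2 * real (pentagonal k) = of_int k * (3 * of_int k + 1)"
      using arg_cong[OF pentagonal_double[of k], of real_of_int] by simp
    then have "real (pentagonal k) = of_int k * (3 * of_int k + 1) / 2" by simp
    then have "- 2 * pi * s / 24 + of_nat (pentagonal k) * (- 2 * pi * s) = - 3 * pi * s * (of_int k + 1 / 6)\<^sup>2"
      by (simp only:) (simp add: power2_eq_square field_simps)
    then have "exp (- 2 * pi * s / 24) * exp (- 2 * pi * s) ^ pentagonal k = exp (- 3 * pi * s * (of_int k + 1 / 6)\<^sup>2)"
      by (simp only: exp_of_nat_mult[symmetric] exp_add[symmetric])
    then have "complex_of_real (exp (- 2 * pi * s / 24)) * x ^ pentagonal k = of_real (exp (- 3 * pi * s * (of_int k + 1 / 6)\<^sup>2))"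
      by (simp only: x_def of_real_mult[symmetric] of_real_power[symmetric])
    then show ?thesis by (metis mult.left_commute)
  qed
  ultimately show ?thesis unfolding eta_series_def by (simp only: infsumI)
qed

text \<open>The signs are the character 1/2 on the shifted lattice, so Poisson summation applies
  with parameter 3s. In the dual sum the class 2 mod 3 cancels under k -> - 1 - k, and the classes 0
  and 1 give the eta series at 1/s with factors 1 and exp (i pi / 3), which add up to sqrt 3 exp (i
  pi / 6).\<close>

lemma eta_series_transformation:
  assumes s: "s > 0"
  shows "eta_series (1 / s) = of_real (sqrt s) * eta_series s"
proof -
  define g where "g m = complex_of_real (exp (- pi * (of_int m - 1 / 2)\<^sup>2 / (3 * s))) * cis (2 * pi * of_int m * (1 / 6))" for m :: int
  have cis_int: "cis (pi * of_int k) = (-1) ^ nat \<bar>k\<bar>" for k :: int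
  proof -
    have "cis (pi * of_int k) = (-1) powi k"
      using cis_power_int[of pi k] by (simp add: mult.commute)
    then show ?thesis by (auto simp: power_int_def)
  qed
  have summ: "(\<lambda>m. norm (g m)) summable_on A" for A
  proof -
    have "(\<lambda>m. norm (g m)) summable_on UNIV"
      using gaussian_abs_summable_int[of "pi / (3 * s)" "- 1 / 2"] s by (simp add: g_def norm_mult)
    then show ?thesis using summable_on_subset_banach by blast
  qed
  note summ' = abs_summable_summable[OF summ]
  let ?r = "\<lambda>j. range (\<lambda>k::int. 3 * k + j)"
  have inj: "inj (\<lambda>k::int. 3 * k + j)" "inj (\<lambda>k::int. - (3 * k))" for j by (auto simp: inj_def)
  \<comment> \<open>Multiples of 3 are written as - 3k because (- 3k - 1/2)^2 = 9 (k + 1/6)^2; with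
    3k the shift would be - 1/6.\<close>
  have U: "UNIV = ?r 1 \<union> (?r 2 \<union> range (\<lambda>k::int. - (3 * k)))"
  proof -
    have "m \<in> ?r 1 \<union> (?r 2 \<union> range (\<lambda>k::int. - (3 * k)))" for m
    proof -
      have "m mod 3 = 0 \<or> m mod 3 = 1 \<or> m mod 3 = 2" by presburger
      moreover have "m = 3 * (m div 3) + m mod 3" by simp
      ultimately consider "m = 3 * (m div 3) + 1" | "m = 3 * (m div 3) + 2" | "m = - (3 * (- (m div 3)))" by force
      then show ?thesis by cases (blast intro: range_eqI)+
    qed
    then show ?thesis by blast
  qed
  have D: "?r 1 \<inter> (?r 2 \<union> range (\<lambda>k::int. - (3 * k))) = {}" "?r 2 \<inter> range (\<lambda>k::int. - (3 * k)) = {}"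
    by (auto; presburger)+
  define e where "e k = (-1) ^ nat \<bar>k\<bar> * complex_of_real (exp (- 3 * pi * (1 / s) * (of_int k + 1 / 6)\<^sup>2))" for k :: int
  have r1: "infsum g (?r 1) = cis (pi / 3) * eta_series (1 / s)"
  proof -
    have "g (3 * k + 1) = cis (pi / 3) * e k" for k
    proof -
      have "- pi * (of_int (3 * k + 1) - 1 / 2)\<^sup>2 / (3 * s) = - 3 * pi * (1 / s) * (of_int k + 1 / 6)\<^sup>2"
        using s by (simp add: power2_eq_square field_simps)
      moreover have "2 * pi * of_int (3 * k + 1) * (1 / 6) = pi / 3 + pi * of_int k" by (simp add: field_simps)
      ultimately show ?thesis unfolding g_def e_def by (simp only: cis_mult[symmetric] cis_int) (simp add: mult_ac)
    qed
    then show ?thesis unfolding infsum_reindex[OF inj(1)] o_def eta_series_def e_def[symmetric] by (simp add: infsum_cmult_right')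
  qed
  have r3: "infsum g (range (\<lambda>k::int. - (3 * k))) = eta_series (1 / s)"
  proof -
    have "g (- (3 * k)) = e k" for k
    proof -
      have "- pi * (of_int (- (3 * k)) - 1 / 2)\<^sup>2 / (3 * s) = - 3 * pi * (1 / s) * (of_int k + 1 / 6)\<^sup>2"
        using s by (simp add: power2_eq_square field_simps)
      moreover have "2 * pi * of_int (- (3 * k)) * (1 / 6) = pi * of_int (- k)" by (simp add: field_simps)
      ultimately show ?thesis unfolding g_def e_def by (simp only: cis_int abs_minus_cancel) (simp add: mult_ac)
    qed
    then show ?thesis unfolding infsum_reindex[OF inj(2)] o_def eta_series_def e_def[symmetric] by simp
  qed
  have r2: "infsum g (?r 2) = 0"
  proof -
    have "bij_betw (\<lambda>k::int. - 1 - k) UNIV UNIV" by (rule bij_betwI[of _ _ _ "\<lambda>k. - 1 - k"]) auto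
    note bb = infsum_reindex_bij_betw[OF this, of "\<lambda>k. g (3 * k + 2)"]
    have "g (3 * (- 1 - k) + 2) = - g (3 * k + 2)" for k
    proof -
      have "(of_int (3 * (- 1 - k) + 2) - 1 / 2 :: real)\<^sup>2 = (of_int (3 * k + 2) - 1 / 2)\<^sup>2"
        by (simp add: power2_eq_square field_simps)
      moreover have "cis (2 * pi * of_int (3 * (- 1 - k) + 2) * (1 / 6)) = - cis (2 * pi * of_int (3 * k + 2) * (1 / 6))"
      proof -
        have "2 * pi * of_int (3 * (- 1 - k) + 2) * (1 / 6) = 2 * pi * of_int (3 * k + 2) * (1 / 6) + pi * of_int (- 2 * k - 1)"
          by (simp add: field_simps)
        moreover have "(-1) ^ nat \<bar>- 2 * k - 1\<bar> = (-1 :: complex)"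
          by (rule neg_one_odd_power) (simp add: even_nat_iff)
        ultimately show ?thesis by (simp only: cis_mult[symmetric] cis_int) simp
      qed
      ultimately show ?thesis unfolding g_def by (simp only:) simp
    qed
    then have "(\<Sum>\<^sub>\<infinity>k. g (3 * k + 2)) = - (\<Sum>\<^sub>\<infinity>k. g (3 * k + 2))" using bb by (simp add: infsum_uminus)
    then show ?thesis unfolding infsum_reindex[OF inj(1)] o_def by simp
  qed
  have tot: "infsum g UNIV = (1 + cis (pi / 3)) * eta_series (1 / s)"
    by (subst U, subst infsum_Un_disjoint[OF summ' summ' D(1)], subst infsum_Un_disjoint[OF summ' summ' D(2)])
       (simp only: r1 r2 r3, simp add: algebra_simps)
  have "of_real (exp (- pi * (3 * s) * (of_int k + 1 / 6)\<^sup>2)) * cis (2 * pi * (1 / 2) * (of_int k + 1 / 6)) =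
      cis (pi / 6) * ((-1) ^ nat \<bar>k\<bar> * complex_of_real (exp (- 3 * pi * s * (of_int k + 1 / 6)\<^sup>2)))" for k :: int
  proof -
    have "2 * pi * (1 / 2) * (of_int k + 1 / 6) = pi / 6 + pi * of_int k" by (simp add: field_simps)
    moreover have "- pi * (3 * s) * (of_int k + 1 / 6)\<^sup>2 = - 3 * pi * s * (of_int k + 1 / 6)\<^sup>2" by simp
    ultimately show ?thesis by (simp only: cis_mult[symmetric] cis_int) (simp add: mult_ac)
  qed
  then have "cis (pi / 6) * eta_series s = of_real (1 / sqrt (3 * s)) * infsum g UNIV"
    using gaussian_Poisson_1d[of "3 * s" "1 / 6" "1 / 2"] s 
    by (simp add: eta_series_def g_def[abs_def] infsum_cmult_right')
  also have "\<dots> = of_real (1 / sqrt (3 * s)) * (1 + cis (pi / 3)) * eta_series (1 / s)" by (simp add: tot)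
  also have "1 + cis (pi / 3) = of_real (sqrt 3) * cis (pi / 6)"
    by (simp add: complex_eq_iff cos_60 sin_60 cos_30 sin_30)
  finally have "cis (pi / 6) * eta_series s = cis (pi / 6) * (of_real (1 / sqrt s) * eta_series (1 / s))"
    using s by (simp add: real_sqrt_mult)
  then have "eta_series s = of_real (1 / sqrt s) * eta_series (1 / s)"
    by (subst (asm) mult_cancel_left) (simp del: of_real_divide)
  then show ?thesis using s by simp
qed

section \<open>The discriminant form\<close>

definition Delta :: "complex fps" where "Delta = fps_X * euler_fps ^ 24"

lemma conv_radius_ge_1_intros:
  fixes F G :: "complex fps"
  shows "fps_conv_radius F \<ge> 1 \<Longrightarrow> fps_conv_radius G \<ge> 1 \<Longrightarrow> fps_conv_radius (F * G) \<ge> 1"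
    "fps_conv_radius F \<ge> 1 \<Longrightarrow> fps_conv_radius G \<ge> 1 \<Longrightarrow> fps_conv_radius (F + G) \<ge> 1"
    "fps_conv_radius F \<ge> 1 \<Longrightarrow> fps_conv_radius G \<ge> 1 \<Longrightarrow> fps_conv_radius (F - G) \<ge> 1"
    "fps_conv_radius F \<ge> 1 \<Longrightarrow> fps_conv_radius (F ^ n) \<ge> 1"
    "fps_conv_radius F \<ge> 1 \<Longrightarrow> fps_conv_radius (fps_deriv F) \<ge> 1"
    "fps_conv_radius (fps_X :: complex fps) \<ge> 1" "fps_conv_radius (fps_const c) \<ge> 1"
    "fps_conv_radius (1 :: complex fps) \<ge> 1"
  by ((rule fps_conv_radius_mult_ge fps_conv_radius_add_ge fps_conv_radius_diff_ge
      order_trans[OF _ fps_conv_radius_power] order_trans[OF _ fps_conv_radius_deriv]; assumption) | simp)+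

lemma qeval_simps:
  assumes "\<tau> \<in> upper" "fps_conv_radius F \<ge> 1" 
  shows "fps_conv_radius G \<ge> 1 \<Longrightarrow> qeval (F * G) \<tau> = qeval F \<tau> * qeval G \<tau>"
    "fps_conv_radius G \<ge> 1 \<Longrightarrow> qeval (F + G) \<tau> = qeval F \<tau> + qeval G \<tau>"
    "fps_conv_radius G \<ge> 1 \<Longrightarrow> qeval (F - G) \<tau> = qeval F \<tau> - qeval G \<tau>"
    "qeval (F ^ n) \<tau> = qeval F \<tau> ^ n"
proof -
  note r = nome_in_eball(2)[OF assms(1)]
  show "qeval (F * G) \<tau> = qeval F \<tau> * qeval G \<tau>" if "fps_conv_radius G \<ge> 1"
    unfolding qeval_def by (rule eval_fps_mult[OF r[OF assms(2)] r[OF that]])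
  show "qeval (F + G) \<tau> = qeval F \<tau> + qeval G \<tau>" if "fps_conv_radius G \<ge> 1"
    unfolding qeval_def by (rule eval_fps_add[OF r[OF assms(2)] r[OF that]])
  show "qeval (F - G) \<tau> = qeval F \<tau> - qeval G \<tau>" if "fps_conv_radius G \<ge> 1"
    unfolding qeval_def by (rule eval_fps_diff[OF r[OF assms(2)] r[OF that]])
  show "qeval (F ^ n) \<tau> = qeval F \<tau> ^ n"
    unfolding qeval_def by (rule eval_fps_power[OF r[OF assms(2)]])
qed

lemma qeval_base [simp]: "qeval fps_X \<tau> = nome \<tau>" "qeval (fps_const c) \<tau> = c"
  by (simp_all add: qeval_def)

lemma imaginary_upper: "s > 0 \<Longrightarrow> \<i> * of_real s \<in> upper" by (simp add: upper_def)

text \<open>In the 24th power the prefactor q^(1/24) of eta becomes q, and the factor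
  \<open>sqrt s\<close> becomes \<open>s ^ 12\<close>, which equals \<open>(\<i> * s) ^ 12\<close>
  because 12 is divisible by 4.\<close>

lemma modular_Delta: "modular 12 Delta"
proof (rule modularI_imaginary_axis)
  show "fps_conv_radius Delta \<ge> 1" unfolding Delta_def
    by (intro conv_radius_ge_1_intros euler_fps_conv_radius)
  have D: "qeval Delta (\<i> * of_real s) = eta_series s ^ 24" if "s > 0" for s
  proof -
    have "exp (- 2 * pi * s / 24) ^ 24 = exp (- 2 * pi * s)" by (simp flip: exp_of_nat_mult)
    then have "complex_of_real (exp (- 2 * pi * s / 24)) ^ 24 = of_real (exp (- 2 * pi * s))"
      by (simp only: of_real_power[symmetric])
    then show ?thesis
      using imaginary_upper[OF that] euler_fps_conv_radius
      by (simp add: Delta_def qeval_simps conv_radius_ge_1_intros nome_imaginary eta_series_eq[OF that] power_mult_distrib)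
  qed
  fix s :: real assume s: "s > 0"
  have "\<i> / of_real s = \<i> * of_real (1 / s)" by simp
  then have "qeval Delta (\<i> / of_real s) = eta_series (1 / s) ^ 24" using D[of "1 / s"] s by simp
  also have "\<dots> = (of_real (sqrt s) ^ 2) ^ 12 * eta_series s ^ 24"
    unfolding eta_series_transformation[OF s] by (simp add: power_mult_distrib flip: power_mult)
  also have "of_real (sqrt s) ^ 2 = complex_of_real s" using s by (simp flip: of_real_power)
  also have "complex_of_real s ^ 12 = (\<i> * of_real s) ^ 12" by (simp add: power_mult_distrib)
  finally show "qeval Delta (\<i> / of_real s) = (\<i> * of_real s) ^ 12 * qeval Delta (\<i> * of_real s)"
    using D[OF s] by simp
qed

section \<open>Eisenstein series and the residue relation\<close>

definition qderiv :: "complex fps \<Rightarrow> complex fps" where "qderiv F = fps_X * fps_deriv F"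

lemma qderiv_conv_radius: "fps_conv_radius F \<ge> 1 \<Longrightarrow> fps_conv_radius (qderiv F) \<ge> 1"
  unfolding qderiv_def by (intro conv_radius_ge_1_intros)

lemma has_field_derivative_qeval:
  assumes "\<tau> \<in> upper" "fps_conv_radius F \<ge> 1"
  shows "(qeval F has_field_derivative 2 * pi * \<i> * qeval (qderiv F) \<tau>) (at \<tau>)"
proof -
  have r: "fps_conv_radius (fps_deriv F) \<ge> 1" by (intro conv_radius_ge_1_intros assms)
  have "(nome has_field_derivative 2 * pi * \<i> * nome \<tau>) (at \<tau>)"
    unfolding nome_def by (auto intro!: derivative_eq_intros)
  moreover have "(eval_fps F has_field_derivative eval_fps (fps_deriv F) (nome \<tau>)) (at (nome \<tau>))"
    by (intro has_field_derivative_eval_fps nome_in_eball assms)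
  ultimately have "((\<lambda>x. eval_fps F (nome x)) has_field_derivative eval_fps (fps_deriv F) (nome \<tau>) * (2 * pi * \<i> * nome \<tau>)) (at \<tau>)"
    by (rule DERIV_chain2[rotated])
  moreover have "qeval (qderiv F) \<tau> = nome \<tau> * eval_fps (fps_deriv F) (nome \<tau>)"
    unfolding qderiv_def by (subst qeval_simps) (auto simp: assms r conv_radius_ge_1_intros qeval_def)
  ultimately show ?thesis by (simp add: qeval_def[abs_def] mult_ac)
qed

lemma has_field_derivative_neg_inverse:
  fixes \<tau> :: complex
  assumes "\<tau> \<in> upper" "(f has_field_derivative f') (at (- 1 / \<tau>))"
  shows "((\<lambda>x. f (- 1 / x)) has_field_derivative f' / \<tau>\<^sup>2) (at \<tau>)"
proof -
  have "\<tau> \<noteq> 0" using assms by (auto simp: upper_def)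
  then have "((\<lambda>x. - 1 / x) has_field_derivative 1 / \<tau>\<^sup>2) (at \<tau>)"
    by (auto intro!: derivative_eq_intros simp: power2_eq_square)
  from DERIV_chain2[OF assms(2) this] show ?thesis by simp
qed

lemma has_field_derivative_unique_on_upper:
  assumes "(f has_field_derivative a) (at \<tau>)" "(g has_field_derivative b) (at \<tau>)"
    and "\<And>\<tau>. \<tau> \<in> upper \<Longrightarrow> f \<tau> = g \<tau>" "\<tau> \<in> upper"
  shows "a = b"
proof -
  have "(g has_field_derivative a) (at \<tau>)"
    by (rule has_field_derivative_transform_within_open[OF assms(1) upper_properties(1) assms(4,3)])
  then show ?thesis using assms(2) DERIV_unique by blast
qed

lemma upper_nonzero: "\<tau> \<in> upper \<Longrightarrow> \<tau> \<noteq> 0" by (auto simp: upper_def)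

text \<open>Differentiating the transformation law raises the weight by two but leaves an anomaly
  proportional to \<open>k\<close>. \<open>E2\<close> has an anomaly of the same shape, which allows
  the two to be cancelled.\<close>

lemma modular_qderiv:
  assumes F: "modular k F" and \<tau>: "\<tau> \<in> upper"
  shows "2 * pi * \<i> * qeval (qderiv F) (- 1 / \<tau>) = 2 * pi * \<i> * \<tau> ^ (k + 2) * qeval (qderiv F) \<tau> + of_nat k * \<tau> ^ (k + 1) * qeval F \<tau>"
proof -
  have r: "fps_conv_radius F \<ge> 1" using F by (simp add: modular_def)
  have "\<tau> \<noteq> 0" using \<tau> by (rule upper_nonzero)
  have "(2 * pi * \<i> * qeval (qderiv F) (- 1 / \<tau>)) / \<tau>\<^sup>2 = 
      of_nat k * \<tau> ^ (k - 1) * qeval F \<tau> + 2 * pi * \<i> * qeval (qderiv F) \<tau> * \<tau> ^ k"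
  proof (rule has_field_derivative_unique_on_upper[OF _ _ _ \<tau>])
    show "((\<lambda>x. qeval F (- 1 / x)) has_field_derivative (2 * pi * \<i> * qeval (qderiv F) (- 1 / \<tau>)) / \<tau>\<^sup>2) (at \<tau>)"
      by (intro has_field_derivative_neg_inverse has_field_derivative_qeval upper_neg_inverse \<tau> r)
    show "((\<lambda>x. x ^ k * qeval F x) has_field_derivative 
        of_nat k * \<tau> ^ (k - 1) * qeval F \<tau> + 2 * pi * \<i> * qeval (qderiv F) \<tau> * \<tau> ^ k) (at \<tau>)"
      using has_field_derivative_qeval[OF \<tau> r] by (auto intro!: derivative_eq_intros)
    show "qeval F (- 1 / \<tau>) = \<tau> ^ k * qeval F \<tau>" if "\<tau> \<in> upper" for \<tau>
      using F that by (simp add: modular_def)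
  qed
  then have "2 * pi * \<i> * qeval (qderiv F) (- 1 / \<tau>) = 
      of_nat k * (\<tau>\<^sup>2 * \<tau> ^ (k - 1)) * qeval F \<tau> + 2 * pi * \<i> * qeval (qderiv F) \<tau> * (\<tau>\<^sup>2 * \<tau> ^ k)"
    using \<open>\<tau> \<noteq> 0\<close> by (simp add: divide_eq_eq algebra_simps)
  also have "of_nat k * (\<tau>\<^sup>2 * \<tau> ^ (k - 1)) = of_nat k * \<tau> ^ (k + 1)"
    by (cases k) (auto simp: power2_eq_square)
  also have "\<tau>\<^sup>2 * \<tau> ^ k = \<tau> ^ (k + 2)" by (simp add: power2_eq_square)
  finally show ?thesis by (simp add: algebra_simps)
qed

lemma modular_mult: "modular k F \<Longrightarrow> modular l G \<Longrightarrow> modular (k + l) (F * G)"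
  unfolding modular_def
  by (auto simp: qeval_simps upper_neg_inverse[simplified] power_add conv_radius_ge_1_intros)

lemma modular_1: "modular 0 1"
  using conv_radius_ge_1_intros(8) by (simp add: modular_def qeval_def)

lemma modular_power: "modular k F \<Longrightarrow> modular (k * n) (F ^ n)"
  by (induction n) (auto simp: modular_1 intro: modular_mult)

section \<open>Eisenstein series derived from the discriminant\<close>

definition inv_euler :: "complex fps" where "inv_euler = inverse euler_fps"

lemma euler_fps_nth_0: "fps_nth euler_fps 0 = 1"
proof -
  have "{k\<in>{- int 0..int 0}. pentagonal k = 0} = {0}" by (auto simp: pentagonal_def)
  then show ?thesis unfolding euler_fps_def by (simp only: fps_nth_Abs_fps) simp
qed

lemma euler_inv_euler: "euler_fps * inv_euler = 1" "inv_euler * euler_fps = 1"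
  using inverse_mult_eq_1[of euler_fps] inverse_mult_eq_1'[of euler_fps]
  by (simp_all add: inv_euler_def euler_fps_nth_0)

text \<open>Euler's product has no zero in the unit disc, so its reciprocal is holomorphic there and
  the formal inverse converges on the whole disc.\<close>

lemma inv_euler_conv_radius: "fps_conv_radius inv_euler \<ge> 1"
proof (rule holomorphic_on_imp_fps_conv_radius_ge)
  have "(1::ereal) > 0" by simp
  then have "fps_conv_radius euler_fps > 0" using euler_fps_conv_radius by (rule less_le_trans)
  then have "eval_fps euler_fps has_fps_expansion euler_fps" by (rule eval_fps_has_fps_expansion)
  then show "(\<lambda>x. inverse (eval_fps euler_fps x)) has_fps_expansion inv_euler"
    unfolding inv_euler_def by (rule has_fps_expansion_inverse) (simp add: euler_fps_nth_0)
  have "eball 0 1 \<subseteq> eball 0 (fps_conv_radius euler_fps)" by (rule eball_mono) (rule euler_fps_conv_radius)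
  moreover have "eval_fps euler_fps x \<noteq> 0" if "x \<in> eball 0 1" for x
    using that by (intro eval_euler_fps_nonzero) (simp add: one_ereal_def)
  ultimately show "(\<lambda>x. inverse (eval_fps euler_fps x)) holomorphic_on eball 0 1"
    by (intro holomorphic_intros) auto
qed

lemmas qfps_conv_radius = conv_radius_ge_1_intros euler_fps_conv_radius inv_euler_conv_radius qderiv_conv_radius

text \<open>The logarithmic derivative of \<open>Delta\<close>, with 1 coming from the factor q. For
  \<open>E4\<close> and \<open>E6\<close>, Ramanujan's differential equations serve as definitions,
  so modularity follows by differentiation instead of summation over a lattice of periods.\<close>

definition E2 :: "complex fps" where "E2 = 1 + fps_const 24 * (qderiv euler_fps * inv_euler)"
definition E4 :: "complex fps" where "E4 = E2 * E2 - fps_const 12 * qderiv E2"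
definition E6 :: "complex fps" where "E6 = E2 * E4 - fps_const 3 * qderiv E4"

lemma Eisenstein_conv_radius: "fps_conv_radius E2 \<ge> 1" "fps_conv_radius E4 \<ge> 1" "fps_conv_radius E6 \<ge> 1"
proof -
  show 2: "fps_conv_radius E2 \<ge> 1" unfolding E2_def by (intro qfps_conv_radius)
  then show 4: "fps_conv_radius E4 \<ge> 1" unfolding E4_def by (intro qfps_conv_radius)
  show "fps_conv_radius E6 \<ge> 1" unfolding E6_def by (intro qfps_conv_radius 2 4)
qed

lemma Delta_conv_radius: "fps_conv_radius Delta \<ge> 1" 
  using modular_Delta by (simp add: modular_def)

lemma qderiv_Delta: "qderiv Delta = Delta * E2"
proof -
  have p: "euler_fps ^ 24 * inv_euler = euler_fps ^ 23"
  proof -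
    have "euler_fps ^ 24 = euler_fps ^ 23 * euler_fps" by (rule power_Suc2[of _ 23, simplified])
    then show ?thesis by (simp add: mult.assoc euler_inv_euler)
  qed
  have d: "fps_deriv (euler_fps ^ 24) = fps_const 24 * fps_deriv euler_fps * euler_fps ^ 23"
    by (simp add: fps_deriv_power)
  have "Delta * E2 = fps_X * euler_fps ^ 24 + fps_const 24 * fps_X * fps_X * fps_deriv euler_fps * (euler_fps ^ 24 * inv_euler)"
    by (simp only: Delta_def E2_def qderiv_def distrib_left mult_1_right mult_1_left mult_ac)
  also have "\<dots> = qderiv Delta"
    unfolding p qderiv_def Delta_def fps_deriv_mult d fps_deriv_fps_X by (simp add: distrib_left mult_ac)
  finally show ?thesis ..
qed

lemma qeval_Delta_nonzero: "\<tau> \<in> upper \<Longrightarrow> qeval Delta \<tau> \<noteq> 0"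
  using eval_euler_fps_nonzero[OF norm_nome_less, of \<tau>]
  by (simp add: Delta_def qeval_simps qfps_conv_radius) (simp add: qeval_def)

text \<open>Since the derivative of \<open>Delta\<close> is \<open>Delta * E2\<close>, its anomaly
  divided by the nonvanishing \<open>Delta\<close> is that of \<open>E2\<close>; the 12 is the
  weight of \<open>Delta\<close>.\<close>

lemma E2_transformation:
  assumes \<tau>: "\<tau> \<in> upper"
  shows "qeval E2 (- 1 / \<tau>) = \<tau>\<^sup>2 * qeval E2 \<tau> + 12 / (2 * pi * \<i>) * \<tau>"
proof -
  have t: "qeval Delta (- 1 / \<tau>) = \<tau> ^ 12 * qeval Delta \<tau>" using modular_Delta \<tau> by (simp add: modular_def)
  have "2 * pi * \<i> * (qeval Delta (- 1 / \<tau>) * qeval E2 (- 1 / \<tau>)) 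
     = 2 * pi * \<i> * \<tau> ^ (12 + 2) * (qeval Delta \<tau> * qeval E2 \<tau>) + of_nat 12 * \<tau> ^ (12 + 1) * qeval Delta \<tau>"
    using modular_qderiv[OF modular_Delta \<tau>] \<tau> upper_neg_inverse[OF \<tau>]
    by (simp only: qderiv_Delta qeval_simps Delta_conv_radius Eisenstein_conv_radius)
  then have "(\<tau> ^ 12 * qeval Delta \<tau>) * (2 * pi * \<i> * qeval E2 (- 1 / \<tau>)) 
     = (\<tau> ^ 12 * qeval Delta \<tau>) * (2 * pi * \<i> * \<tau>\<^sup>2 * qeval E2 \<tau> + 12 * \<tau>)"
    unfolding t by (simp add: algebra_simps eval_nat_numeral)
  then have *: "(2 * pi * \<i>) * qeval E2 (- 1 / \<tau>) = (2 * pi * \<i>) * \<tau>\<^sup>2 * qeval E2 \<tau> + 12 * \<tau>"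
    using qeval_Delta_nonzero[OF \<tau>] upper_nonzero[OF \<tau>] by simp
  have "a = \<tau>\<^sup>2 * b + 12 / c * \<tau>" if "c * a = c * \<tau>\<^sup>2 * b + 12 * \<tau>" "c \<noteq> 0" for a b c
    using that by (simp add: field_simps)
  from this[OF *] show ?thesis by simp
qed

text \<open>The anomaly of \<open>E2\<close> squared and the derivative of that anomaly produce the
  same terms once the derivative is multiplied by 12.\<close>

lemma modular_E4: "modular 4 E4"
  unfolding modular_def
proof (intro conjI Eisenstein_conv_radius ballI)
  fix \<tau> assume \<tau>: "\<tau> \<in> upper"
  note \<tau>' = upper_neg_inverse[OF \<tau>]
  note nz = upper_nonzero[OF \<tau>]
  define c :: complex where "c = 2 * pi * \<i>"
  have c: "c \<noteq> 0" by (simp add: c_def)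
  have "(c * qeval (qderiv E2) (- 1 / \<tau>)) / \<tau>\<^sup>2 = 
      2 * \<tau> * qeval E2 \<tau> + \<tau>\<^sup>2 * (c * qeval (qderiv E2) \<tau>) + 12 / c"
  proof (rule has_field_derivative_unique_on_upper[OF _ _ _ \<tau>])
    show "((\<lambda>x. qeval E2 (- 1 / x)) has_field_derivative (c * qeval (qderiv E2) (- 1 / \<tau>)) / \<tau>\<^sup>2) (at \<tau>)"
      unfolding c_def by (intro has_field_derivative_neg_inverse has_field_derivative_qeval \<tau> \<tau>' Eisenstein_conv_radius)
    show "((\<lambda>x. x\<^sup>2 * qeval E2 x + 12 / c * x) has_field_derivative 
        2 * \<tau> * qeval E2 \<tau> + \<tau>\<^sup>2 * (c * qeval (qderiv E2) \<tau>) + 12 / c) (at \<tau>)"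
      using has_field_derivative_qeval[OF \<tau> Eisenstein_conv_radius(1), folded c_def] c
      by (auto intro!: derivative_eq_intros)
    show "qeval E2 (- 1 / \<tau>) = \<tau>\<^sup>2 * qeval E2 \<tau> + 12 / c * \<tau>" if "\<tau> \<in> upper" for \<tau>
      unfolding c_def by (rule E2_transformation[OF that])
  qed
  then have D: "qeval (qderiv E2) (- 1 / \<tau>) = 
      \<tau>\<^sup>2 * (2 * \<tau> * qeval E2 \<tau> + \<tau>\<^sup>2 * (c * qeval (qderiv E2) \<tau>) + 12 / c) / c"
    using nz c by (simp add: field_simps)
  have ev: "qeval E4 \<tau> = qeval E2 \<tau> * qeval E2 \<tau> - 12 * qeval (qderiv E2) \<tau>" if "\<tau> \<in> upper" for \<tau>
    using that unfolding E4_def by (simp add: qeval_simps qfps_conv_radius Eisenstein_conv_radius)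
  show "qeval E4 (- 1 / \<tau>) = \<tau> ^ 4 * qeval E4 \<tau>"
    unfolding ev[OF \<tau>] ev[OF \<tau>'] D E2_transformation[OF \<tau>, folded c_def]
    using c by (simp add: field_simps eval_nat_numeral)
qed

text \<open>A Serre derivative: \<open>E2 * E4\<close> contributes the anomaly 12, and three times
  the derivative of a form of weight 4 contributes the same.\<close>

lemma modular_E6: "modular 6 E6"
  unfolding modular_def
proof (intro conjI Eisenstein_conv_radius ballI)
  fix \<tau> assume \<tau>: "\<tau> \<in> upper"
  note \<tau>' = upper_neg_inverse[OF \<tau>]
  note nz = upper_nonzero[OF \<tau>]
  define c :: complex where "c = 2 * pi * \<i>"
  have c: "c \<noteq> 0" by (simp add: c_def)
  have "c * qeval (qderiv E4) (- 1 / \<tau>) = c * \<tau> ^ 6 * qeval (qderiv E4) \<tau> + 4 * \<tau> ^ 5 * qeval E4 \<tau>"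
    using modular_qderiv[OF modular_E4 \<tau>, folded c_def] by simp
  then have D: "qeval (qderiv E4) (- 1 / \<tau>) = (c * \<tau> ^ 6 * qeval (qderiv E4) \<tau> + 4 * \<tau> ^ 5 * qeval E4 \<tau>) / c"
    using c by (simp add: field_simps)
  have E4t: "qeval E4 (- 1 / \<tau>) = \<tau> ^ 4 * qeval E4 \<tau>" using modular_E4 \<tau> by (simp add: modular_def)
  have ev: "qeval E6 \<tau> = qeval E2 \<tau> * qeval E4 \<tau> - 3 * qeval (qderiv E4) \<tau>" if "\<tau> \<in> upper" for \<tau>
    using that unfolding E6_def by (simp add: qeval_simps qfps_conv_radius Eisenstein_conv_radius)
  show "qeval E6 (- 1 / \<tau>) = \<tau> ^ 6 * qeval E6 \<tau>"
    unfolding ev[OF \<tau>] ev[OF \<tau>'] D E2_transformation[OF \<tau>, folded c_def] E4t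
    using c by (simp add: field_simps eval_nat_numeral)
qed

section \<open>Constant terms in weight 2\<close>

lemma nome_add_1: "nome (\<tau> + 1) = nome \<tau>"
  by (simp add: nome_def ring_distribs exp_add exp_eq_1)

text \<open>
  A form \<open>h\<close> of weight 2 has a primitive \<open>\<Phi>\<close> on the half-plane. It satisfies \<open>\<Phi> (- 1 / \<tau>) = \<Phi> \<tau>\<close>
  (compare at \<open>\<i>\<close>), and \<open>\<Phi> (\<tau> + 1) - \<Phi> \<tau>\<close> is the constant term of \<open>h\<close>. At the cube root of unity \<open>\<rho>\<close>,
  where \<open>- 1 / \<rho> = \<rho> + 1\<close>, this forces the constant term to vanish.
\<close>

theorem modular_residue:
  assumes N: "modular (12 * j + 2) N"
  shows "fps_nth (N * inv_euler ^ (24 * j)) j = 0"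
proof -
  define H where "H = N * inv_euler ^ (24 * j)"
  have rN: "fps_conv_radius N \<ge> 1" using N by (simp add: modular_def)
  have rH: "fps_conv_radius H \<ge> 1" unfolding H_def by (intro qfps_conv_radius rN)
  define h where "h \<tau> = qeval N \<tau> / qeval Delta \<tau> ^ j" for \<tau>
  have h_H: "h \<tau> = qeval H \<tau> / nome \<tau> ^ j" if "\<tau> \<in> upper" for \<tau>
  proof -
    have "qeval euler_fps \<tau> * qeval inv_euler \<tau> = qeval (euler_fps * inv_euler) \<tau>"
      using that by (simp add: qeval_simps qfps_conv_radius)
    also have "\<dots> = 1" unfolding euler_inv_euler by (simp add: qeval_def)
    finally have i: "qeval inv_euler \<tau> = 1 / qeval euler_fps \<tau>"
      by (auto simp: divide_simps mult.commute)
    have "qeval H \<tau> = qeval N \<tau> * qeval inv_euler \<tau> ^ (24 * j)"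
      using that unfolding H_def by (simp add: qeval_simps qfps_conv_radius rN)
    moreover have "qeval Delta \<tau> ^ j = nome \<tau> ^ j * qeval euler_fps \<tau> ^ (24 * j)"
      using that unfolding Delta_def by (simp add: qeval_simps qfps_conv_radius power_mult_distrib power_mult)
    ultimately show ?thesis by (simp add: h_def i power_one_over mult_ac)
  qed
  have h_inv: "h (- 1 / \<tau>) / \<tau>\<^sup>2 = h \<tau>" if "\<tau> \<in> upper" for \<tau>
  proof -
    have "qeval N (- 1 / \<tau>) = \<tau> ^ (12 * j + 2) * qeval N \<tau>" using N that by (simp add: modular_def)
    moreover have "qeval Delta (- 1 / \<tau>) = \<tau> ^ 12 * qeval Delta \<tau>" using modular_Delta that by (simp add: modular_def)
    ultimately show ?thesis using upper_nonzero[OF that] qeval_Delta_nonzero[OF that]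
      by (simp add: h_def power_add power_mult power_mult_distrib power2_eq_square)
  qed
  \<comment> \<open>After division by q^j the terms of \<open>H\<close> beyond index j are q times
    this series. The factor q is absorbed by the chain rule, so a primitive of \<open>H2\<close> in
    q yields a primitive in tau.\<close>
  define H2 where "H2 = fps_shift (Suc j) H"
  have rH2: "fps_conv_radius H2 \<ge> 1" using rH by (simp add: H2_def)
  have "eval_fps H2 holomorphic_on ball 0 1"
    using holomorphic_on_subset[OF holomorphic_on_eval_fps[of "eball 0 (fps_conv_radius H2)" H2] eball_mono[OF rH2, of 0]]
    by (simp add: one_ereal_def)
  then obtain g where g: "\<And>x. x \<in> ball 0 1 \<Longrightarrow> (g has_field_derivative eval_fps H2 x) (at x)"
    using holomorphic_convex_primitive'[of "ball 0 1" "eval_fps H2"] by (auto simp: at_within_open[of _ "ball 0 1"])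
  define c :: complex where "c = 2 * pi * \<i>"
  have c: "c \<noteq> 0" by (simp add: c_def)
  \<comment> \<open>Polar terms are integrated as exponentials; the constant term contributes the
    only summand that can change under tau + 1.\<close>
  define \<Phi> where "\<Phi> \<tau> = (\<Sum>n<j. fps_nth H n / (c * (of_nat n - of_nat j)) * exp (c * (of_nat n - of_nat j) * \<tau>)) 
     + fps_nth H j * \<tau> + g (nome \<tau>) / c" for \<tau>
  have expand: "h \<tau> = (\<Sum>n<j. fps_nth H n * exp (c * (of_nat n - of_nat j) * \<tau>)) + fps_nth H j + nome \<tau> * qeval H2 \<tau>"
    if "\<tau> \<in> upper" for \<tau>
  proof -
    define z where "z = nome \<tau>"
    have z: "z \<noteq> 0" "ereal (norm z) < fps_conv_radius H" using nome_in_eball(2)[OF that rH] by (auto simp: z_def)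
    have "eval_fps H z = (\<Sum>n. fps_nth H (n + Suc j) * z ^ (n + Suc j)) + (\<Sum>n<Suc j. fps_nth H n * z ^ n)"
      unfolding eval_fps_def by (rule suminf_split_initial_segment[OF summable_fps[OF z(2)]])
    also have "(\<Sum>n. fps_nth H (n + Suc j) * z ^ (n + Suc j)) = (\<Sum>n. z ^ Suc j * (fps_nth H2 n * z ^ n))"
      by (simp add: H2_def power_add mult_ac)
    also have "\<dots> = z ^ Suc j * eval_fps H2 z"
      unfolding eval_fps_def using z(2) by (intro suminf_mult summable_fps) (simp add: H2_def)
    finally have "h \<tau> = (z ^ Suc j * eval_fps H2 z + (\<Sum>n<j. fps_nth H n * z ^ n) + fps_nth H j * z ^ j) / z ^ j"
      unfolding h_H[OF that] by (simp add: qeval_def z_def)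
    also have "\<dots> = z * eval_fps H2 z + (\<Sum>n<j. fps_nth H n * (z ^ n / z ^ j)) + fps_nth H j"
      using z(1) by (simp add: add_divide_distrib sum_divide_distrib)
    also have "(\<Sum>n<j. fps_nth H n * (z ^ n / z ^ j)) = (\<Sum>n<j. fps_nth H n * exp (c * (of_nat n - of_nat j) * \<tau>))"
    proof (rule sum.cong[OF refl], rule arg_cong[of _ _ "\<lambda>x. _ * x"])
      fix n
      have "c * (of_nat n - of_nat j) * \<tau> = of_nat n * (c * \<tau>) - of_nat j * (c * \<tau>)" by (simp add: algebra_simps)
      then show "z ^ n / z ^ j = exp (c * (of_nat n - of_nat j) * \<tau>)"
        by (simp only: z_def nome_def exp_diff exp_of_nat_mult c_def)
    qed
    finally show ?thesis by (simp add: qeval_def z_def)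
  qed
  have \<Phi>': "(\<Phi> has_field_derivative h \<tau>) (at \<tau>)" if "\<tau> \<in> upper" for \<tau>
  proof -
    have nome': "(nome has_field_derivative c * nome \<tau>) (at \<tau>)"
      unfolding nome_def c_def by (auto intro!: derivative_eq_intros)
    have "nome \<tau> \<in> ball 0 1" using norm_nome_less[OF that] by simp
    from DERIV_chain2[OF g[OF this] nome']
    have "((\<lambda>x. g (nome x)) has_field_derivative eval_fps H2 (nome \<tau>) * (c * nome \<tau>)) (at \<tau>)" .
    then have 1: "((\<lambda>x. g (nome x) / c) has_field_derivative eval_fps H2 (nome \<tau>) * (c * nome \<tau>) / c) (at \<tau>)"
      by (rule DERIV_cdivide)
    have 2: "((\<lambda>x. fps_nth H n / (c * (of_nat n - of_nat j)) * exp (c * (of_nat n - of_nat j) * x)) has_field_derivative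
       fps_nth H n * exp (c * (of_nat n - of_nat j) * \<tau>)) (at \<tau>)" if "n \<in> {..<j}" for n
    proof -
      have "c * (of_nat n - of_nat j) \<noteq> 0" using that c by simp
      then show ?thesis by (auto intro!: derivative_eq_intros)
    qed
    show ?thesis unfolding \<Phi>_def expand[OF that]
      by (rule derivative_eq_intros DERIV_sum 1 2 refl | assumption)+ (use c in \<open>simp add: qeval_def mult_ac\<close>)
  qed
  have \<Phi>_1: "\<Phi> (\<tau> + 1) = \<Phi> \<tau> + fps_nth H j" for \<tau>
  proof -
    have "exp (c * (of_nat n - of_nat j) * (\<tau> + 1)) = exp (c * (of_nat n - of_nat j) * \<tau>)" for n
    proof -
      have "c * (of_nat n - of_nat j) * (\<tau> + 1) = c * (of_nat n - of_nat j) * \<tau> + of_int (2 * (int n - int j)) * (of_real pi * \<i>)"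
        by (simp add: c_def algebra_simps)
      moreover have "exp (of_int (2 * (int n - int j)) * (of_real pi * \<i>)) = (1 :: complex)"
        by (subst exp_eq_1) (auto intro!: exI[of _ "int n - int j"])
      ultimately show ?thesis by (simp only: exp_add mult_1_right)
    qed
    then show ?thesis unfolding \<Phi>_def nome_add_1 by (simp add: distrib_left)
  qed
  have \<Phi>_inv: "\<Phi> (- 1 / \<tau>) = \<Phi> \<tau>" if "\<tau> \<in> upper" for \<tau>
  proof -
    have "((\<lambda>x. \<Phi> (- 1 / x) - \<Phi> x) has_field_derivative 0) (at x within upper)" if "x \<in> upper" for x
      using DERIV_diff[OF has_field_derivative_neg_inverse[OF that \<Phi>'[OF upper_neg_inverse[OF that]]] \<Phi>'[OF that]]
      unfolding h_inv[OF that] by (simp add: has_field_derivative_at_within)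
    then have "\<exists>k. \<forall>x\<in>upper. \<Phi> (- 1 / x) - \<Phi> x = k"
      by (rule has_field_derivative_zero_constant[OF upper_properties(2)])
    then obtain k where k: "\<And>x. x \<in> upper \<Longrightarrow> \<Phi> (- 1 / x) - \<Phi> x = k" by blast
    have "- 1 / \<i> = \<i>" by (simp add: complex_eq_iff)
    then have "k = 0" using k[OF upper_properties(4)] by simp
    then show ?thesis using k[OF that] by simp
  qed
  define \<rho> where "\<rho> = Complex (- 1 / 2) (sqrt 3 / 2)"
  have \<rho>: "\<rho> \<in> upper" by (simp add: \<rho>_def upper_def)
  have "\<rho> * (\<rho> + 1) = - 1" by (simp add: \<rho>_def complex_eq_iff field_simps)
  then have "- 1 / \<rho> = \<rho> + 1" using upper_nonzero[OF \<rho>] by (simp add: field_simps)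
  then have "\<Phi> (\<rho> + 1) = \<Phi> \<rho>" using \<Phi>_inv[OF \<rho>] by simp
  then have "fps_nth H j = 0" using \<Phi>_1[of \<rho>] by simp
  then show ?thesis by (simp add: H_def)
qed

section \<open>Theta series of even unimodular lattices\<close>

lemma zspan_subset_span: "zspan B \<subseteq> span (B :: 'a::real_inner set)"
proof
  fix y assume "y \<in> zspan B"
  then show "y \<in> span B"
  proof (induction rule: zmod.span_induct_alt)
    case base show ?case by (rule span_zero)
  next
    case (step c x y) then show ?case by (meson span_add span_scale span_base)
  qed
qed

lemma span_zspan: "span (zspan B) = span (B :: 'a::real_inner set)"
proof
  show "span (zspan B) \<subseteq> span B" using zspan_subset_span[of B] by (simp add: span_minimal)
  show "span B \<subseteq> span (zspan B)" by (intro span_mono zmod.span_superset)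
qed

lemma dual_span_eq_dual_lattice: "dual_span B = dual_lattice (zspan B)"
proof -
  have "x \<bullet> y \<in> \<int>" if "x \<in> zspan B" "\<And>b. b \<in> B \<Longrightarrow> b \<bullet> y \<in> \<int>" for x y :: 'a
    using that(1)
  proof (induction rule: zmod.span_induct_alt)
    case base show ?case by simp
  next
    case (step c z w) then show ?case using that(2) by (simp add: inner_add_left)
  qed
  then show ?thesis unfolding dual_span_def dual_lattice_def span_zspan
    using zmod.span_superset[of B] by blast
qed

text \<open>Comparing both sides at t = 1 and u = 0 gives S = c S with S > 0, so self-duality forces
  the constant to be 1.\<close>

lemma
  fixes L :: "'a::real_inner set"
  assumes "lattice_of_rank n L" "unimodular L"
  shows unimodular_gauss_summable: "\<And>t v. t > 0 \<Longrightarrow> v \<in> span L \<Longrightarrow> (\<lambda>y. gauss t (y + v)) summable_on L"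
    and unimodular_Poisson: "\<And>t u. t > 0 \<Longrightarrow> u \<in> span L \<Longrightarrow> 
      (\<Sum>\<^sub>\<infinity>y\<in>L. of_real (gauss t y) * cis (2 * pi * (u \<bullet> y))) = 
      complex_of_real (1 / sqrt t ^ n) * (\<Sum>\<^sub>\<infinity>w\<in>L. of_real (gauss (1 / t) (w - u)))"
proof -
  obtain B where B: "finite B" "card B = n" "independent B" "L = zspan B"
    using assms(1) by (auto simp: lattice_of_rank_def)
  have D: "dual_span B = L" using assms(2) B(4) by (simp add: dual_span_eq_dual_lattice unimodular_def)
  have S: "span L = span B" by (simp add: B(4) span_zspan)
  obtain c where "lattice_Poisson B c" using lattice_Poisson_exists B by blast
  note P = this[unfolded lattice_Poisson_def D B(4)[symmetric] S[symmetric] B(2)]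
  have z: "0 \<in> span L" by (rule span_zero)
  show sm: "(\<lambda>y. gauss t (y + v)) summable_on L" if "t > 0" "v \<in> span L" for t v
    using P that by blast
  have eq: "(\<Sum>\<^sub>\<infinity>y\<in>L. of_real (gauss t y) * cis (2 * pi * (u \<bullet> y))) = 
      complex_of_real (c / sqrt t ^ n) * (\<Sum>\<^sub>\<infinity>w\<in>L. of_real (gauss (1 / t) (w - u)))"
    if "t > 0" "u \<in> span L" for t u
    using P[THEN conjunct2, THEN conjunct2, THEN conjunct2, rule_format, OF that(1) z that(2)] by simp
  define S0 where "S0 = (\<Sum>\<^sub>\<infinity>y\<in>L. gauss 1 y)"
  have sm1: "gauss 1 summable_on L" using sm[of 1 0] z by simp
  have "0 \<in> L" unfolding B(4) by (rule zmod.span_zero)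
  have "(\<Sum>y\<in>{0::'a}. gauss 1 y) \<le> S0" unfolding S0_def
    by (rule finite_sum_le_infsum[OF sm1]) (use \<open>0 \<in> L\<close> in auto)
  then have "S0 > 0" by (simp add: gauss_def)
  have "of_real S0 = complex_of_real c * of_real S0"
    using eq[of 1 0] z infsum_of_real_summable[OF sm1] by (simp add: S0_def)
  then have "c = 1" using \<open>S0 > 0\<close> by (simp flip: of_real_mult)
  then show "(\<Sum>\<^sub>\<infinity>y\<in>L. of_real (gauss t y) * cis (2 * pi * (u \<bullet> y))) = 
      complex_of_real (1 / sqrt t ^ n) * (\<Sum>\<^sub>\<infinity>w\<in>L. of_real (gauss (1 / t) (w - u)))"
    if "t > 0" "u \<in> span L" for t u
    using eq[OF that] by simp
qed

section \<open>Power series of Gaussians\<close>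

definition gauss_fps :: "complex \<Rightarrow> complex fps" where
  "gauss_fps c = Abs_fps (\<lambda>k. if even k then c ^ (k div 2) / fact (k div 2) else 0)"

lemma gauss_fps_compose: "gauss_fps c = fps_exp c oo (fps_X ^ 2)"
proof (rule fps_ext)
  fix n
  have "(\<Sum>i = 0..n. fps_exp c $ i * ((fps_X ^ 2) ^ i) $ n) = (\<Sum>i = 0..n. if i = n div 2 \<and> even n then c ^ i / fact i else 0)"
    by (rule sum.cong) (auto simp: power_mult[symmetric])
  also have "\<dots> = gauss_fps c $ n" by (auto simp: gauss_fps_def)
  finally show "gauss_fps c $ n = (fps_exp c oo (fps_X ^ 2)) $ n" by (simp add: fps_compose_nth)
qed

lemma gauss_fps_mult: "gauss_fps c * gauss_fps d = gauss_fps (c + d)"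
  by (simp add: gauss_fps_compose fps_exp_add_mult fps_compose_mult_distrib)

lemma gauss_fps_scale: "gauss_fps c oo (fps_const k * fps_X) = gauss_fps (k\<^sup>2 * c)"
proof (rule fps_ext)
  fix n show "(gauss_fps c oo (fps_const k * fps_X)) $ n = gauss_fps (k\<^sup>2 * c) $ n"
  proof (cases "even n")
    case True
    then obtain m where "n = 2 * m" by (rule evenE)
    then show ?thesis by (simp add: gauss_fps_def power_mult power_mult_distrib)
  qed (simp add: gauss_fps_def)
qed

lemma has_fps_expansion_gauss_fps: "(\<lambda>z. exp (c * z\<^sup>2)) has_fps_expansion gauss_fps c"
proof -
  have "((\<lambda>z. exp (c * z)) \<circ> (\<lambda>z. z ^ 2)) has_fps_expansion (fps_exp c oo (fps_X ^ 2))"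
    by (intro has_fps_expansion_compose fps_expansion_intros) auto
  then show ?thesis by (simp add: o_def gauss_fps_compose)
qed

text \<open>Poisson summation yields values at purely imaginary arguments, where the exponential is
  a character. These points accumulate at 0, so the identity theorem gives equality of all Taylor
  coefficients.\<close>

lemma fps_expansion_eqI_imaginary:
  assumes F: "f has_fps_expansion F" and G: "g has_fps_expansion G"
    and eq: "\<And>s::real. f (\<i> * of_real s) = g (\<i> * of_real s)"
  shows "F = G"
proof -
  have FG: "(\<lambda>z. f z - g z) has_fps_expansion F - G" by (intro fps_expansion_intros F G)
  then obtain S where S: "open S" "0 \<in> S" "(\<lambda>z. f z - g z) holomorphic_on S"
    using has_fps_expansion_imp_holomorphic by metis
  then obtain r where r: "r > 0" "ball 0 r \<subseteq> S" using openE by blast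
  have "f z - g z = 0" if "z \<in> ball 0 r" for z
  proof (rule analytic_continuation[of "\<lambda>z. f z - g z" "ball 0 r" "(\<lambda>s. \<i> * of_real s) ` {0<..<r}" 0])
    show "(\<lambda>z. f z - g z) holomorphic_on ball 0 r" using S(3) r(2) by (rule holomorphic_on_subset)
    show "0 islimpt (\<lambda>s. \<i> * complex_of_real s) ` {0<..<r}"
    proof (rule islimpt_approachable[THEN iffD2], intro allI impI)
      fix e :: real assume "e > 0"
      then show "\<exists>x'\<in>(\<lambda>s. \<i> * complex_of_real s) ` {0<..<r}. x' \<noteq> 0 \<and> dist x' 0 < e"
        using r(1) by (intro bexI[of _ "\<i> * complex_of_real (min e r / 2)"] imageI) (auto simp: norm_mult)
    qed
    show "(\<lambda>s. \<i> * complex_of_real s) ` {0<..<r} \<subseteq> ball 0 r" by (auto simp: norm_mult)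
  qed (use r that eq in auto)
  then have "eventually (\<lambda>z. f z - g z = 0) (nhds 0)"
    using r(1) by (intro eventually_nhds[THEN iffD2] exI[of _ "ball 0 r"]) auto
  then have "(\<lambda>z. f z - g z) has_fps_expansion 0" by (simp add: has_fps_expansion_0_iff)
  then have "F - G = 0" using FG fps_expansion_unique_complex by blast
  then show ?thesis by simp
qed

section \<open>Moments over shells and their Gaussian sums\<close>

lemma summable_on_bounded_below_imp_finite:
  fixes f :: "'b \<Rightarrow> real"
  assumes "f summable_on A" "e > 0" "\<And>x. x \<in> A \<Longrightarrow> f x \<ge> e"
  shows "finite A"
proof (rule ccontr)
  assume "infinite A"
  obtain k :: nat where k: "infsum f A / e < k" using reals_Archimedean2 by blast
  obtain F where F: "finite F" "card F = k" "F \<subseteq> A" using infinite_arbitrarily_large[OF \<open>infinite A\<close>] by blast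
  have "k * e = (\<Sum>x\<in>F. e)" using F by simp
  also have "\<dots> \<le> sum f F" using F assms(3) by (intro sum_mono) auto
  also have "\<dots> \<le> infsum f A"
    using F assms by (intro finite_sum_le_infsum) (auto intro: order_trans[OF less_imp_le])
  finally show False using k assms(2) by (simp add: field_simps)
qed

text \<open>Norms are even, so shells are indexed by half the norm, the exponent of q in the theta
  series.\<close>

definition shell_moment :: "'a::real_inner set \<Rightarrow> 'a \<Rightarrow> nat \<Rightarrow> nat \<Rightarrow> real" where
  "shell_moment L x m N = (\<Sum>y\<in>shell L (2 * real N). (x \<bullet> y) ^ m)"

definition theta_fps :: "'a::real_inner set \<Rightarrow> 'a \<Rightarrow> nat \<Rightarrow> complex fps" where
  "theta_fps L x m = Abs_fps (\<lambda>N. of_real (shell_moment L x m N))"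

definition gauss_moment :: "'a::real_inner set \<Rightarrow> 'a \<Rightarrow> nat \<Rightarrow> real \<Rightarrow> complex" where
  "gauss_moment L x m t = (\<Sum>\<^sub>\<infinity>y\<in>L. of_real ((x \<bullet> y) ^ m * gauss t y))"

context
  fixes n :: nat and L :: "'a::real_inner set" and x :: 'a
  assumes rank: "lattice_of_rank n L" and even: "even_lattice L" and uni: "unimodular L" and x: "x \<in> L"
begin

lemma x_span: "c *\<^sub>R x \<in> span L" using x by (intro span_scale span_base)

lemma gauss_shift: 
  assumes "t > 0"
  shows "gauss t y * exp (s * (x \<bullet> y)) = exp (s\<^sup>2 * (x \<bullet> x) / (4 * pi * t)) * gauss t (y - (s / (2 * pi * t)) *\<^sub>R x)"
proof -
  define a where "a = s / (2 * pi * t)"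
  have s: "s = 2 * pi * t * a" using assms by (simp add: a_def)
  have "s\<^sup>2 * (x \<bullet> x) / (4 * pi * t) = pi * t * a\<^sup>2 * (x \<bullet> x)"
    using assms unfolding s by (simp add: field_simps power2_eq_square)
  moreover have "- pi * t * (y \<bullet> y) + s * (x \<bullet> y) = pi * t * a\<^sup>2 * (x \<bullet> x) + - pi * t * ((y - a *\<^sub>R x) \<bullet> (y - a *\<^sub>R x))"
    unfolding s by (simp add: inner_diff_left inner_diff_right inner_commute power2_eq_square algebra_simps)
  ultimately show ?thesis unfolding gauss_def a_def[symmetric] exp_add[symmetric] by simp
qed

text \<open>An exponential factor only moves the centre of the Gaussian, by completing the square;
  the absolute value is covered by adding both signs of \<open>s\<close>. This majorizes all moments
  and the exponential series.\<close>

lemma gauss_exp_summable: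
  assumes "t > 0"
  shows "(\<lambda>y. gauss t y * exp (s * \<bar>x \<bullet> y\<bar>)) summable_on L"
proof (rule summable_on_comparison_test)
  have "(\<lambda>y. gauss t y * exp (s * (x \<bullet> y))) summable_on L" for s
    unfolding gauss_shift[OF assms] 
    using unimodular_gauss_summable[OF rank uni assms x_span[of "- (s / (2 * pi * t))"]]
    by (intro summable_on_cmult_right) simp
  then show "(\<lambda>y. gauss t y * exp (s * (x \<bullet> y)) + gauss t y * exp ((- s) * (x \<bullet> y))) summable_on L"
    by (intro summable_on_add)
  show "gauss t y * exp (s * \<bar>x \<bullet> y\<bar>) \<le> gauss t y * exp (s * (x \<bullet> y)) + gauss t y * exp ((- s) * (x \<bullet> y))" for y
    by (cases "x \<bullet> y \<ge> 0") auto
qed auto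

lemma gauss_summable: "t > 0 \<Longrightarrow> gauss t summable_on L"
  using gauss_exp_summable[of t 0] by simp

text \<open>The lattice sum and the exponential series are interchanged; the double family is
  absolutely summable by \<open>gauss_exp_summable\<close> with the norm of
  \<open>z\<close>.\<close>

lemma exponential_expansion:
  assumes t: "t > 0"
  shows "((\<lambda>m. gauss_moment L x m t * z ^ m / fact m) has_sum (\<Sum>\<^sub>\<infinity>y\<in>L. of_real (gauss t y) * exp (z * of_real (x \<bullet> y)))) UNIV"
    and moment_abs_summable: "(\<lambda>y. (x \<bullet> y) ^ m * gauss t y) summable_on L"
proof -
  define F where "F y m = complex_of_real (gauss t y) * ((z * of_real (x \<bullet> y)) ^ m / fact m)" for y m
  have exp_has_sum: "((\<lambda>m. w ^ m / fact m) has_sum exp w) UNIV" for w :: complex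
  proof -
    have s: "(\<lambda>m. w ^ m / fact m) sums exp w" using exp_converges[of w] by (simp add: scaleR_conv_of_real field_simps)
    have "summable (\<lambda>m. norm (w ^ m / fact m))" 
      using summable_norm_exp[of w] by (simp add: scaleR_conv_of_real norm_divide norm_mult norm_power divide_inverse mult.commute)
    then show ?thesis using s by (rule norm_summable_imp_has_sum)
  qed
  have exp_has_sum_real: "((\<lambda>m. w ^ m / fact m) has_sum exp w) UNIV" for w :: real
  proof -
    have "((\<lambda>m. complex_of_real (w ^ m / fact m)) has_sum of_real (exp w)) UNIV"
      using exp_has_sum[of "of_real w"] by (simp add: exp_of_real)
    then show ?thesis by (subst (asm) has_sum_of_real_iff)
  qed
  have nF: "norm (F y m) = gauss t y * ((norm z * \<bar>x \<bullet> y\<bar>) ^ m / fact m)" for y m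
    by (simp add: F_def norm_mult norm_divide norm_power)
  have "(\<lambda>(y, m). norm (F y m)) summable_on (L \<times> UNIV)"
  proof (rule summable_on_SigmaI)
    show "((\<lambda>m. case (y, m) of (y, m) \<Rightarrow> norm (F y m)) has_sum gauss t y * exp (norm z * \<bar>x \<bullet> y\<bar>)) UNIV" for y
      unfolding case_prod_conv nF by (intro has_sum_cmult_right exp_has_sum_real)
  qed (use gauss_exp_summable[OF t] in auto)
  then have sF: "(\<lambda>(y, m). F y m) summable_on (L \<times> UNIV)"
    by (rule abs_summable_summable[OF summable_on_cong[THEN iffD1, rotated]]) (simp add: case_prod_unfold)
  have inner_m: "((\<lambda>m. F y m) has_sum of_real (gauss t y) * exp (z * of_real (x \<bullet> y))) UNIV" for y
    unfolding F_def by (intro has_sum_cmult_right exp_has_sum)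
  define S where "S = (\<Sum>\<^sub>\<infinity>(y, m)\<in>L \<times> UNIV. F y m)"
  have hS: "((\<lambda>(y, m). F y m) has_sum S) (L \<times> UNIV)" unfolding S_def by (rule has_sum_infsum[OF sF])
  have "((\<lambda>y. of_real (gauss t y) * exp (z * of_real (x \<bullet> y))) has_sum S) L"
    by (rule has_sum_SigmaD[OF hS]) (use inner_m in simp)
  then have S: "S = (\<Sum>\<^sub>\<infinity>y\<in>L. of_real (gauss t y) * exp (z * of_real (x \<bullet> y)))" by (simp add: infsumI)
  show moment: "(\<lambda>y. (x \<bullet> y) ^ m * gauss t y) summable_on L" for m
  proof -
    have "(\<lambda>y. norm ((x \<bullet> y) ^ m * gauss t y)) summable_on L"
    proof (rule summable_on_comparison_test)
      show "(\<lambda>y. fact m * (gauss t y * exp (1 * \<bar>x \<bullet> y\<bar>))) summable_on L"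
        by (intro summable_on_cmult_right gauss_exp_summable t)
      fix y
      have "\<bar>x \<bullet> y\<bar> ^ m / fact m \<le> exp \<bar>x \<bullet> y\<bar>"
        using finite_sum_le_has_sum[OF exp_has_sum_real[of "\<bar>x \<bullet> y\<bar>"], of "{m}"] by simp
      then have "\<bar>x \<bullet> y\<bar> ^ m \<le> fact m * exp \<bar>x \<bullet> y\<bar>" by (simp add: field_simps)
      then have "\<bar>x \<bullet> y\<bar> ^ m * gauss t y \<le> fact m * exp \<bar>x \<bullet> y\<bar> * gauss t y" by (intro mult_right_mono) auto
      then show "norm ((x \<bullet> y) ^ m * gauss t y) \<le> fact m * (gauss t y * exp (1 * \<bar>x \<bullet> y\<bar>))"
        by (simp add: norm_mult power_abs mult_ac abs_mult)
    qed auto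
    then show ?thesis by (rule abs_summable_summable)
  qed
  have inner_y: "((\<lambda>y. F y m) has_sum gauss_moment L x m t * z ^ m / fact m) L" for m
  proof -
    have "((\<lambda>y. complex_of_real ((x \<bullet> y) ^ m * gauss t y)) has_sum gauss_moment L x m t) L"
      unfolding gauss_moment_def by (intro has_sum_infsum summable_on_of_real moment)
    from has_sum_cmult_left[OF this, of "z ^ m / fact m"] show ?thesis
      by (simp add: F_def power_mult_distrib mult_ac)
  qed
  have "((\<lambda>(m, y). F y m) has_sum S) (UNIV \<times> L)"
    using hS by (subst (asm) has_sum_swap) simp
  then have "((\<lambda>m. gauss_moment L x m t * z ^ m / fact m) has_sum S) UNIV"
    by (rule has_sum_SigmaD) (use inner_y in simp)
  then show "((\<lambda>m. gauss_moment L x m t * z ^ m / fact m) has_sum (\<Sum>\<^sub>\<infinity>y\<in>L. of_real (gauss t y) * exp (z * of_real (x \<bullet> y)))) UNIV"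
    by (simp add: S)
qed

definition "moment_fps t = Abs_fps (\<lambda>m. gauss_moment L x m t / fact m)"

lemma moment_fps_has_fps_expansion:
  assumes t: "t > 0"
  shows "(\<lambda>z. \<Sum>\<^sub>\<infinity>y\<in>L. of_real (gauss t y) * exp (z * of_real (x \<bullet> y))) has_fps_expansion moment_fps t"
proof -
  have sums: "(\<lambda>m. moment_fps t $ m * z ^ m) sums (\<Sum>\<^sub>\<infinity>y\<in>L. of_real (gauss t y) * exp (z * of_real (x \<bullet> y)))" for z
    using has_sum_imp_sums[OF exponential_expansion(1)[OF t, where z = z]] by (simp add: moment_fps_def)
  have "fps_conv_radius (moment_fps t) \<ge> \<infinity>"
    unfolding fps_conv_radius_def
  proof (rule conv_radius_geI_ex)
    fix r :: real assume "0 < r"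
    then show "\<exists>z. norm z = r \<and> summable (\<lambda>n. fps_nth (moment_fps t) n * z ^ n)"
      using sums[of "of_real r"] by (intro exI[of _ "of_real r"]) (auto simp: sums_iff)
  qed
  moreover have "eval_fps (moment_fps t) z = (\<Sum>\<^sub>\<infinity>y\<in>L. of_real (gauss t y) * exp (z * of_real (x \<bullet> y)))" for z
    using sums[of z] by (simp add: eval_fps_def sums_iff)
  ultimately show ?thesis by (simp add: has_fps_expansion_def)
qed

text \<open>At z = i r the left side is a Gaussian sum with character r x / (2 pi). Poisson
  summation turns the character into a shift, and completing the square turns the shift back into an
  exponential, now at - i z / t and with a Gaussian factor in z.\<close>

lemma moment_fps_transformation:
  assumes t: "t > 0"
  shows "moment_fps t = fps_const (of_real (1 / sqrt t ^ n)) * gauss_fps (of_real ((x \<bullet> x) / (4 * pi * t))) * 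
    (moment_fps (1 / t) oo (fps_const (- \<i> / of_real t) * fps_X))"
proof (rule fps_expansion_eqI_imaginary[OF moment_fps_has_fps_expansion[OF t]])
  define f where "f t z = (\<Sum>\<^sub>\<infinity>y\<in>L. of_real (gauss t y) * exp (z * of_real (x \<bullet> y)))" for t and z :: complex
  have f: "f t has_fps_expansion moment_fps t" if "t > 0" for t 
    unfolding f_def using moment_fps_has_fps_expansion[OF that] .
  show "(\<lambda>z. of_real (1 / sqrt t ^ n) * exp (of_real ((x \<bullet> x) / (4 * pi * t)) * z\<^sup>2) * (f (1 / t) \<circ> (\<lambda>z. - \<i> / of_real t * z)) z)
    has_fps_expansion fps_const (of_real (1 / sqrt t ^ n)) * gauss_fps (of_real ((x \<bullet> x) / (4 * pi * t))) * 
    (moment_fps (1 / t) oo (fps_const (- \<i> / of_real t) * fps_X))"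
    using t by (intro has_fps_expansion_mult has_fps_expansion_const has_fps_expansion_gauss_fps has_fps_expansion_compose f
       has_fps_expansion_fps_X) auto
  fix r :: real
  define s where "s = r / (2 * pi)"
  have r: "r = 2 * pi * s" by (simp add: s_def)
  have "f t (\<i> * of_real r) = (\<Sum>\<^sub>\<infinity>y\<in>L. of_real (gauss t y) * cis (2 * pi * ((s *\<^sub>R x) \<bullet> y)))"
    by (simp add: f_def cis_conv_exp r mult_ac)
  also have "\<dots> = of_real (1 / sqrt t ^ n) * (\<Sum>\<^sub>\<infinity>w\<in>L. of_real (gauss (1 / t) (w - s *\<^sub>R x)))"
    by (rule unimodular_Poisson[OF rank uni t x_span])
  also have "(\<Sum>\<^sub>\<infinity>w\<in>L. complex_of_real (gauss (1 / t) (w - s *\<^sub>R x))) = 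
     (\<Sum>\<^sub>\<infinity>w\<in>L. of_real (exp (- pi * s\<^sup>2 * (x \<bullet> x) / t)) * (of_real (gauss (1 / t) w) * exp (of_real (2 * pi * s / t) * of_real (x \<bullet> w))))"
  proof (rule infsum_cong)
    fix w
    have "gauss (1 / t) w * exp ((2 * pi * s / t) * (x \<bullet> w)) 
       = exp (pi * s\<^sup>2 * (x \<bullet> x) / t) * gauss (1 / t) (w - s *\<^sub>R x)"
      using gauss_shift[of "1 / t" w "2 * pi * s / t"] t by (simp add: power2_eq_square field_simps)
    then have "gauss (1 / t) (w - s *\<^sub>R x) = exp (- pi * s\<^sup>2 * (x \<bullet> x) / t) * (gauss (1 / t) w * exp ((2 * pi * s / t) * (x \<bullet> w)))"
      by (simp add: exp_minus field_simps)
    then show "complex_of_real (gauss (1 / t) (w - s *\<^sub>R x)) = of_real (exp (- pi * s\<^sup>2 * (x \<bullet> x) / t)) * 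
        (of_real (gauss (1 / t) w) * exp (of_real (2 * pi * s / t) * of_real (x \<bullet> w)))"
      by (simp only: of_real_mult exp_of_real[symmetric])
  qed
  also have "\<dots> = of_real (exp (- pi * s\<^sup>2 * (x \<bullet> x) / t)) * f (1 / t) (of_real (2 * pi * s / t))"
    unfolding f_def by (rule infsum_cmult_right')
  also have "of_real (2 * pi * s / t) = - \<i> / of_real t * (\<i> * of_real r)" using t by (simp add: r field_simps)
  also have "complex_of_real (exp (- pi * s\<^sup>2 * (x \<bullet> x) / t)) = exp (of_real ((x \<bullet> x) / (4 * pi * t)) * (\<i> * of_real r)\<^sup>2)"
  proof -
    have "- pi * s\<^sup>2 * (x \<bullet> x) / t = (x \<bullet> x) / (4 * pi * t) * (- (r\<^sup>2))"
      using t by (simp add: r power2_eq_square field_simps)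
    moreover have "(\<i> * complex_of_real r)\<^sup>2 = of_real (- (r\<^sup>2))" by (simp add: power_mult_distrib)
    ultimately show ?thesis by (simp only: of_real_mult exp_of_real[symmetric])
  qed
  finally show "(\<Sum>\<^sub>\<infinity>y\<in>L. of_real (gauss t y) * exp ((\<i> * of_real r) * of_real (x \<bullet> y))) = 
    of_real (1 / sqrt t ^ n) * exp (of_real ((x \<bullet> x) / (4 * pi * t)) * (\<i> * of_real r)\<^sup>2) * (f (1 / t) \<circ> (\<lambda>z. - \<i> / of_real t * z)) (\<i> * of_real r)"
    by (simp add: f_def mult_ac)
qed

lemma norm_even: 
  assumes "y \<in> L" 
  obtains N :: nat where "y \<bullet> y = 2 * real N"
proof -
  obtain k :: int where "y \<bullet> y = 2 * of_int k" using even assms by (auto simp: even_lattice_def)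
  moreover have "k \<ge> 0" using inner_ge_zero[of y] calculation by simp
  ultimately show ?thesis using that[of "nat k"] by simp
qed

lemma finite_shell: "finite (shell L a)"
proof (rule summable_on_bounded_below_imp_finite)
  show "gauss 1 summable_on shell L a"
    by (rule summable_on_subset_banach[OF gauss_summable]) (auto simp: shell_def)
  show "exp (- pi * a) \<le> gauss 1 y" if "y \<in> shell L a" for y
    using that by (simp add: shell_def gauss_def)
qed simp

lemma theta_fps_sums:
  assumes t: "t > 0"
  shows "(\<lambda>N. theta_fps L x m $ N * of_real (exp (- 2 * pi * t)) ^ N) sums gauss_moment L x m t"
proof -
  define f where "f y = complex_of_real ((x \<bullet> y) ^ m * gauss t y)" for y
  have "(f has_sum gauss_moment L x m t) L"
    unfolding gauss_moment_def f_def by (intro has_sum_infsum summable_on_of_real moment_abs_summable t)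
  moreover have "bij_betw snd (Sigma UNIV (\<lambda>N. shell L (2 * real N))) L"
  proof (rule bij_betw_imageI)
    show "inj_on snd (Sigma UNIV (\<lambda>N. shell L (2 * real N)))" by (auto simp: inj_on_def shell_def)
    show "snd ` Sigma UNIV (\<lambda>N. shell L (2 * real N)) = L"
    proof (intro equalityI subsetI)
      fix y assume "y \<in> L"
      then obtain N where "y \<bullet> y = 2 * real N" using norm_even by blast
      then have "(N, y) \<in> Sigma UNIV (\<lambda>N. shell L (2 * real N))" using \<open>y \<in> L\<close> by (simp add: shell_def)
      then show "y \<in> snd ` Sigma UNIV (\<lambda>N. shell L (2 * real N))" by (metis image_eqI snd_conv)
    qed (auto simp: shell_def)
  qed
  ultimately have "((\<lambda>z. f (snd z)) has_sum gauss_moment L x m t) (Sigma UNIV (\<lambda>N. shell L (2 * real N)))"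
    by (subst has_sum_reindex_bij_betw)
  moreover have "((\<lambda>y. f (snd (N, y))) has_sum (\<Sum>y\<in>shell L (2 * real N). f y)) (shell L (2 * real N))" for N
    using finite_shell by (simp add: has_sum_finite)
  ultimately have "((\<lambda>N. \<Sum>y\<in>shell L (2 * real N). f y) has_sum gauss_moment L x m t) UNIV"
    by (rule has_sum_SigmaD)
  moreover have "(\<Sum>y\<in>shell L (2 * real N). f y) = theta_fps L x m $ N * of_real (exp (- 2 * pi * t)) ^ N" for N
  proof -
    have "f y = of_real ((x \<bullet> y) ^ m) * of_real (exp (- 2 * pi * t)) ^ N" if "y \<in> shell L (2 * real N)" for y
    proof -
      have "gauss t y = exp (- 2 * pi * t) ^ N"
        using that by (simp add: shell_def gauss_def mult_ac flip: exp_of_nat_mult)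
      then show ?thesis by (simp add: f_def)
    qed
    then show ?thesis by (simp add: theta_fps_def shell_moment_def sum_distrib_right)
  qed
  ultimately show ?thesis using has_sum_imp_sums by fastforce
qed

lemma theta_fps_conv_radius: "fps_conv_radius (theta_fps L x m) \<ge> 1"
  unfolding fps_conv_radius_def
proof (rule conv_radius_geI_ex)
  fix r :: real assume r: "0 < r" "ereal r < 1"
  define t where "t = - ln r / (2 * pi)"
  have "ln r < 0" using r by simp
  then have t: "t > 0" "exp (- 2 * pi * t) = r" using r by (auto simp: t_def intro: divide_neg_pos)
  show "\<exists>z. norm z = r \<and> summable (\<lambda>n. fps_nth (theta_fps L x m) n * z ^ n)"
    using theta_fps_sums[OF t(1), of m] r unfolding t(2) by (intro exI[of _ "of_real r"]) (auto simp: sums_iff)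
qed

lemma qeval_theta_fps: "t > 0 \<Longrightarrow> qeval (theta_fps L x m) (\<i> * of_real t) = gauss_moment L x m t"
  using theta_fps_sums[of t m] by (simp add: qeval_def eval_fps_def nome_imaginary sums_iff)


definition "jacobi_fps t = gauss_fps (of_real (- (x \<bullet> x) / 24) * qeval E2 (\<i> * of_real t)) * moment_fps t"

text \<open>On the axis the anomaly of \<open>E2\<close> is 6t / pi. Scaled by - T / 24 and by the
  square of - i / t it becomes T / (4 pi t), precisely the exponent of the Gaussian factor of
  \<open>moment_fps\<close>; this is the origin of the 24.\<close>

lemma jacobi_fps_transformation:
  assumes t: "t > 0"
  shows "jacobi_fps t = fps_const (of_real (1 / sqrt t ^ n)) * (jacobi_fps (1 / t) oo (fps_const (- \<i> / of_real t) * fps_X))"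
proof -
  define k where "k = - \<i> / complex_of_real t"
  define e where "e = qeval E2 (\<i> * of_real t)"
  define T where "T = x \<bullet> x"
  have "- 1 / (\<i> * complex_of_real t) = \<i> * of_real (1 / t)" using t by (simp add: field_simps)
  then have "qeval E2 (\<i> * of_real (1 / t)) = (\<i> * of_real t)\<^sup>2 * e + 12 / (2 * pi * \<i>) * (\<i> * of_real t)"
    using E2_transformation[OF imaginary_upper[OF t]] by (simp only: e_def)
  also have "\<dots> = - (of_real t)\<^sup>2 * e + 6 * of_real t / of_real pi" by (simp add: power_mult_distrib)
  finally have Q: "qeval E2 (\<i> * of_real (1 / t)) = - (of_real t)\<^sup>2 * e + 6 * of_real t / of_real pi" .
  have E: "k\<^sup>2 * (of_real (- T / 24) * qeval E2 (\<i> * of_real (1 / t))) = of_real (- T / 24) * e + of_real (T / (4 * pi * t))"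
    unfolding Q using t by (simp add: k_def power2_eq_square field_simps)
  have "jacobi_fps t = fps_const (of_real (1 / sqrt t ^ n)) * (gauss_fps (of_real (- T / 24) * e) * gauss_fps (of_real (T / (4 * pi * t)))) * 
     (moment_fps (1 / t) oo (fps_const k * fps_X))"
    unfolding jacobi_fps_def by (subst moment_fps_transformation[OF t]) (simp only: T_def e_def k_def mult_ac)
  also have "gauss_fps (of_real (- T / 24) * e) * gauss_fps (of_real (T / (4 * pi * t))) = 
      gauss_fps (of_real (- T / 24) * qeval E2 (\<i> * of_real (1 / t))) oo (fps_const k * fps_X)"
    by (simp only: gauss_fps_mult gauss_fps_scale E)
  finally show ?thesis
    unfolding jacobi_fps_def T_def[symmetric] k_def[symmetric] by (simp add: fps_compose_mult_distrib mult_ac)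
qed

end

text \<open>
  The Taylor coefficients at \<open>s = 0\<close> of the Jacobi theta function
  \<open>\<Sum>y\<in>L. q ^ (y \<bullet> y / 2) * exp (s * (x \<bullet> y))\<close> become modular once the function is multiplied by
  \<open>exp (- (x \<bullet> x) / 24 * E2 * s\<^sup>2)\<close>, which cancels the Gaussian factor in its transformation law.
\<close>

definition corrected_theta :: "'a::real_inner set \<Rightarrow> 'a \<Rightarrow> nat \<Rightarrow> complex fps" where
  "corrected_theta L x d = (\<Sum>i\<le>d div 2. fps_const (of_real ((- (x \<bullet> x) / 24) ^ i / (fact i * fact (d - 2 * i)))) *
     (E2 ^ i * theta_fps L x (d - 2 * i)))"

lemma conv_radius_ge_1_sum:
  assumes "\<And>i. i \<in> A \<Longrightarrow> fps_conv_radius (f i :: complex fps) \<ge> 1"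
  shows "fps_conv_radius (sum f A) \<ge> 1"
  using assms by (induction A rule: infinite_finite_induct) (auto intro: conv_radius_ge_1_intros)

lemma qeval_sum:
  assumes "\<tau> \<in> upper" "\<And>i. i \<in> A \<Longrightarrow> fps_conv_radius (f i :: complex fps) \<ge> 1"
  shows "qeval (sum f A) \<tau> = (\<Sum>i\<in>A. qeval (f i) \<tau>)"
  using assms(2)
  by (induction A rule: infinite_finite_induct)
     (auto simp: qeval_simps assms(1) conv_radius_ge_1_sum, simp_all add: qeval_def)

theorem modular_corrected_theta:
  fixes L :: "'a::real_inner set"
  assumes rank: "lattice_of_rank (8 * l) L" and even: "even_lattice L" and uni: "unimodular L" and x: "x \<in> L"
    and d: "even d"
  shows "modular (4 * l + d) (corrected_theta L x d)"
proof (rule modularI_imaginary_axis)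
  note ctx = rank even uni x
  define T where "T = x \<bullet> x"
  have r: "fps_conv_radius (fps_const c * (E2 ^ i * theta_fps L x m)) \<ge> 1" for c i m
    by (intro conv_radius_ge_1_intros Eisenstein_conv_radius theta_fps_conv_radius[OF ctx])
  show "fps_conv_radius (corrected_theta L x d) \<ge> 1"
    unfolding corrected_theta_def by (intro conv_radius_ge_1_sum r)
  define J where "J t = jacobi_fps L x t" for t
  have J: "qeval (corrected_theta L x d) (\<i> * of_real t) = J t $ d" if t: "t > 0" for t
  proof -
    define c where "c = of_real (- T / 24) * qeval E2 (\<i> * of_real t)"
    have "qeval (corrected_theta L x d) (\<i> * of_real t) = 
        (\<Sum>i\<le>d div 2. of_real ((- T / 24) ^ i / (fact i * fact (d - 2 * i))) * (qeval E2 (\<i> * of_real t) ^ i * gauss_moment L x (d - 2 * i) t))"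
      using imaginary_upper[OF t] unfolding corrected_theta_def
      by (subst qeval_sum) (auto simp: qeval_simps conv_radius_ge_1_intros Eisenstein_conv_radius
          theta_fps_conv_radius[OF ctx] qeval_theta_fps[OF ctx t] T_def)
    also have "\<dots> = (\<Sum>i\<le>d div 2. c ^ i / fact i * (gauss_moment L x (d - 2 * i) t / fact (d - 2 * i)))"
    proof (rule sum.cong[OF refl])
      fix i
      have "c ^ i = of_real ((- T / 24) ^ i) * qeval E2 (\<i> * of_real t) ^ i"
        unfolding c_def power_mult_distrib by simp
      then show "of_real ((- T / 24) ^ i / (fact i * fact (d - 2 * i))) * (qeval E2 (\<i> * of_real t) ^ i * gauss_moment L x (d - 2 * i) t) =
          c ^ i / fact i * (gauss_moment L x (d - 2 * i) t / fact (d - 2 * i))"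
        by simp
    qed
    \<comment> \<open>The correcting Gaussian has only even coefficients, so the sum over i is the
      full convolution with its zero terms left out.\<close>
    also have "\<dots> = (\<Sum>k\<in>(\<lambda>i. 2 * i) ` {..d div 2}. gauss_fps c $ k * moment_fps L x t $ (d - k))"
      by (subst sum.reindex) (auto simp: inj_on_def gauss_fps_def moment_fps_def[OF ctx])
    also have "\<dots> = (\<Sum>k=0..d. gauss_fps c $ k * moment_fps L x t $ (d - k))"
    proof (rule sum.mono_neutral_left)
      show "\<forall>k\<in>{0..d} - (\<lambda>i. 2 * i) ` {..d div 2}. gauss_fps c $ k * moment_fps L x t $ (d - k) = 0"
      proof
        fix k assume k: "k \<in> {0..d} - (\<lambda>i. 2 * i) ` {..d div 2}"
        have "odd k"
        proof
          assume "even k"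
          then have "k = 2 * (k div 2)" "k div 2 \<le> d div 2" using k by (auto intro: div_le_mono)
          then show False using k by blast
        qed
        then show "gauss_fps c $ k * moment_fps L x t $ (d - k) = 0" by (simp add: gauss_fps_def)
      qed
    qed auto
    also have "\<dots> = J t $ d"
      by (simp add: J_def jacobi_fps_def[OF ctx] fps_mult_nth c_def T_def)
    finally show ?thesis .
  qed
  fix s :: real assume s: "s > 0"
  define C where "C = complex_of_real (1 / sqrt s ^ (8 * l))"
  \<comment> \<open>Half the rank is 4l, and the fourth power of i is 1, so the real factor from
    Poisson summation is a power of tau = i s.\<close>
  have C: "C = 1 / (\<i> * of_real s) ^ (4 * l)"
  proof -
    have "sqrt s ^ (8 * l) = (sqrt s ^ 2) ^ (4 * l)" by (simp flip: power_mult)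
    also have "\<dots> = s ^ (4 * l)" using s by simp
    finally have "sqrt s ^ (8 * l) = s ^ (4 * l)" .
    moreover have "(\<i> * complex_of_real s) ^ (4 * l) = of_real (s ^ (4 * l))" by (simp add: power_mult_distrib power_mult)
    ultimately show ?thesis by (simp add: C_def)
  qed
  have "J s $ d = C * ((- \<i> / of_real s) ^ d * J (1 / s) $ d)"
    unfolding J_def by (subst jacobi_fps_transformation[OF ctx s]) (simp add: C_def)
  also have "- \<i> / complex_of_real s = 1 / (\<i> * of_real s)" using s by (simp add: field_simps)
  finally have "(\<i> * of_real s) ^ (4 * l + d) * J s $ d = J (1 / s) $ d"
    unfolding C using s by (simp add: power_add power_one_over field_simps)
  moreover have "\<i> / of_real s = \<i> * of_real (1 / s)" by simp
  ultimately show "qeval (corrected_theta L x d) (\<i> / of_real s) = (\<i> * of_real s) ^ (4 * l + d) * qeval (corrected_theta L x d) (\<i> * of_real s)"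
    using J[OF s] J[of "1 / s"] s by simp
qed

section \<open>Moment relations for extremal lattices\<close>

definition fps_agrees :: "complex fps \<Rightarrow> int list \<Rightarrow> bool" where
  "fps_agrees F cs \<longleftrightarrow> (\<forall>k<length cs. fps_nth F k = of_int (cs ! k))"

definition trunc_mult :: "int list \<Rightarrow> int list \<Rightarrow> int list" where
  "trunc_mult xs ys = map (\<lambda>k. \<Sum>i\<leftarrow>[0..<Suc k]. xs ! i * ys ! (k - i)) [0..<min (length xs) (length ys)]"

fun trunc_power :: "int list \<Rightarrow> nat \<Rightarrow> int list" where
  "trunc_power xs 0 = map (\<lambda>k. if k = 0 then 1 else 0) [0..<length xs]"
| "trunc_power xs (Suc n) = trunc_mult xs (trunc_power xs n)"

lemma fps_agreesD: "fps_agrees F cs \<Longrightarrow> k < length cs \<Longrightarrow> fps_nth F k = of_int (cs ! k)"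
  by (simp add: fps_agrees_def)

lemma fps_agrees_mult:
  assumes "fps_agrees F xs" "fps_agrees G ys"
  shows "fps_agrees (F * G) (trunc_mult xs ys)"
  unfolding fps_agrees_def
proof (intro allI impI)
  fix k assume "k < length (trunc_mult xs ys)"
  then have k: "k < length xs" "k < length ys" by (auto simp: trunc_mult_def)
  have "trunc_mult xs ys ! k = (\<Sum>i=0..k. xs ! i * ys ! (k - i))"
    using k by (simp add: trunc_mult_def interv_sum_list_conv_sum_set_nat atLeastLessThanSuc_atLeastAtMost del: upt_Suc)
  moreover have "fps_nth (F * G) k = (\<Sum>i=0..k. of_int (xs ! i * ys ! (k - i)))"
    unfolding fps_mult_nth using assms k by (intro sum.cong) (auto simp: fps_agrees_def)
  ultimately show "fps_nth (F * G) k = of_int (trunc_mult xs ys ! k)" by simp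
qed

lemma fps_agrees_power: "fps_agrees F xs \<Longrightarrow> fps_agrees (F ^ n) (trunc_power xs n)"
proof (induction n)
  case 0
  show ?case by (simp add: fps_agrees_def)
next
  case (Suc n)
  then show ?case by (simp add: fps_agrees_mult)
qed

text \<open>A proposed list \<open>ys\<close> is checked by one multiplication: if F times its
  series agrees with 1 to the given order, multiplying by G recovers G to that order.\<close>

lemma fps_agrees_inverse:
  assumes F: "fps_agrees F xs" and FG: "F * G = 1" and len: "length ys = length xs"
    and prod: "trunc_mult xs ys = trunc_power xs 0"
  shows "fps_agrees G ys"
  unfolding fps_agrees_def
proof (intro allI impI)
  fix k assume k: "k < length ys"
  define Y :: "complex fps" where "Y = Abs_fps (\<lambda>k. of_int (ys ! k))"
  have "fps_agrees Y ys" by (simp add: fps_agrees_def Y_def)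
  from fps_agrees_mult[OF F this] have FY: "fps_nth (F * Y) i = (if i = 0 then 1 else 0)" if "i < length ys" for i
    using that len unfolding prod by (simp add: fps_agrees_def)
  have "Y = (F * G) * Y" by (simp add: FG)
  also have "\<dots> = G * (F * Y)" by (simp add: mult_ac)
  finally have "fps_nth Y k = (\<Sum>i=0..k. fps_nth G i * fps_nth (F * Y) (k - i))" by (metis fps_mult_nth)
  also have "\<dots> = (\<Sum>i=0..k. if i = k then fps_nth G i else 0)"
    using k by (intro sum.cong) (auto simp: FY)
  finally show "fps_nth G k = of_int (ys ! k)" by (simp add: Y_def)
qed

lemma fps_agrees_qderiv:
  assumes "fps_agrees F xs"
  shows "fps_agrees (qderiv F) (map (\<lambda>k. int k * xs ! k) [0..<length xs])"
  unfolding fps_agrees_def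
proof (intro allI impI)
  fix k assume "k < length (map (\<lambda>k. int k * xs ! k) [0..<length xs])"
  then show "fps_nth (qderiv F) k = of_int (map (\<lambda>k. int k * xs ! k) [0..<length xs] ! k)"
    using assms by (cases k) (auto simp: qderiv_def fps_agrees_def)
qed

text \<open>Eight coefficients reach the largest index in use, 2r + 1 = 7 for r = 3. The lists below
  are partition numbers and the classical expansions 1 - 24 sigma_1, 1 + 240 sigma_3 and 1 - 504
  sigma_5.\<close>

definition euler_cs :: "int list" where "euler_cs = [1, -1, -1, 0, 0, 1, 0, 1]"
definition inv_euler_cs :: "int list" where "inv_euler_cs = [1, 1, 2, 3, 5, 7, 11, 15]"
definition E2_cs :: "int list" where "E2_cs = [1, -24, -72, -96, -168, -144, -288, -192]"
definition E4_cs :: "int list" where "E4_cs = [1, 240, 2160, 6720, 17520, 30240, 60480, 82560]"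
definition E6_cs :: "int list" where "E6_cs = [1, -504, -16632, -122976, -532728, -1575504, -4058208, -8471232]"

lemma euler_fps_agrees: "fps_agrees euler_fps euler_cs"
proof -
  have "fps_nth euler_fps n = of_int (\<Sum>k\<leftarrow>filter (\<lambda>k. pentagonal k = n) [- int n..int n]. (-1) ^ nat \<bar>k\<bar>)" for n
  proof -
    have "distinct (filter (\<lambda>k. pentagonal k = n) [- int n..int n])" by simp
    then have "(\<Sum>k\<leftarrow>filter (\<lambda>k. pentagonal k = n) [- int n..int n]. (-1 :: int) ^ nat \<bar>k\<bar>) 
       = (\<Sum>k\<in>set (filter (\<lambda>k. pentagonal k = n) [- int n..int n]). (-1) ^ nat \<bar>k\<bar>)"
      by (rule sum_list_distinct_conv_sum_set)
    then show ?thesis by (simp add: euler_fps_def)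
  qed
  moreover have "\<forall>n\<in>set [0..<8]. (\<Sum>k\<leftarrow>filter (\<lambda>k. pentagonal k = n) [- int n..int n]. (-1) ^ nat \<bar>k\<bar>) = euler_cs ! n"
    unfolding pentagonal_def euler_cs_def by code_simp
  ultimately show ?thesis by (auto simp: fps_agrees_def euler_cs_def)
qed

lemma inv_euler_agrees: "fps_agrees inv_euler inv_euler_cs"
  by (rule fps_agrees_inverse[OF euler_fps_agrees euler_inv_euler(1)])
     (simp add: euler_cs_def inv_euler_cs_def, unfold euler_cs_def inv_euler_cs_def, code_simp)

lemma E2_agrees: "fps_agrees E2 E2_cs"
proof -
  note A = fps_agrees_mult[OF fps_agrees_qderiv[OF euler_fps_agrees] inv_euler_agrees]
  \<comment> \<open>The negatives of the divisor sums sigma_1, as the logarithmic derivative of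
    Euler's product predicts.\<close>
  have "trunc_mult (map (\<lambda>k. int k * euler_cs ! k) [0..<length euler_cs]) inv_euler_cs = [0, -1, -3, -4, -7, -6, -12, -8]"
    unfolding euler_cs_def inv_euler_cs_def by code_simp
  note A = A[unfolded this fps_agrees_def]
  show ?thesis unfolding fps_agrees_def E2_def
    using A by (auto simp: E2_cs_def less_Suc_eq numeral_eq_Suc nth_Cons')
qed

lemma E4_agrees: "fps_agrees E4 E4_cs"
proof -
  note A = fps_agrees_mult[OF E2_agrees E2_agrees] and B = fps_agrees_qderiv[OF E2_agrees]
  have C: "\<forall>k\<in>set [0..<8]. trunc_mult E2_cs E2_cs ! k - 12 * map (\<lambda>k. int k * E2_cs ! k) [0..<length E2_cs] ! k = E4_cs ! k"
    and len: "length (trunc_mult E2_cs E2_cs) = 8" "length (map (\<lambda>k. int k * E2_cs ! k) [0..<length E2_cs]) = 8"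
    unfolding E2_cs_def E4_cs_def by code_simp+
  have "fps_nth E4 k = of_int (E4_cs ! k)" if k: "k < 8" for k
  proof -
    have "fps_nth E4 k = of_int (trunc_mult E2_cs E2_cs ! k - 12 * map (\<lambda>k. int k * E2_cs ! k) [0..<length E2_cs] ! k)"
      using fps_agreesD[OF A, of k] fps_agreesD[OF B, of k] k unfolding len by (simp add: E4_def)
    moreover have "k \<in> set [0..<8]" using k by simp
    ultimately show ?thesis using C by metis
  qed
  then show ?thesis by (simp add: fps_agrees_def E4_cs_def)
qed

lemma E6_agrees: "fps_agrees E6 E6_cs"
proof -
  note A = fps_agrees_mult[OF E2_agrees E4_agrees] and B = fps_agrees_qderiv[OF E4_agrees]
  have C: "\<forall>k\<in>set [0..<8]. trunc_mult E2_cs E4_cs ! k - 3 * map (\<lambda>k. int k * E4_cs ! k) [0..<length E4_cs] ! k = E6_cs ! k"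
    and len: "length (trunc_mult E2_cs E4_cs) = 8" "length (map (\<lambda>k. int k * E4_cs ! k) [0..<length E4_cs]) = 8"
    unfolding E2_cs_def E4_cs_def E6_cs_def by code_simp+
  have "fps_nth E6 k = of_int (E6_cs ! k)" if k: "k < 8" for k
  proof -
    have "fps_nth E6 k = of_int (trunc_mult E2_cs E4_cs ! k - 3 * map (\<lambda>k. int k * E4_cs ! k) [0..<length E4_cs] ! k)"
      using fps_agreesD[OF A, of k] fps_agreesD[OF B, of k] k unfolding len by (simp add: E6_def)
    moreover have "k \<in> set [0..<8]" using k by simp
    ultimately show ?thesis using C by metis
  qed
  then show ?thesis by (simp add: fps_agrees_def E6_cs_def)
qed

text \<open>The cofactor of a theta series in the \<open>i\<close>-th term of the corrected series.
  Division by \<open>Delta ^ j\<close> is split into this inverse Euler power and a factor q^(-j),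
  so constant terms are read at index \<open>j\<close>.\<close>

definition kernel_fps :: "nat \<Rightarrow> nat \<Rightarrow> nat \<Rightarrow> nat \<Rightarrow> complex fps" where
  "kernel_fps a b i j = E4 ^ a * E6 ^ b * E2 ^ i * inv_euler ^ (24 * j)"

definition inv_euler24_cs :: "int list" where
  "inv_euler24_cs = [1, 24, 324, 3200, 25650, 176256, 1073720, 5930496]"

lemma inv_euler24_eq: "inv_euler24_cs = trunc_power (trunc_power inv_euler_cs 4) 6"
  by code_simp

definition kernel_cs :: "nat \<Rightarrow> nat \<Rightarrow> nat \<Rightarrow> nat \<Rightarrow> int list" where
  "kernel_cs a b i j = trunc_mult (trunc_mult (trunc_mult (trunc_power E4_cs a) (trunc_power E6_cs b)) (trunc_power E2_cs i))
     (trunc_power inv_euler24_cs j)"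

lemma kernel_agrees: "fps_agrees (kernel_fps a b i j) (kernel_cs a b i j)"
proof -
  have "fps_agrees (inv_euler ^ (24 * j)) (trunc_power inv_euler24_cs j)"
    unfolding inv_euler24_eq using fps_agrees_power[OF fps_agrees_power[OF fps_agrees_power[OF inv_euler_agrees, of 4], of 6], of j]
    by (simp flip: power_mult)
  then show ?thesis unfolding kernel_fps_def kernel_cs_def
    by (intro fps_agrees_mult fps_agrees_power E2_agrees E4_agrees E6_agrees)
qed

lemma length_trunc_mult: "length (trunc_mult xs ys) = min (length xs) (length ys)"
  by (simp add: trunc_mult_def)

lemma length_trunc_power: "length (trunc_power xs n) = length xs"
  by (induction n) (auto simp: length_trunc_mult)

lemma length_kernel_cs: "length (kernel_cs a b i j) = 8"
  by (simp add: kernel_cs_def length_trunc_mult length_trunc_power inv_euler24_cs_def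
      E2_cs_def E4_cs_def E6_cs_def inv_euler_cs_def)

lemma fps_power_nth_1: 
  assumes "fps_nth F 0 = (1 :: 'a :: comm_ring_1)"
  shows "fps_nth (F ^ n) 0 = 1 \<and> fps_nth (F ^ n) 1 = of_nat n * fps_nth F 1"
  by (induction n) (auto simp: assms fps_mult_nth algebra_simps)

text \<open>For j = 2r + 1 the two shells meet exactly the coefficients 1 and 0 of the kernel. All
  factors start with 1, so the linear coefficient is additive in the exponents.\<close>

lemma kernel_fps_nth_0_1:
  "fps_nth (kernel_fps a b i j) 0 = 1"
  "fps_nth (kernel_fps a b i j) 1 = of_int (240 * int a - 504 * int b - 24 * int i + 24 * int j)"
proof -
  have 0: "fps_nth E4 0 = 1" "fps_nth E6 0 = 1" "fps_nth E2 0 = 1" "fps_nth inv_euler 0 = 1"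
    using fps_agreesD[OF E4_agrees, of 0] fps_agreesD[OF E6_agrees, of 0] fps_agreesD[OF E2_agrees, of 0] fps_agreesD[OF inv_euler_agrees, of 0]
    by (simp_all add: E4_cs_def E6_cs_def E2_cs_def inv_euler_cs_def)
  have 1: "fps_nth E4 1 = 240" "fps_nth E6 1 = - 504" "fps_nth E2 1 = - 24" "fps_nth inv_euler 1 = 1"
    using fps_agreesD[OF E4_agrees, of 1] fps_agreesD[OF E6_agrees, of 1] fps_agreesD[OF E2_agrees, of 1] fps_agreesD[OF inv_euler_agrees, of 1]
    by (simp_all add: E4_cs_def E6_cs_def E2_cs_def inv_euler_cs_def)
  note P = 0[THEN fps_power_nth_1]
  show "fps_nth (kernel_fps a b i j) 0 = 1" by (simp add: kernel_fps_def P)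
  show "fps_nth (kernel_fps a b i j) 1 = of_int (240 * int a - 504 * int b - 24 * int i + 24 * int j)"
    using P by (simp add: kernel_fps_def fps_mult_nth 1[unfolded One_nat_def] algebra_simps)
qed

section \<open>Linear relations among the moments\<close>

locale extremal_vector =
  fixes r :: nat and L :: "'a::real_inner set" and x :: 'a
  assumes rank: "lattice_of_rank (40 * r) L" and even: "even_lattice L" and uni: "unimodular L"
    and min: "\<And>y. y \<in> L \<Longrightarrow> y \<noteq> 0 \<Longrightarrow> real (4 * r) \<le> y \<bullet> y"
    and x: "x \<in> L" "x \<noteq> 0" and r: "r > 0"
begin

definition "T = x \<bullet> x"

text \<open>Dividing by the power of \<open>T\<close> turns all residue relations into linear equations with rational coefficients.\<close>

definition "mom1 k = shell_moment L x (2 * k) (2 * r) / T ^ k"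
definition "mom2 k = shell_moment L x (2 * k) (2 * r + 1) / T ^ k"

lemma T_pos: "T > 0" using x by (simp add: T_def)

lemma shell_moment_0: "shell_moment L x m 0 = 0 ^ m"
proof -
  have "0 \<in> L" using rank by (auto simp: lattice_of_rank_def zmod.span_zero)
  then have "shell L (2 * real 0) = {0}" by (auto simp: shell_def)
  then show ?thesis by (simp add: shell_moment_def)
qed

lemma shell_moment_small: "0 < N \<Longrightarrow> N < 2 * r \<Longrightarrow> shell_moment L x m N = 0"
proof -
  assume N: "0 < N" "N < 2 * r"
  have "y \<notin> shell L (2 * real N)" for y
    using min[of y] N by (cases "y = 0") (auto simp: shell_def)
  then have "shell L (2 * real N) = {}" by blast
  then show ?thesis by (simp add: shell_moment_def)
qed

text \<open>The factor \<open>E4 ^ a * E6 ^ b\<close> lifts the weight 20r + 2k of the corrected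
  theta series to 12j + 2, where \<open>modular_residue\<close> applies.\<close>

lemma residue_relation:
  assumes w: "4 * a + 6 * b + 20 * r + 2 * k = 12 * j + 2"
  shows "(\<Sum>i\<le>k. complex_of_real ((- T / 24) ^ i / (fact i * fact (2 * k - 2 * i))) * 
     (\<Sum>N=0..j. fps_nth (kernel_fps a b i j) (j - N) * of_real (shell_moment L x (2 * k - 2 * i) N))) = 0"
proof -
  have "modular (4 * (5 * r) + 2 * k) (corrected_theta L x (2 * k))"
    by (rule modular_corrected_theta) (use rank even uni x in auto)
  then have "modular ((4 * a + 6 * b) + (4 * (5 * r) + 2 * k)) ((E4 ^ a * E6 ^ b) * corrected_theta L x (2 * k))"
    by (intro modular_mult modular_power modular_E4 modular_E6)
  moreover have "(4 * a + 6 * b) + (4 * (5 * r) + 2 * k) = 12 * j + 2" using w by simp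
  ultimately have "fps_nth ((E4 ^ a * E6 ^ b) * corrected_theta L x (2 * k) * inv_euler ^ (24 * j)) j = 0"
    using modular_residue by simp
  also have "(E4 ^ a * E6 ^ b) * corrected_theta L x (2 * k) * inv_euler ^ (24 * j) = 
      (\<Sum>i\<le>k. fps_const (of_real ((- T / 24) ^ i / (fact i * fact (2 * k - 2 * i)))) * 
        (theta_fps L x (2 * k - 2 * i) * kernel_fps a b i j))"
    unfolding corrected_theta_def kernel_fps_def T_def sum_distrib_left sum_distrib_right
    by (rule sum.cong) (auto simp: mult_ac)
  finally have "(\<Sum>i\<le>k. complex_of_real ((- T / 24) ^ i / (fact i * fact (2 * k - 2 * i))) * 
      fps_nth (theta_fps L x (2 * k - 2 * i) * kernel_fps a b i j) j) = 0"
    by (simp only: fps_sum_nth fps_mult_left_const_nth)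
  moreover have "fps_nth (theta_fps L x m * kernel_fps a b i j) j = 
      (\<Sum>N=0..j. fps_nth (kernel_fps a b i j) (j - N) * of_real (shell_moment L x m N))" for i m
  proof -
    have "fps_nth (theta_fps L x m * kernel_fps a b i j) j = (\<Sum>N=0..j. of_real (shell_moment L x m N) * fps_nth (kernel_fps a b i j) (j - N))"
      by (simp add: fps_mult_nth theta_fps_def)
    then show ?thesis by (simp add: mult.commute)
  qed
  ultimately show ?thesis by (simp only:)
qed

lemma sum_shells:
  fixes f :: "nat \<Rightarrow> complex"
  assumes "j = 2 * r \<or> j = 2 * r + 1"
  shows "(\<Sum>N=0..j. f N * of_real (shell_moment L x m N)) = 
    f 0 * 0 ^ m + f (2 * r) * of_real (shell_moment L x m (2 * r)) + 
    (if j = 2 * r + 1 then f (2 * r + 1) * of_real (shell_moment L x m (2 * r + 1)) else 0)"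
proof -
  have "(\<Sum>N=0..2 * r. f N * of_real (shell_moment L x m N)) = (\<Sum>N\<in>{0, 2 * r}. f N * of_real (shell_moment L x m N))"
    using shell_moment_small by (intro sum.mono_neutral_right) auto
  also have "\<dots> = f 0 * 0 ^ m + f (2 * r) * of_real (shell_moment L x m (2 * r))"
    using r by (simp add: shell_moment_0)
  finally show ?thesis using assms by auto
qed

text \<open>Every term is homogeneous of degree k in T. The zero vector contributes through
  \<open>0 ^ (2 * k - 2 * i)\<close>, which is 1 at i = k and 0 otherwise, so a single kernel
  coefficient \<open>c k\<close> enters.\<close>

lemma pure_scaling:
  "(\<Sum>i\<le>k. (- T / 24) ^ i / (fact i * fact (2 * k - 2 * i)) * (0 ^ (2 * k - 2 * i) * of_int (c i) + f i * (T ^ (k - i) * s i))) = 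
    T ^ k * ((\<Sum>i\<le>k. (- 1 / 24) ^ i / (fact i * fact (2 * k - 2 * i)) * (f i * s i)) + (- 1 / 24) ^ k / fact k * of_int (c k))"
proof -
  have "(- T / 24) ^ i / (fact i * fact (2 * k - 2 * i)) * (0 ^ (2 * k - 2 * i) * of_int (c i) + f i * (T ^ (k - i) * s i)) = 
     T ^ k * ((- 1 / 24) ^ i / (fact i * fact (2 * k - 2 * i)) * (f i * s i) + (if i = k then (- 1 / 24) ^ k / fact k * of_int (c k) else 0))"
    if "i \<le> k" for i
  proof -
    have T: "(- T / 24) ^ i = T ^ i * (- 1 / 24) ^ i" by (metis divide_inverse inverse_eq_divide minus_divide_left mult.commute mult_minus1_right power_mult_distrib times_divide_eq_right)
    have "T ^ i * T ^ (k - i) = T ^ k" using that by (simp flip: power_add)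
    show ?thesis
    proof (cases "i = k")
      case True
      then show ?thesis unfolding T by (simp add: algebra_simps add_divide_distrib)
    next
      case False
      then have "(0 :: real) ^ (2 * k - 2 * i) = 0" using that by simp
      then have "(- T / 24) ^ i / (fact i * fact (2 * k - 2 * i)) * (0 ^ (2 * k - 2 * i) * of_int (c i) + f i * (T ^ (k - i) * s i)) = 
        (T ^ i * T ^ (k - i)) * ((- 1 / 24) ^ i / (fact i * fact (2 * k - 2 * i)) * (f i * s i))"
        unfolding T by simp
      then show ?thesis using False \<open>T ^ i * T ^ (k - i) = T ^ k\<close> by simp
    qed
  qed
  then have "(\<Sum>i\<le>k. (- T / 24) ^ i / (fact i * fact (2 * k - 2 * i)) * (0 ^ (2 * k - 2 * i) * of_int (c i) + f i * (T ^ (k - i) * s i))) = 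
    (\<Sum>i\<le>k. T ^ k * ((- 1 / 24) ^ i / (fact i * fact (2 * k - 2 * i)) * (f i * s i) + (if i = k then (- 1 / 24) ^ k / fact k * of_int (c k) else 0)))"
    by (intro sum.cong) auto
  then show ?thesis by (simp add: sum.distrib flip: sum_distrib_left)
qed

lemma shell_moment_mom:
  "shell_moment L x (2 * k) (2 * r) = T ^ k * mom1 k" "shell_moment L x (2 * k) (2 * r + 1) = T ^ k * mom2 k"
  using T_pos by (simp_all add: mom1_def mom2_def)

text \<open>The case j = 2r + 1, where both shells enter; 4r + 14 is 12j + 2 - 20r. Here
  \<open>c\<close> is the share of the zero vector, and r <= 3 keeps its index within the tabulated
  coefficients.\<close>

lemma upper_relation:
  assumes w: "4 * a + 6 * b + 2 * k = 4 * r + 14" and c: "kernel_cs a b k (2 * r + 1) ! (2 * r + 1) = c" "r \<le> 3"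
  shows "(\<Sum>i\<le>k. (- 1 / 24) ^ i / (fact i * fact (2 * k - 2 * i)) * 
      (of_int (240 * int a - 504 * int b - 24 * int i + 24 * (2 * int r + 1)) * mom1 (k - i) + mom2 (k - i))) + (- 1 / 24) ^ k / fact k * of_int c = (0 :: real)"
proof -
  define j where "j = 2 * r + 1"
  define cc where "cc i = kernel_cs a b i j ! j" for i
  define e where "e i = (240 * int a - 504 * int b - 24 * int i + 24 * int j)" for i
  have k: "fps_nth (kernel_fps a b i j) j = of_int (cc i)" for i
    using fps_agreesD[OF kernel_agrees, of j a b i j] c(2) by (simp add: cc_def length_kernel_cs j_def)
  have "(\<Sum>i\<le>k. complex_of_real ((- T / 24) ^ i / (fact i * fact (2 * k - 2 * i))) * 
     (\<Sum>N=0..j. fps_nth (kernel_fps a b i j) (j - N) * of_real (shell_moment L x (2 * k - 2 * i) N))) = 0"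
    by (rule residue_relation) (use w in \<open>simp add: j_def\<close>)
  moreover have "(\<Sum>N=0..j. fps_nth (kernel_fps a b i j) (j - N) * complex_of_real (shell_moment L x (2 * k - 2 * i) N))
      = of_real (0 ^ (2 * k - 2 * i) * of_int (cc i) + 1 * (T ^ (k - i) * (of_int (e i) * mom1 (k - i) + mom2 (k - i))))" if "i \<le> k" for i
  proof -
    have m: "2 * k - 2 * i = 2 * (k - i)" by simp
    have "(\<Sum>N=0..j. fps_nth (kernel_fps a b i j) (j - N) * complex_of_real (shell_moment L x (2 * k - 2 * i) N)) =
       fps_nth (kernel_fps a b i j) j * 0 ^ (2 * k - 2 * i) + fps_nth (kernel_fps a b i j) (j - 2 * r) * of_real (shell_moment L x (2 * k - 2 * i) (2 * r))
       + fps_nth (kernel_fps a b i j) (j - (2 * r + 1)) * of_real (shell_moment L x (2 * k - 2 * i) (2 * r + 1))"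
      using sum_shells[of j "\<lambda>N. fps_nth (kernel_fps a b i j) (j - N)" "2 * k - 2 * i"] by (simp add: j_def)
    also have "j - 2 * r = 1" by (simp add: j_def)
    also have "j - (2 * r + 1) = 0" by (simp add: j_def)
    finally show ?thesis unfolding kernel_fps_nth_0_1 k e_def[symmetric] unfolding m shell_moment_mom
      by (simp add: algebra_simps)
  qed
  ultimately have "complex_of_real (\<Sum>i\<le>k. (- T / 24) ^ i / (fact i * fact (2 * k - 2 * i)) * 
     (0 ^ (2 * k - 2 * i) * of_int (cc i) + 1 * (T ^ (k - i) * (of_int (e i) * mom1 (k - i) + mom2 (k - i))))) = 0"
    by simp
  then have "(\<Sum>i\<le>k. (- 1 / 24) ^ i / (fact i * fact (2 * k - 2 * i)) * 
      (of_int (e i) * mom1 (k - i) + mom2 (k - i))) + (- 1 / 24) ^ k / fact k * of_int (cc k) = (0 :: real)"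
    unfolding of_real_eq_0_iff pure_scaling using T_pos by simp
  then show ?thesis using c(1) by (simp add: e_def cc_def j_def algebra_simps)
qed

text \<open>The case j = 2r, where the larger shell lies beyond the extracted coefficient and only
  the minimal vectors remain.\<close>

lemma lower_relation:
  assumes w: "4 * a + 6 * b + 2 * k = 4 * r + 2" and c: "kernel_cs a b k (2 * r) ! (2 * r) = c" "r \<le> 3"
  shows "(\<Sum>i\<le>k. (- 1 / 24) ^ i / (fact i * fact (2 * k - 2 * i)) * mom1 (k - i)) + (- 1 / 24) ^ k / fact k * of_int c = (0 :: real)"
proof -
  define j where "j = 2 * r"
  define cc where "cc i = kernel_cs a b i j ! j" for i
  have k: "fps_nth (kernel_fps a b i j) j = of_int (cc i)" for i
    using fps_agreesD[OF kernel_agrees, of j a b i j] c(2) by (simp add: cc_def length_kernel_cs j_def)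
  have "(\<Sum>i\<le>k. complex_of_real ((- T / 24) ^ i / (fact i * fact (2 * k - 2 * i))) * 
     (\<Sum>N=0..j. fps_nth (kernel_fps a b i j) (j - N) * of_real (shell_moment L x (2 * k - 2 * i) N))) = 0"
    by (rule residue_relation) (use w in \<open>simp add: j_def\<close>)
  moreover have "(\<Sum>N=0..j. fps_nth (kernel_fps a b i j) (j - N) * complex_of_real (shell_moment L x (2 * k - 2 * i) N))
      = of_real (0 ^ (2 * k - 2 * i) * of_int (cc i) + 1 * (T ^ (k - i) * mom1 (k - i)))" if "i \<le> k" for i
  proof -
    have m: "2 * k - 2 * i = 2 * (k - i)" by simp
    have "(\<Sum>N=0..j. fps_nth (kernel_fps a b i j) (j - N) * complex_of_real (shell_moment L x (2 * k - 2 * i) N)) =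
       fps_nth (kernel_fps a b i j) j * 0 ^ (2 * k - 2 * i) + fps_nth (kernel_fps a b i j) (j - 2 * r) * of_real (shell_moment L x (2 * k - 2 * i) (2 * r))"
      using sum_shells[of j "\<lambda>N. fps_nth (kernel_fps a b i j) (j - N)" "2 * k - 2 * i"] by (simp add: j_def)
    also have "j - 2 * r = 0" by (simp add: j_def)
    finally show ?thesis unfolding kernel_fps_nth_0_1 k unfolding m shell_moment_mom
      by (simp add: algebra_simps)
  qed
  ultimately have "complex_of_real (\<Sum>i\<le>k. (- T / 24) ^ i / (fact i * fact (2 * k - 2 * i)) * 
     (0 ^ (2 * k - 2 * i) * of_int (cc i) + 1 * (T ^ (k - i) * mom1 (k - i)))) = 0"
    by simp
  then have "(\<Sum>i\<le>k. (- 1 / 24) ^ i / (fact i * fact (2 * k - 2 * i)) * (1 * mom1 (k - i))) 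
      + (- 1 / 24) ^ k / fact k * of_int (cc k) = (0 :: real)"
    unfolding of_real_eq_0_iff pure_scaling using T_pos by simp
  then show ?thesis using c(1) by (simp add: cc_def j_def)
qed


text \<open>The list \<open>e\<close> holds the coefficients of a polynomial in the square of the
  inner product that vanishes at all its possible values; summed over the shell this relates even
  moments. Multiplying by the \<open>2 * s\<close>-th power gives further relations from the same
  polynomial.\<close>

lemma vanishing_relation:
  assumes bound: "\<And>y. y \<in> shell L (2 * real N) \<Longrightarrow> \<exists>z::int. x \<bullet> y = of_int z \<and> \<bar>z\<bar> \<le> M"
    and vanish: "\<forall>z\<in>set [- M..M]. (\<Sum>k\<leftarrow>[0..<length e]. e ! k * z ^ (2 * k)) = 0"
  shows "(\<Sum>k<length e. of_int (e ! k) * shell_moment L x (2 * (k + s)) N) = 0"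
proof -
  have "(\<Sum>k<length e. of_int (e ! k) * (x \<bullet> y) ^ (2 * (k + s))) = 0" if y: "y \<in> shell L (2 * real N)" for y
  proof -
    obtain z :: int where z: "x \<bullet> y = of_int z" "\<bar>z\<bar> \<le> M" using bound[OF y] by blast
    have "z \<in> set [- M..M]" using z(2) by auto
    then have "(\<Sum>k\<leftarrow>[0..<length e]. e ! k * z ^ (2 * k)) = 0" using vanish by blast
    then have "(\<Sum>k<length e. e ! k * z ^ (2 * k)) = 0"
      by (simp add: interv_sum_list_conv_sum_set_nat atLeast0LessThan)
    then have "of_int (z ^ (2 * s) * (\<Sum>k<length e. e ! k * z ^ (2 * k))) = (0 :: real)" by simp
    also have "z ^ (2 * s) * (\<Sum>k<length e. e ! k * z ^ (2 * k)) = (\<Sum>k<length e. e ! k * z ^ (2 * (k + s)))"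
      unfolding sum_distrib_left by (rule sum.cong) (auto simp: power_add algebra_simps)
    finally show ?thesis by (simp add: z(1))
  qed
  then have "(\<Sum>y\<in>shell L (2 * real N). \<Sum>k<length e. of_int (e ! k) * (x \<bullet> y) ^ (2 * (k + s))) = 0"
    by (intro sum.neutral) auto
  then show ?thesis
    by (subst (asm) sum.swap) (simp add: shell_moment_def sum_distrib_left)
qed


lemma vanishing_relation_mom:
  assumes "N = 2 * r \<and> \<sigma> = mom1 \<or> N = 2 * r + 1 \<and> \<sigma> = mom2"
    and "\<And>y. y \<in> shell L (2 * real N) \<Longrightarrow> \<exists>z::int. x \<bullet> y = of_int z \<and> \<bar>z\<bar> \<le> M"
    and "\<forall>z\<in>set [- M..M]. (\<Sum>k\<leftarrow>[0..<length e]. e ! k * z ^ (2 * k)) = 0"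
  shows "(\<Sum>k\<leftarrow>[0..<length e]. of_int (e ! k) * (T ^ k * \<sigma> (k + s))) = 0"
proof -
  have "shell_moment L x (2 * (k + s)) N = T ^ s * (T ^ k * \<sigma> (k + s))" for k
    using assms(1) by (elim disjE conjE) (simp_all only: shell_moment_mom power_add mult.assoc mult.left_commute)
  then have "T ^ s * (\<Sum>k<length e. of_int (e ! k) * (T ^ k * \<sigma> (k + s))) 
      = (\<Sum>k<length e. of_int (e ! k) * shell_moment L x (2 * (k + s)) N)"
    unfolding sum_distrib_left by (intro sum.cong) (simp_all only: mult.left_commute)
  also have "\<dots> = 0" using assms(2,3) by (rule vanishing_relation)
  finally show ?thesis using T_pos by (simp add: interv_sum_list_conv_sum_set_nat atLeast0LessThan)
qed

end

section \<open>Elimination in ranks 40, 80 and 120\<close>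

lemma sum_atMost_upt: "(\<Sum>i\<le>k. f i) = (\<Sum>i\<leftarrow>[0..<Suc k]. f i)"
  by (simp add: interv_sum_list_conv_sum_set_nat atLeast0LessThan lessThan_Suc_atMost del: upt_Suc)

lemmas relation_simps =
  sum_atMost_upt upt_rec fact_numeral power_divide add_divide_distrib diff_divide_distrib

text \<open>Contributions of the zero vector. The first three entries solve 4a + 6b + 2k = 6 with j
  = 2, the others 4a + 6b + 2k = 18 with j = 3, each with i = k.\<close>

lemma kernel_1_values:
  "kernel_cs 0 1 0 2 ! 2 = -39600"
  "kernel_cs 1 0 1 2 ! 2 = 7920"
  "kernel_cs 0 0 3 2 ! 2 = -720"
  "kernel_cs 3 1 0 3 ! 3 = -99264000"
  "kernel_cs 4 0 1 3 ! 3 = 79411200"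
  "kernel_cs 2 1 2 3 ! 3 = -43000320"
  "kernel_cs 3 0 3 3 ! 3 = 16235520"
  "kernel_cs 1 1 4 3 ! 3 = -1666560"
  by code_simp+

text \<open>
  The residue relations determine the scaled moments up to the two unknowns \<open>p\<close> and \<open>q\<close>. Since the
  inner products with the shell vectors are small integers, a product of factors \<open>u - i\<^sup>2\<close>
  with \<open>u = (x \<bullet> y)\<^sup>2\<close> vanishes on each shell, which gives the equations V1, V2 and V3.
  Eliminating \<open>p\<close> and \<open>q\<close> from them leaves \<open>C = 0\<close> for a polynomial \<open>C\<close> in \<open>T\<close> whose expansion
  at the least admissible value of \<open>T\<close> has positive coefficients.
\<close>

lemma (in extremal_vector) no_minimal_vector_1:
  assumes r: "r = 1"
    and shell1: "\<And>y. y \<in> shell L (2 * real (2 * r)) \<Longrightarrow>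
      \<exists>z::int. x \<bullet> y = of_int z \<and> \<bar>z\<bar> \<le> 2 * int r"
    and shell2: "\<And>y. y \<in> shell L (2 * real (2 * r + 1)) \<Longrightarrow>
      \<exists>z::int. x \<bullet> y = of_int z \<and> \<bar>z\<bar> \<le> 2 * int r + 1"
    and T: "T \<ge> 8"
  shows False
proof -
  \<comment> \<open>\<open>mom1 2\<close> is not determined, since 4a + 6b = 2 has no solution;
    \<open>mom1 4\<close>, called \<open>q\<close> next, lies beyond the range 2k <= 6 of the lower
    relations.\<close>
  define p where "p = mom1 2"
  define q where "q = mom1 4"
  note M = kernel_1_values p_def[symmetric] q_def[symmetric]
  \<comment> \<open>This is the number of vectors of norm 4; \<open>mom2 0\<close> below counts
    those of norm 6.\<close>
  have "mom1 0 = 39600"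
    using lower_relation[of 0 1 0 "-39600"] M by (simp add: r relation_simps; linarith)
  note M = M this
  have "mom1 1 = 3960"
    using lower_relation[of 1 0 1 "7920"] M by (simp add: r relation_simps; linarith)
  note M = M this
  have "mom1 3 = - 900 + 5 / 4 * p"
    using lower_relation[of 0 0 3 "-720"] M by (simp add: r relation_simps; linarith)
  note M = M this
  have "mom2 0 = 87859200"
    using upper_relation[of 3 1 0 "-99264000"] M by (simp add: r relation_simps; linarith)
  note M = M this
  have "mom2 1 = 13178880"
    using upper_relation[of 4 0 1 "79411200"] M by (simp add: r relation_simps; linarith)
  note M = M this
  have "mom2 2 = 5702400 - 48 * p"
    using upper_relation[of 2 1 2 "-43000320"] M by (simp add: r relation_simps; linarith)
  note M = M this
  have "mom2 3 = 3952800 - 90 * p"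
    using upper_relation[of 3 0 3 "16235520"] M by (simp add: r relation_simps; linarith)
  note M = M this
  have "mom2 4 = 3931200 - 420 * p + 192 * q"
    using upper_relation[of 1 1 4 "-1666560"] M by (simp add: r relation_simps; linarith)
  note M = M this
  let ?V1 = "(15840 * T - 900 * T ^ 3) + (- 5 * T ^ 2 + 5 / 4 * T ^ 3) * p"
  have V1: "?V1 = 0"
  proof -
    \<comment> \<open>The coefficients of u (u - 1) (u - 4); V2 uses the same product multiplied
      once more by u.\<close>
    let ?e = "[0, 4, -5, 1] :: int list"
    have "(\<Sum>k\<leftarrow>[0..<length ?e]. of_int (?e ! k) * (T ^ k * mom1 (k + 0))) = 0"
      by (rule vanishing_relation_mom[where M = 2 and N = "2 * r"], simp, use shell1 r in fastforce, code_simp)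
    then have "4 * (T ^ 1 * mom1 1) - 5 * (T ^ 2 * mom1 2) + (T ^ 3 *
        mom1 3) = 0"
      by (simp add: upt_rec eval_nat_numeral algebra_simps)
    then show ?thesis using M by (simp add: algebra_simps)
  qed
  let ?V2 = "(4500 * T ^ 2) + (4 * T - 25 / 4 * T ^ 2) * p + (T ^ 3) * q"
  have V2: "?V2 = 0"
  proof -
    let ?e = "[0, 4, -5, 1] :: int list"
    have "(\<Sum>k\<leftarrow>[0..<length ?e]. of_int (?e ! k) * (T ^ k * mom1 (k + 1))) = 0"
      by (rule vanishing_relation_mom[where M = 2 and N = "2 * r"], simp, use shell1 r in fastforce, code_simp)
    then have "4 * (T ^ 1 * mom1 2) - 5 * (T ^ 2 * mom1 3) + (T ^ 3 *
        mom1 4) = 0"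
      by (simp add: upt_rec eval_nat_numeral algebra_simps)
    then show ?thesis using M by (simp add: algebra_simps)
  qed
  let ?V3 = "(- 474439680 * T + 279417600 * T ^ 2 - 55339200 * T ^ 3 + 3931200 * T ^ 4) + (- 2352
      * T ^ 2 + 1260 * T ^ 3 - 420 * T ^ 4) * p + (192 * T ^ 4) * q"
  have V3: "?V3 = 0"
  proof -
    let ?e = "[0, -36, 49, -14, 1] :: int list"
    have "(\<Sum>k\<leftarrow>[0..<length ?e]. of_int (?e ! k) * (T ^ k * mom2 (k + 0))) = 0"
      by (rule vanishing_relation_mom[where M = 3 and N = "2 * r + 1"], simp, use shell2 r in fastforce, code_simp)
    then have "- 36 * (T ^ 1 * mom2 1) + 49 * (T ^ 2 * mom2 2) - 14 * (T ^
        3 * mom2 3) + (T ^ 4 * mom2 4) = 0"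
      by (simp add: upt_rec eval_nat_numeral algebra_simps)
    then show ?thesis using M by (simp add: algebra_simps)
  qed
  define u where "u = T - 8"
  have "u \<ge> 0" using T by (simp add: u_def)
  define C where "C = 8008 - 6710 * T + 2097 * T ^ 2 - 290 * T ^ 3 + 15 * T ^ 4"
  have "C = 1496 + 1882 * u + 897 * u ^ 2 + 190 * u ^ 3 + 15 * u ^ 4"
    by (simp add: C_def u_def eval_nat_numeral algebra_simps)
  then have "C > 0" using \<open>u \<ge> 0\<close> by (simp add: add_pos_nonneg)
  \<comment> \<open>The multipliers are polynomials in T for which the coefficients of
    \<open>p\<close> and \<open>q\<close> cancel, so the three equations leave a condition on T
    alone.\<close>
  moreover have "T ^ 3 * C = (- 1 / 60480 * T ^ 2 + 1 / 241920 * T ^ 3) * (?V3) + (1 / 315 * T ^ 3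
      - 1 / 1260 * T ^ 4) * (?V2) + (13 / 1260 * T ^ 2 - 41 / 5040 * T ^ 3 + 1 / 720 * T ^ 4) *
      (?V1)"
    by (simp add: C_def eval_nat_numeral algebra_simps)
  then have "T ^ 3 * C = 0" unfolding V1 V2 V3 by simp
  ultimately show False using T_pos by simp
qed

lemma kernel_2_values:
  "kernel_cs 1 1 0 4 ! 4 = -1250172000"
  "kernel_cs 2 0 1 4 ! 4 = 250034400"
  "kernel_cs 0 1 2 4 ! 4 = -6098400"
  "kernel_cs 1 0 3 4 ! 4 = -11325600"
  "kernel_cs 0 0 5 4 ! 4 = 1029600"
  "kernel_cs 4 1 0 5 ! 5 = -8261500262400"
  "kernel_cs 5 0 1 5 ! 5 = 4130750131200"
  "kernel_cs 3 1 2 5 ! 5 = -1485543628800"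
  "kernel_cs 4 0 3 5 ! 5 = 369218995200"
  "kernel_cs 2 1 4 5 ! 5 = -20209305600"
  "kernel_cs 3 0 5 5 ! 5 = -28053734400"
  "kernel_cs 1 1 6 5 ! 5 = 8637788160"
  by code_simp+

text \<open>Now 4a + 6b + 2k is 10 and 22. The gap 4a + 6b = 2 leaves \<open>mom1 4\<close> free and
  \<open>mom1 6\<close> is out of reach of the lower relations; the vanishing products run up to the
  factors u - 16 and u - 25.\<close>

lemma (in extremal_vector) no_minimal_vector_2:
  assumes r: "r = 2"
    and shell1: "\<And>y. y \<in> shell L (2 * real (2 * r)) \<Longrightarrow>
      \<exists>z::int. x \<bullet> y = of_int z \<and> \<bar>z\<bar> \<le> 2 * int r"
    and shell2: "\<And>y. y \<in> shell L (2 * real (2 * r + 1)) \<Longrightarrow>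
      \<exists>z::int. x \<bullet> y = of_int z \<and> \<bar>z\<bar> \<le> 2 * int r + 1"
    and T: "T \<ge> 12"
  shows False
proof -
  define p where "p = mom1 4"
  define q where "q = mom1 6"
  note M = kernel_2_values p_def[symmetric] q_def[symmetric]
  have "mom1 0 = 1250172000"
    using lower_relation[of 1 1 0 "-1250172000"] M by (simp add: r relation_simps; linarith)
  note M = M this
  have "mom1 1 = 125017200"
    using lower_relation[of 2 0 1 "250034400"] M by (simp add: r relation_simps; linarith)
  note M = M this
  have "mom1 2 = 36590400"
    using lower_relation[of 0 1 2 "-6098400"] M by (simp add: r relation_simps; linarith)
  note M = M this
  have "mom1 3 = 17424000"
    using lower_relation[of 1 0 3 "-11325600"] M by (simp add: r relation_simps; linarith)
  note M = M this
  have "mom1 5 = - 33264000 + 15 / 4 * p"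
    using lower_relation[of 0 0 5 "1029600"] M by (simp add: r relation_simps; linarith)
  note M = M this
  have "mom2 0 = 7541401190400"
    using upper_relation[of 4 1 0 "-8261500262400"] M by (simp add: r relation_simps; linarith)
  note M = M this
  have "mom2 1 = 942675148800"
    using upper_relation[of 5 0 1 "4130750131200"] M by (simp add: r relation_simps; linarith)
  note M = M this
  have "mom2 2 = 344881152000"
    using upper_relation[of 3 1 2 "-1485543628800"] M by (simp add: r relation_simps; linarith)
  note M = M this
  have "mom2 3 = 205286400000"
    using upper_relation[of 4 0 3 "369218995200"] M by (simp add: r relation_simps; linarith)
  note M = M this
  have "mom2 4 = 168182784000 - 96 * p"
    using upper_relation[of 2 1 4 "-20209305600"] M by (simp add: r relation_simps; linarith)
  note M = M this
  have "mom2 5 = 175996800000 - 450 * p"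
    using upper_relation[of 3 0 5 "-28053734400"] M by (simp add: r relation_simps; linarith)
  note M = M this
  have "mom2 6 = 241257139200 - 2970 * p + 144 * q"
    using upper_relation[of 1 1 6 "8637788160"] M by (simp add: r relation_simps; linarith)
  note M = M this
  let ?V1 = "(72009907200 * T - 30004128000 * T ^ 2 + 4756752000 * T ^ 3 - 33264000 * T ^ 5) + (-
      30 * T ^ 4 + 15 / 4 * T ^ 5) * p"
  have V1: "?V1 = 0"
  proof -
    let ?e = "[0, 576, -820, 273, -30, 1] :: int list"
    have "(\<Sum>k\<leftarrow>[0..<length ?e]. of_int (?e ! k) * (T ^ k * mom1 (k + 0))) = 0"
      by (rule vanishing_relation_mom[where M = 4 and N = "2 * r"], simp, use shell1 r in fastforce, code_simp)
    then have "576 * (T ^ 1 * mom1 1) - 820 * (T ^ 2 * mom1 2) + 273 * (T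
        ^ 3 * mom1 3) - 30 * (T ^ 4 * mom1 4) + (T ^ 5 * mom1
        5) = 0"
      by (simp add: upt_rec eval_nat_numeral algebra_simps)
    then show ?thesis using M by (simp add: algebra_simps)
  qed
  let ?V2 = "(21076070400 * T - 14287680000 * T ^ 2 + 997920000 * T ^ 4) + (273 * T ^ 3 - 225 / 2
      * T ^ 4) * p + (T ^ 5) * q"
  have V2: "?V2 = 0"
  proof -
    let ?e = "[0, 576, -820, 273, -30, 1] :: int list"
    have "(\<Sum>k\<leftarrow>[0..<length ?e]. of_int (?e ! k) * (T ^ k * mom1 (k + 1))) = 0"
      by (rule vanishing_relation_mom[where M = 4 and N = "2 * r"], simp, use shell1 r in fastforce, code_simp)
    then have "576 * (T ^ 1 * mom1 2) - 820 * (T ^ 2 * mom1 3) + 273 * (T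
        ^ 3 * mom1 4) - 30 * (T ^ 4 * mom1 5) + (T ^ 5 * mom1
        6) = 0"
      by (simp add: upt_rec eval_nat_numeral algebra_simps)
    then show ?thesis using M by (simp add: algebra_simps)
  qed
  let ?V3 = "(- 13574522142720000 * T + 7268715159552000 * T ^ 2 - 1569414528000000 * T ^ 3 +
      172050988032000 * T ^ 4 - 9679824000000 * T ^ 5 + 241257139200 * T ^ 6) + (- 98208 * T ^ 4 +
      24750 * T ^ 5 - 2970 * T ^ 6) * p + (144 * T ^ 6) * q"
  have V3: "?V3 = 0"
  proof -
    let ?e = "[0, -14400, 21076, -7645, 1023, -55, 1] :: int list"
    have "(\<Sum>k\<leftarrow>[0..<length ?e]. of_int (?e ! k) * (T ^ k * mom2 (k + 0))) = 0"
      by (rule vanishing_relation_mom[where M = 5 and N = "2 * r + 1"], simp, use shell2 r in fastforce, code_simp)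
    then have "- 14400 * (T ^ 1 * mom2 1) + 21076 * (T ^ 2 * mom2 2) -
        7645 * (T ^ 3 * mom2 3) + 1023 * (T ^ 4 * mom2 4) - 55 * (T ^ 5 *
        mom2 5) + (T ^ 6 * mom2 6) = 0"
      by (simp add: upt_rec eval_nat_numeral algebra_simps)
    then show ?thesis using M by (simp add: algebra_simps)
  qed
  define u where "u = T - 12"
  have "u \<ge> 0" using T by (simp add: u_def)
  define C where "C = 696679872 - 460875016 * T + 127538114 * T ^ 2 - 18911035 * T ^ 3 + 1585715 *
      T ^ 4 - 71338 * T ^ 5 + 1346 * T ^ 6"
  have "C = 2743104 + 4178072 * u + 2737814 * u ^ 2 + 994325 * u ^ 3 + 212795 * u ^ 4 + 25574 * u
      ^ 5 + 1346 * u ^ 6"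
    by (simp add: C_def u_def eval_nat_numeral algebra_simps)
  then have "C > 0" using \<open>u \<ge> 0\<close> by (simp add: add_pos_nonneg)
  moreover have "T ^ 5 * C = (- 1 / 19958400 * T ^ 4 + 1 / 159667200 * T ^ 5) * (?V3) + (1 /
      138600 * T ^ 5 - 1 / 1108800 * T ^ 6) * (?V2) + (191 / 831600 * T ^ 4 - 13 / 190080 * T ^ 5
      + 1 / 201600 * T ^ 6) * (?V1)"
    by (simp add: C_def eval_nat_numeral algebra_simps)
  then have "T ^ 5 * C = 0" unfolding V1 V2 V3 by simp
  ultimately show False using T_pos by simp
qed

lemma kernel_3_values:
  "kernel_cs 2 1 0 6 ! 6 = -45792819072000"
  "kernel_cs 3 0 1 6 ! 6 = 9158563814400"
  "kernel_cs 1 1 2 6 ! 6 = -750701952000"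
  "kernel_cs 2 0 3 6 ! 6 = -198572774400"
  "kernel_cs 0 1 4 6 ! 6 = 54659404800"
  "kernel_cs 1 0 5 6 ! 6 = 8994585600"
  "kernel_cs 0 0 7 6 ! 6 = -817689600"
  "kernel_cs 5 1 0 7 ! 7 = -446519236939776000"
  "kernel_cs 6 0 1 7 ! 7 = 178607694775910400"
  "kernel_cs 4 1 2 7 ! 7 = -52944820914585600"
  "kernel_cs 5 0 3 7 ! 7 = 11317435947417600"
  "kernel_cs 3 1 4 7 ! 7 = -777729989836800"
  "kernel_cs 4 0 5 7 ! 7 = -512907249254400"
  "kernel_cs 2 1 6 7 ! 7 = 172210655232000"
  "kernel_cs 3 0 7 7 ! 7 = 15316903526400"
  "kernel_cs 1 1 8 7 ! 7 = -20362619289600"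
  by code_simp+

text \<open>Here 4a + 6b + 2k is 14 and 26, the free unknowns are \<open>mom1 6\<close> and
  \<open>mom1 8\<close>, and the vanishing products end with u - 36 and u - 49.\<close>

lemma (in extremal_vector) no_minimal_vector_3:
  assumes r: "r = 3"
    and shell1: "\<And>y. y \<in> shell L (2 * real (2 * r)) \<Longrightarrow>
      \<exists>z::int. x \<bullet> y = of_int z \<and> \<bar>z\<bar> \<le> 2 * int r"
    and shell2: "\<And>y. y \<in> shell L (2 * real (2 * r + 1)) \<Longrightarrow>
      \<exists>z::int. x \<bullet> y = of_int z \<and> \<bar>z\<bar> \<le> 2 * int r + 1"
    and T: "T \<ge> 16"
  shows False
proof -
  define p where "p = mom1 6"
  define q where "q = mom1 8"
  note M = kernel_3_values p_def[symmetric] q_def[symmetric]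
  have "mom1 0 = 45792819072000"
    using lower_relation[of 2 1 0 "-45792819072000"] M by (simp add: r relation_simps; linarith)
  note M = M this
  have "mom1 1 = 4579281907200"
    using lower_relation[of 3 0 1 "9158563814400"] M by (simp add: r relation_simps; linarith)
  note M = M this
  have "mom1 2 = 1351263513600"
    using lower_relation[of 1 1 2 "-750701952000"] M by (simp add: r relation_simps; linarith)
  note M = M this
  have "mom1 3 = 653837184000"
    using lower_relation[of 2 0 3 "-198572774400"] M by (simp add: r relation_simps; linarith)
  note M = M this
  have "mom1 4 = 435891456000"
    using lower_relation[of 0 1 4 "54659404800"] M by (simp add: r relation_simps; linarith)
  note M = M this
  have "mom1 5 = 367783416000"
    using lower_relation[of 1 0 5 "8994585600"] M by (simp add: r relation_simps; linarith)
  note M = M this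
  have "mom1 7 = - 2390592204000 + 91 / 12 * p"
    using lower_relation[of 0 0 7 "-817689600"] M by (simp add: r relation_simps; linarith)
  note M = M this
  have "mom2 0 = 406954241261568000"
    using upper_relation[of 5 1 0 "-446519236939776000"] M by (simp add: r relation_simps; linarith)
  note M = M this
  have "mom2 1 = 47477994813849600"
    using upper_relation[of 6 0 1 "178607694775910400"] M by (simp add: r relation_simps; linarith)
  note M = M this
  have "mom2 2 = 16344883460505600"
    using upper_relation[of 4 1 2 "-52944820914585600"] M by (simp add: r relation_simps; linarith)
  note M = M this
  have "mom2 3 = 9226950340608000"
    using upper_relation[of 5 0 3 "11317435947417600"] M by (simp add: r relation_simps; linarith)
  note M = M this
  have "mom2 4 = 7176516931584000"
    using upper_relation[of 3 1 4 "-777729989836800"] M by (simp add: r relation_simps; linarith)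
  note M = M this
  have "mom2 5 = 7064383854528000"
    using upper_relation[of 4 0 5 "-512907249254400"] M by (simp add: r relation_simps; linarith)
  note M = M this
  have "mom2 6 = 8422353390528000 - 144 * p"
    using upper_relation[of 2 1 6 "172210655232000"] M by (simp add: r relation_simps; linarith)
  note M = M this
  have "mom2 7 = 12014258256000000 - 1274 * p"
    using upper_relation[of 3 0 7 "15316903526400"] M by (simp add: r relation_simps; linarith)
  note M = M this
  have "mom2 8 = 22103783301600000 - 10920 * p + 96 * q"
    using upper_relation[of 1 1 8 "-20362619289600"] M by (simp add: r relation_simps; linarith)
  note M = M this
  let ?V1 = "(2373899740692480000 * T - 1044710467850649600 * T ^ 2 + 193729342270464000 * T ^ 3 -
      19385400722688000 * T ^ 4 + 1104453598248000 * T ^ 5 - 2390592204000 * T ^ 7) + (- 91 * T ^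
      6 + 91 / 12 * T ^ 7) * p"
  have V1: "?V1 = 0"
  proof -
    let ?e = "[0, 518400, -773136, 296296, -44473, 3003, -91, 1] :: int list"
    have "(\<Sum>k\<leftarrow>[0..<length ?e]. of_int (?e ! k) * (T ^ k * mom1 (k + 0))) = 0"
      by (rule vanishing_relation_mom[where M = 6 and N = "2 * r"], simp, use shell1 r in fastforce, code_simp)
    then have "518400 * (T ^ 1 * mom1 1) - 773136 * (T ^ 2 * mom1 2) +
        296296 * (T ^ 3 * mom1 3) - 44473 * (T ^ 4 * mom1 4) + 3003 * (T ^
        5 * mom1 5) - 91 * (T ^ 6 * mom1 6) + (T ^ 7 * mom1 7)
        = 0"
      by (simp add: upt_rec eval_nat_numeral algebra_simps)
    then show ?thesis using M by (simp add: algebra_simps)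
  qed
  let ?V2 = "(700495005450240000 * T - 505505065089024000 * T ^ 2 + 129152894846976000 * T ^ 3 -
      16356431859768000 * T ^ 4 + 217543890564000 * T ^ 6) + (3003 * T ^ 5 - 8281 / 12 * T ^ 6) *
      p + (T ^ 7) * q"
  have V2: "?V2 = 0"
  proof -
    let ?e = "[0, 518400, -773136, 296296, -44473, 3003, -91, 1] :: int list"
    have "(\<Sum>k\<leftarrow>[0..<length ?e]. of_int (?e ! k) * (T ^ k * mom1 (k + 1))) = 0"
      by (rule vanishing_relation_mom[where M = 6 and N = "2 * r"], simp, use shell1 r in fastforce, code_simp)
    then have "518400 * (T ^ 1 * mom1 2) - 773136 * (T ^ 2 * mom1 3) +
        296296 * (T ^ 3 * mom1 4) - 44473 * (T ^ 4 * mom1 5) + 3003 * (T ^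
        5 * mom1 6) - 91 * (T ^ 6 * mom1 7) + (T ^ 7 * mom1 8)
        = 0"
      by (simp add: upt_rec eval_nat_numeral algebra_simps)
    then show ?thesis using M by (simp add: algebra_simps)
  qed
  let ?V3 = "(- 1206017033063481999360000 * T + 627677260722877523558400 * T ^ 2 -
      141095202906454917120000 * T ^ 3 + 17765273898179039232000 * T ^ 4 - 1353677234204655360000
      * T ^ 5 + 62847601000119936000 * T ^ 6 - 1681996155840000000 * T ^ 7 + 22103783301600000 * T
      ^ 8) + (- 1074528 * T ^ 6 + 178360 * T ^ 7 - 10920 * T ^ 8) * p + (96 * T ^ 8) * q"
  have V3: "?V3 = 0"
  proof -
    let ?e = "[0, -25401600, 38402064, -15291640, 2475473, -191620, 7462, -140, 1] :: int list"
    have "(\<Sum>k\<leftarrow>[0..<length ?e]. of_int (?e ! k) * (T ^ k * mom2 (k + 0))) = 0"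
      by (rule vanishing_relation_mom[where M = 7 and N = "2 * r + 1"], simp, use shell2 r in fastforce, code_simp)
    then have "- 25401600 * (T ^ 1 * mom2 1) + 38402064 * (T ^ 2 * mom2 2)
        - 15291640 * (T ^ 3 * mom2 3) + 2475473 * (T ^ 4 * mom2 4) -
        191620 * (T ^ 5 * mom2 5) + 7462 * (T ^ 6 * mom2 6) - 140 * (T ^ 7
        * mom2 7) + (T ^ 8 * mom2 8) = 0"
      by (simp add: upt_rec eval_nat_numeral algebra_simps)
    then show ?thesis using M by (simp add: algebra_simps)
  qed
  define u where "u = T - 16"
  have "u \<ge> 0" using T by (simp add: u_def)
  define C where "C = 30382329692160 - 18356571389952 * T + 4878079229952 * T ^ 2 - 744972993024 *
      T ^ 3 + 71538520768 * T ^ 4 - 4424788544 * T ^ 5 + 172199772 * T ^ 6 - 3856240 * T ^ 7 +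
      38055 * T ^ 8"
  have "C = 3723231232 + 6098468864 * u + 4488306688 * u ^ 2 + 1949265408 * u ^ 3 + 550068928 * u
      ^ 4 + 104147008 * u ^ 5 + 13079132 * u ^ 6 + 1014800 * u ^ 7 + 38055 * u ^ 8"
    by (simp add: C_def u_def eval_nat_numeral algebra_simps)
  then have "C > 0" using \<open>u \<ge> 0\<close> by (simp add: add_pos_nonneg)
  moreover have "T ^ 7 * C = (- 1 / 40864824000 * T ^ 6 + 1 / 490377888000 * T ^ 7) * (?V3) + (1 /
      425675250 * T ^ 7 - 1 / 5108103000 * T ^ 8) * (?V2) + (2 / 5457375 * T ^ 6 - 2 / 30405375 *
      T ^ 7 + 1 / 340540200 * T ^ 8) * (?V1)"
    by (simp add: C_def eval_nat_numeral algebra_simps)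
  then have "T ^ 7 * C = 0" unfolding V1 V2 V3 by simp
  ultimately show False using T_pos by simp
qed

section \<open>Generation by two shells\<close>

text \<open>Norms in an even lattice are natural numbers, so a least one exists in any nonempty part
  of L.\<close>

lemma minimal_vector_outside_sublattice:
  fixes L :: "'a::real_inner set"
  assumes even: "even_lattice L" and ne: "\<exists>x\<in>L. x \<notin> M"
  obtains x where "x \<in> L" "x \<notin> M" "\<And>y. y \<in> L \<Longrightarrow> y \<notin> M \<Longrightarrow> x \<bullet> x \<le> y \<bullet> y"
proof -
  define f where "f y = nat \<lfloor>y \<bullet> y\<rfloor>" for y :: 'a
  have f: "y \<bullet> y = real (f y)" if "y \<in> L" for y
  proof -
    have "\<exists>k::int. y \<bullet> y = 2 * of_int k" using even that by (simp add: even_lattice_def)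
    then obtain k :: int where k: "y \<bullet> y = 2 * of_int k" ..
    from k have "y \<bullet> y = of_int (2 * k)" by simp
    moreover have "0 \<le> k" using k inner_ge_zero[of y] by simp
    ultimately show ?thesis by (simp add: f_def)
  qed
  obtain x0 where "x0 \<in> L \<and> x0 \<notin> M" using ne by blast
  from ex_has_least_nat[of "\<lambda>y. y \<in> L \<and> y \<notin> M", OF this, of f]
  obtain x where "x \<in> L \<and> x \<notin> M" "\<forall>y. y \<in> L \<and> y \<notin> M \<longrightarrow> f x \<le> f y" by blast
  then show ?thesis using that f by (metis of_nat_le_iff)
qed

theorem theorem3p1:
  fixes r :: nat and L :: "'a::real_inner set"
  assumes "r \<in> {1, 2, 3}"
    and "extremal_even_unimodular (40 * r) L"
  shows "L = two_shell_lattice L (real (4 * r)) (real (4 * r + 2))"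
proof -
  define M where "M = two_shell_lattice L (real (4 * r)) (real (4 * r + 2))"
  have rank: "lattice_of_rank (40 * r) L" and even: "even_lattice L" and uni: "unimodular L"
    and mn: "is_min_norm L (real (2 * (40 * r div 24) + 2))"
    using assms(2) by (auto simp: extremal_even_unimodular_def)
  \<comment> \<open>The quotients are 1, 3 and 5; the pattern 2r - 1 breaks at r = 4.\<close>
  have "2 * (40 * r div 24) + 2 = 4 * r" using assms(1) by auto
  then have min: "real (4 * r) \<le> y \<bullet> y" if "y \<in> L" "y \<noteq> 0" for y
    using mn that by (simp only: is_min_norm_def) blast
  have sub_L: "zmod.subspace L"
    using rank by (auto simp: lattice_of_rank_def zmod.subspace_span)
  have sub_M: "zmod.subspace M" by (simp add: M_def two_shell_lattice_def zmod.subspace_span)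
  have shell_M: "y \<in> M" if "y \<in> shell L (real (4 * r)) \<union> shell L (real (4 * r + 2))" for y
    unfolding M_def two_shell_lattice_def using that by (rule zmod.span_base)
  have "M \<subseteq> L" unfolding M_def two_shell_lattice_def
    by (rule zmod.span_minimal[OF _ sub_L]) (auto simp: shell_def)
  moreover have "L \<subseteq> M"
  proof (rule ccontr)
    assume "\<not> L \<subseteq> M"
    then have "\<exists>x\<in>L. x \<notin> M" by blast
    then obtain x where x: "x \<in> L" "x \<notin> M" and least: "\<And>y. y \<in> L \<Longrightarrow> y \<notin> M \<Longrightarrow> x \<bullet> x \<le> y \<bullet> y"
      using minimal_vector_outside_sublattice[OF even] by blast
    have "x \<noteq> 0" using x(2) zmod.subspace_0[OF sub_M] by blast
    have bound: "\<exists>z::int. x \<bullet> y = of_int z \<and> \<bar>z\<bar> \<le> int N" if y: "y \<in> L" "y \<in> M" "y \<bullet> y = 2 * real N" for y N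
    proof -
      have "x \<bullet> y \<in> \<int>" using uni x(1) y(1) unfolding unimodular_def dual_lattice_def by blast
      then obtain z :: int where z: "x \<bullet> y = of_int z" by (auto elim: Ints_cases)
      have "x - y \<in> L" "x + y \<in> L" using x(1) y(1) zmod.subspace_diff[OF sub_L] zmod.subspace_add[OF sub_L] by auto
      moreover have "x - y \<notin> M" using x(2) zmod.subspace_add[OF sub_M _ y(2), of "x - y"] by auto
      moreover have "x + y \<notin> M" using x(2) zmod.subspace_diff[OF sub_M _ y(2), of "x + y"] by auto
      ultimately have "x \<bullet> x \<le> (x - y) \<bullet> (x - y)" "x \<bullet> x \<le> (x + y) \<bullet> (x + y)" using least by auto
      then have "\<bar>x \<bullet> y\<bar> \<le> real N"
        using y(3) by (simp add: inner_diff_left inner_diff_right inner_add_left inner_add_right inner_commute)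
      then show ?thesis using z by (intro exI[of _ z]) auto
    qed
    interpret v: extremal_vector r L x
    proof
      show "r > 0" using assms(1) by auto
      show "real (4 * r) \<le> y \<bullet> y" if "y \<in> L" "y \<noteq> 0" for y using min that .
    qed (fact rank even uni x(1) \<open>x \<noteq> 0\<close>)+
    have shell1: "\<exists>z::int. x \<bullet> y = of_int z \<and> \<bar>z\<bar> \<le> 2 * int r" if "y \<in> shell L (2 * real (2 * r))" for y
      using bound[of y "2 * r"] shell_M[of y] that by (auto simp: shell_def)
    have shell2: "\<exists>z::int. x \<bullet> y = of_int z \<and> \<bar>z\<bar> \<le> 2 * int r + 1" if "y \<in> shell L (2 * real (2 * r + 1))" for y
      using bound[of y "2 * r + 1"] shell_M[of y] that by (auto simp: shell_def)
    have "real (4 * r) + 4 \<le> v.T"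
    proof -
      obtain k :: int where k: "x \<bullet> x = 2 * of_int k" using even x(1) unfolding even_lattice_def by blast
      have "real (4 * r) \<le> x \<bullet> x" using min x(1) \<open>x \<noteq> 0\<close> by blast
      then have "2 * int r \<le> k" using k by linarith
      \<comment> \<open>A vector of either norm would lie in its shell and hence in
        \<open>M\<close>; evenness then makes 4r + 4 the next possible norm.\<close>
      moreover have "x \<bullet> x \<noteq> real (4 * r)" "x \<bullet> x \<noteq> real (4 * r + 2)" using shell_M[of x] x by (auto simp: shell_def)
      then have "k \<noteq> 2 * int r" "k \<noteq> 2 * int r + 1" using k by auto
      ultimately have "2 * int r + 2 \<le> k" by linarith
      then show ?thesis using k by (simp add: v.T_def)
    qed
    then show False
      using v.no_minimal_vector_1[OF _ shell1 shell2] v.no_minimal_vector_2[OF _ shell1 shell2]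
        v.no_minimal_vector_3[OF _ shell1 shell2] assms(1) by auto
  qed
  ultimately show ?thesis unfolding M_def by blast
qed

end
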